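(* Let $V$ be an irreducible uniformly bounded weight module for $(\mathcal{S}_N\ltimes A_N)\otimes B$ on which $t^{\mathbf{0}}$ acts non-trivially and $t^{\mathbf{s}}$ acts non-trivially for some $\mathbf{s}\neq\mathbf{0}$. Then for any $0\ne v\in V$ we have $\mathcal{U}(\mathcal{S}_N\ltimes A_N)\cdot v=V$.
   Context: All vector spaces, algebras and tensor products are over $\mathbb{C}$; $B$ is a finitely generated commutative associative unital algebra; $N\ge 2$ is an integer. $A_N=\mathbb{C}[t_1^{\pm1},\dots,t_N^{\pm1}]$, $t^{\mathbf{m}}=t_1^{m_1}\cdots t_N^{m_N}$, $d_i=t_i\frac{d}{dt_i}$, $(x,y)=\sum_ix_iy_i$. For $u\in\mathbb{C}^N$, $\mathbf{r}\in\mathbb{Z}^N$ put $D(u,\mathbf{r})=\sum_iu_it^{\mathbf{r}}d_i$; $\mathcal{S}_N=\mathrm{span}\{D(u,\mathbf{r})\mid(u,\mathbf{r})=0\}$ with $[D(u,\mathbf{r}),D(v,\mathbf{s})]=D((u,\mathbf{s})v-(v,\mathbf{r})u,\mathbf{r}+\mathbf{s})$. In $\mathcal{S}_N\ltimes A_N$, $A_N$ is an abelian ideal and $[D(u,\mathbf{r}),t^{\mathbf{s}}]=(u,\mathbf{s})t^{\mathbf{r}+\mathbf{s}}$. For a Lie algebra $\mathfrak{g}$, $\mathfrak{g}\otimes B$ has bracket $[x\otimes b_1,y\otimes b_2]=[x,y]\otimes b_1b_2$; identify $x$ with $x\otimes1$, so $\mathcal{S}_N\ltimes A_N\subseteq(\mathcal{S}_N\ltimes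 A_N)\otimes B$. $\mathcal{U}(\cdot)$ is the universal enveloping algebra. $\mathfrak{h}=\mathrm{span}\{d_1,\dots,d_N\}$. A uniformly bounded weight module is a module $V=\bigoplus_{\lambda\in\mathfrak{h}^*}V_\lambda$, $V_\lambda=\{v\mid hv=\lambda(h)v\ \forall h\in\mathfrak{h}\}$, for which there is a positive integer $M$ with $\dim V_\lambda\le M$ for all $\lambda$. *)

theory Defs
  imports "HOL-Analysis.Analysis" "HOL-Library.Poly_Mapping"
begin

section \<open>Complex vector spaces and algebras\<close>

text \<open>
  The ground field is fixed to the complex numbers throughout. As with
  \<^class>\<open>real_vector\<close>, a vector space is a type; linear algebra over it is imported from
  \<^locale>\<open>vector_space\<close>.
\<close>

class complex_space = ab_group_add +
  fixes cscale :: "complex \<Rightarrow> 'a \<Rightarrow> 'a"  (infixr "*\<^sub>C" 75)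
  assumes cscale_add_right: "c *\<^sub>C (x + y) = c *\<^sub>C x + c *\<^sub>C y"
    and cscale_add_left: "(c + d) *\<^sub>C x = c *\<^sub>C x + d *\<^sub>C x"
    and cscale_cscale: "c *\<^sub>C d *\<^sub>C x = (c * d) *\<^sub>C x"
    and cscale_one [simp]: "1 *\<^sub>C x = x"

global_interpretation cvs: vector_space "cscale :: complex \<Rightarrow> 'a \<Rightarrow> 'a :: complex_space"
  by unfold_locales (simp_all add: cscale_add_right cscale_add_left cscale_cscale)

abbreviation clinear :: "('a::complex_space \<Rightarrow> 'b::complex_space) \<Rightarrow> bool"
  where "clinear \<equiv> Vector_Spaces.linear cscale cscale"

lemma clinearI:
  assumes "\<And>x y. f (x + y) = f x + f y" "\<And>c x. f (c *\<^sub>C x) = c *\<^sub>C f x"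
  shows "clinear f"
  using assms
  by (auto simp: Vector_Spaces.linear_def module_hom_def module_hom_axioms_def
      cvs.vector_space_axioms cvs.module_axioms)

lemma clinearD:
  assumes "clinear f"
  shows "f (x + y) = f x + f y" "f (c *\<^sub>C x) = c *\<^sub>C f x"
  using assms
  by (auto simp: Vector_Spaces.linear_def module_hom_def module_hom_axioms_def)

lemma clinear_diff: "clinear f \<Longrightarrow> f (x - y) = f x - f y"
  using clinearD(1)[of f "x - y" y] by simp

lemma clinear_zero: "clinear f \<Longrightarrow> f 0 = 0"
  using clinear_diff[of f 0 0] by simp

lemma clinear_vanish_on_span:
  assumes "clinear f" "\<And>x. x \<in> S \<Longrightarrow> f x = 0" "x \<in> cvs.span S"
  shows "f x = 0"
  using assms(3)
proof (induction rule: cvs.span_induct_alt)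
  case base
  show ?case by (simp add: clinear_zero assms(1))
next
  case (step c x y)
  then show ?case using assms(1,2) by (simp add: clinearD)
qed

text \<open>The sort below does not include \<open>0 \<noteq> 1\<close>, so the zero algebra is allowed.\<close>

class complex_comm_algebra = complex_space + comm_ring + comm_monoid_mult +
  assumes cscale_mult: "(c *\<^sub>C x) * y = c *\<^sub>C (x * y)"

lemma cscale_mult_right: "x * (c *\<^sub>C y) = c *\<^sub>C (x * (y :: 'a :: complex_comm_algebra))"
  by (metis cscale_mult mult.commute)

definition is_subalgebra :: "'b::complex_comm_algebra set \<Rightarrow> bool"
  where "is_subalgebra S \<longleftrightarrow> cvs.subspace S \<and> 1 \<in> S \<and> (\<forall>x\<in>S. \<forall>y\<in>S. x * y \<in> S)"

definition finitely_generated_algebra :: "'b::complex_comm_algebra itself \<Rightarrow> bool"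
  where "finitely_generated_algebra _ \<longleftrightarrow>
    (\<exists>G :: 'b set. finite G \<and> is_subalgebra hull G = UNIV)"

instantiation complex :: complex_comm_algebra
begin
definition cscale_complex :: "complex \<Rightarrow> complex \<Rightarrow> complex" where "cscale_complex = (*)"
instance by standard (simp_all add: cscale_complex_def algebra_simps)
end

instantiation poly_mapping :: (type, complex_space) complex_space
begin
lift_definition cscale_poly_mapping :: "complex \<Rightarrow> ('a \<Rightarrow>\<^sub>0 'b) \<Rightarrow> ('a \<Rightarrow>\<^sub>0 'b)"
  is "\<lambda>c f k. c *\<^sub>C f k"
  by (erule finite_subset[rotated]) auto
instance
  by standard (transfer; simp add: cscale_add_right cscale_add_left cscale_cscale)+
end

lemma lookup_cscale [simp]: "Poly_Mapping.lookup (c *\<^sub>C p) k = c *\<^sub>C Poly_Mapping.lookup p k"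
  by transfer simp

instantiation vec :: (complex_space, finite) complex_space
begin
definition "cscale_vec c x = (\<chi> i. c *\<^sub>C x $ i)"
instance
  by standard
    (simp_all add: cscale_vec_def vec_eq_iff cscale_add_right cscale_add_left cscale_cscale)
end

lemma cscale_vec_nth [simp]: "(c *\<^sub>C x) $ i = c *\<^sub>C x $ i"
  by (simp add: cscale_vec_def)

lemma poly_mapping_sum_single:
  "p = (\<Sum>k\<in>Poly_Mapping.keys p. Poly_Mapping.single k (Poly_Mapping.lookup p k))"
  by (rule poly_mapping_eqI)
    (auto simp: lookup_sum lookup_single when_def in_keys_iff)

lemma poly_mapping_single_induct [case_names single add]:
  fixes p :: "'a \<Rightarrow>\<^sub>0 'b::comm_monoid_add"
  assumes s: "\<And>k c. P (Poly_Mapping.single k c)"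
    and a: "\<And>p q. P p \<Longrightarrow> P q \<Longrightarrow> P (p + q)"
  shows "P p"
proof -
  have "P (\<Sum>k\<in>A. Poly_Mapping.single k (Poly_Mapping.lookup p k))" if "finite A" for A
    using that
  proof (induction rule: finite_induct)
    case empty
    show ?case using s[of undefined 0] by simp
  next
    case (insert x F)
    then show ?case using s a by simp
  qed
  from this[of "Poly_Mapping.keys p"] show ?thesis
    using poly_mapping_sum_single[of p] by simp
qed

text \<open>
  \<open>'k \<Rightarrow>\<^sub>0 complex\<close> is the vector space with basis \<open>'k\<close>; the linear extension of a map defined on
  the basis is as follows.
\<close>

definition lin_ext :: "('k \<Rightarrow> 'v::complex_space) \<Rightarrow> ('k \<Rightarrow>\<^sub>0 complex) \<Rightarrow> 'v"
  where "lin_ext f p = (\<Sum>k\<in>Poly_Mapping.keys p. Poly_Mapping.lookup p k *\<^sub>C f k)"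

lemma lin_ext_superset:
  assumes "finite S" "Poly_Mapping.keys p \<subseteq> S"
  shows "lin_ext f p = (\<Sum>k\<in>S. Poly_Mapping.lookup p k *\<^sub>C f k)"
  unfolding lin_ext_def
  by (rule sum.mono_neutral_left) (use assms in \<open>auto simp: in_keys_iff\<close>)

lemma lin_ext_linear: "clinear (lin_ext f)"
proof (rule clinearI)
  fix p q :: "'a \<Rightarrow>\<^sub>0 complex" and c
  let ?S = "Poly_Mapping.keys p \<union> Poly_Mapping.keys q"
  have "lin_ext f (p + q) = (\<Sum>k\<in>?S. Poly_Mapping.lookup (p + q) k *\<^sub>C f k)"
    by (rule lin_ext_superset) (use Poly_Mapping.keys_add[of p q] in auto)
  also have "\<dots> = lin_ext f p + lin_ext f q"
    by (simp add: lookup_add cscale_add_left sum.distrib lin_ext_superset[of ?S p]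
        lin_ext_superset[of ?S q])
  finally show "lin_ext f (p + q) = lin_ext f p + lin_ext f q" .
  have "lin_ext f (c *\<^sub>C p) = (\<Sum>k\<in>Poly_Mapping.keys p. Poly_Mapping.lookup (c *\<^sub>C p) k *\<^sub>C f k)"
    by (rule lin_ext_superset) (auto simp: in_keys_iff)
  then show "lin_ext f (c *\<^sub>C p) = c *\<^sub>C lin_ext f p"
    by (simp add: lin_ext_def cvs.scale_sum_right cscale_complex_def)
qed

lemma lin_ext_single [simp]: "lin_ext f (Poly_Mapping.single k c) = c *\<^sub>C f k"
  by (simp add: lin_ext_def)

section \<open>Tensor products\<close>

text \<open>
  The tensor product is the vector space with basis the pairs \<open>(x, b)\<close> modulo the subspace spanned
  by the bilinearity relations.
\<close>

definition tensor_relations ::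
    "('a::complex_space \<times> 'b::complex_space \<Rightarrow>\<^sub>0 complex) set"
  where "tensor_relations =
      {Poly_Mapping.single (x + x', b) 1 - Poly_Mapping.single (x, b) 1
         - Poly_Mapping.single (x', b) 1 | x x' b. True}
    \<union> {Poly_Mapping.single (x, b + b') 1 - Poly_Mapping.single (x, b) 1
         - Poly_Mapping.single (x, b') 1 | x b b'. True}
    \<union> {Poly_Mapping.single (c *\<^sub>C x, b) 1 - c *\<^sub>C Poly_Mapping.single (x, b) 1 | c x b. True}
    \<union> {Poly_Mapping.single (x, c *\<^sub>C b) 1 - c *\<^sub>C Poly_Mapping.single (x, b) 1 | c x b. True}"

definition tensor_eq ::
    "('a::complex_space \<times> 'b::complex_space \<Rightarrow>\<^sub>0 complex) \<Rightarrow> ('a \<times> 'b \<Rightarrow>\<^sub>0 complex) \<Rightarrow> bool"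
  where "tensor_eq p q \<longleftrightarrow> p - q \<in> cvs.span tensor_relations"

lemma equivp_tensor_eq: "equivp tensor_eq"
proof (rule equivpI)
  show "reflp tensor_eq"
    by (auto simp: reflp_def tensor_eq_def cvs.span_zero)
  show "symp tensor_eq"
    unfolding symp_def tensor_eq_def by (metis cvs.span_neg minus_diff_eq)
  show "transp tensor_eq"
    unfolding transp_def tensor_eq_def by (intro allI impI, drule (1) cvs.span_add) simp
qed

quotient_type (overloaded) ('a, 'b) tensor =
    "('a::complex_space \<times> 'b::complex_space) \<Rightarrow>\<^sub>0 complex" / tensor_eq
  by (rule equivp_tensor_eq)

instantiation tensor :: (complex_space, complex_space) complex_space
begin

lift_definition zero_tensor :: "('a, 'b) tensor" is 0 .

lift_definition plus_tensor :: "('a, 'b) tensor \<Rightarrow> ('a, 'b) tensor \<Rightarrow> ('a, 'b) tensor" is "(+)"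
  unfolding tensor_eq_def by (drule (1) cvs.span_add) (simp add: algebra_simps)

lift_definition uminus_tensor :: "('a, 'b) tensor \<Rightarrow> ('a, 'b) tensor" is uminus
  unfolding tensor_eq_def by (metis cvs.span_neg minus_diff_minus)

lift_definition minus_tensor :: "('a, 'b) tensor \<Rightarrow> ('a, 'b) tensor \<Rightarrow> ('a, 'b) tensor" is "(-)"
  unfolding tensor_eq_def by (drule (1) cvs.span_diff) (simp add: algebra_simps)

lift_definition cscale_tensor :: "complex \<Rightarrow> ('a, 'b) tensor \<Rightarrow> ('a, 'b) tensor" is cscale
  unfolding tensor_eq_def by (metis cvs.scale_right_diff_distrib cvs.span_scale)

instance
  by standard
    (transfer; simp add: equivp_reflp[OF equivp_tensor_eq] algebra_simps cscale_add_right
      cscale_add_left cscale_cscale)+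

end

lift_definition tens :: "'a::complex_space \<Rightarrow> 'b::complex_space \<Rightarrow> ('a, 'b) tensor"
    (infixl "\<otimes>" 75)
  is "\<lambda>x b. Poly_Mapping.single (x, b) 1" .

lemma tens_add_left: "(x + x') \<otimes> b = x \<otimes> b + x' \<otimes> b"
  by transfer (unfold tensor_eq_def tensor_relations_def diff_diff_eq[symmetric],
      rule cvs.span_base, blast)

lemma tens_add_right: "x \<otimes> (b + b') = x \<otimes> b + x \<otimes> b'"
  by transfer (unfold tensor_eq_def tensor_relations_def diff_diff_eq[symmetric],
      rule cvs.span_base, blast)

lemma tens_cscale_left: "(c *\<^sub>C x) \<otimes> b = c *\<^sub>C (x \<otimes> b)"
  by transfer (unfold tensor_eq_def tensor_relations_def, rule cvs.span_base, blast)

lemma tens_cscale_right: "x \<otimes> (c *\<^sub>C b) = c *\<^sub>C (x \<otimes> b)"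
  by transfer (unfold tensor_eq_def tensor_relations_def, rule cvs.span_base, blast)

lemma tensor_induct [case_names tens add]:
  assumes t: "\<And>x b. P (x \<otimes> b)" and a: "\<And>X Y. P X \<Longrightarrow> P Y \<Longrightarrow> P (X + Y)"
  shows "P X"
proof -
  have "P (abs_tensor p)" for p
  proof (induction p rule: poly_mapping_single_induct)
    case (single k c)
    obtain x b where k: "k = (x, b)" by force
    have "Poly_Mapping.single k c = c *\<^sub>C Poly_Mapping.single k 1"
      by (rule poly_mapping_eqI) (simp add: lookup_single when_def cscale_complex_def)
    then have "abs_tensor (Poly_Mapping.single k c) = (c *\<^sub>C x) \<otimes> b"
      by (subst tens_cscale_left) (simp only: k tens.abs_eq cscale_tensor.abs_eq)
    then show ?case using t by simp
  next
    case (add p q)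
    then show ?case using a by (simp add: plus_tensor.abs_eq[symmetric])
  qed
  then show ?thesis by (metis Quotient_tensor Quotient_abs_rep)
qed

definition cbilinear ::
    "('a::complex_space \<Rightarrow> 'b::complex_space \<Rightarrow> 'v::complex_space) \<Rightarrow> bool"
  where "cbilinear f \<longleftrightarrow> (\<forall>x. clinear (f x)) \<and> (\<forall>b. clinear (\<lambda>x. f x b))"

text \<open>The linear map induced by a bilinear \<open>f\<close>; it is only meaningful for bilinear \<open>f\<close>.\<close>

definition tensor_lift ::
    "('a::complex_space \<Rightarrow> 'b::complex_space \<Rightarrow> 'v::complex_space) \<Rightarrow> ('a, 'b) tensor \<Rightarrow> 'v"
  where "tensor_lift f T = lin_ext (\<lambda>(x, b). f x b) (rep_tensor T)"

lemma tensor_lift_plus: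
  "tensor_lift (\<lambda>x b. f x b + g x b) T = tensor_lift f T + tensor_lift g T"
  by (simp add: tensor_lift_def lin_ext_def case_prod_unfold cscale_add_right sum.distrib)

lemma tensor_lift_cscale: "tensor_lift (\<lambda>x b. c *\<^sub>C f x b) T = c *\<^sub>C tensor_lift f T"
  by (simp add: tensor_lift_def lin_ext_def case_prod_unfold cvs.scale_sum_right mult.commute)

lemma tensor_lift_abs:
  assumes "cbilinear f"
  shows "tensor_lift f (abs_tensor p) = lin_ext (\<lambda>(x, b). f x b) p"
proof -
  let ?L = "lin_ext (\<lambda>(x, b). f x b)"
  have lin: "clinear (f x)" "clinear (\<lambda>x. f x b)" for x b
    using assms by (auto simp: cbilinear_def)
  have van: "?L r = 0" if "r \<in> tensor_relations" for r
    using that unfolding tensor_relations_def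
    by (auto simp: clinear_diff[OF lin_ext_linear] clinearD(2)[OF lin_ext_linear]
        clinearD[OF lin(1)] clinearD[OF lin(2)])
  have van_span: "?L r = 0" if "r \<in> cvs.span tensor_relations" for r
    by (rule clinear_vanish_on_span[OF lin_ext_linear _ that]) (rule van)
  have "tensor_eq (rep_tensor (abs_tensor p)) p"
    by (metis Quotient_tensor Quotient_rep_abs equivp_reflp equivp_tensor_eq)
  then have "?L (rep_tensor (abs_tensor p) - p) = 0"
    unfolding tensor_eq_def by (rule van_span)
  then show ?thesis
    by (simp add: tensor_lift_def clinear_diff[OF lin_ext_linear])
qed

lemma tensor_lift_tens:
  assumes "cbilinear f"
  shows "tensor_lift f (x \<otimes> b) = f x b"
  by (simp add: tens.abs_eq tensor_lift_abs[OF assms])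

lemma tensor_lift_linear:
  assumes "cbilinear f"
  shows "clinear (tensor_lift f)"
proof (rule clinearI)
  fix X Y :: "('a, 'b) tensor" and c
  obtain p q where pq: "X = abs_tensor p" "Y = abs_tensor q"
    by (metis Quotient_tensor Quotient_abs_rep)
  show "tensor_lift f (X + Y) = tensor_lift f X + tensor_lift f Y"
    by (simp add: pq plus_tensor.abs_eq tensor_lift_abs[OF assms] clinearD[OF lin_ext_linear])
  show "tensor_lift f (c *\<^sub>C X) = c *\<^sub>C tensor_lift f X"
    by (simp add: pq cscale_tensor.abs_eq tensor_lift_abs[OF assms] clinearD[OF lin_ext_linear])
qed

section \<open>Lie algebras and their modules\<close>

class complex_lie_algebra = complex_space +
  fixes lie :: "'a \<Rightarrow> 'a \<Rightarrow> 'a"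
  assumes lie_add_left: "lie (x + y) z = lie x z + lie y z"
    and lie_add_right: "lie z (x + y) = lie z x + lie z y"
    and lie_cscale_left: "lie (c *\<^sub>C x) y = c *\<^sub>C lie x y"
    and lie_cscale_right: "lie x (c *\<^sub>C y) = c *\<^sub>C lie x y"
    and lie_self [simp]: "lie x x = 0"
    and lie_jacobi: "lie x (lie y z) + lie y (lie z x) + lie z (lie x y) = 0"

lemma lie_antisym: "lie x y = - lie y (x :: 'a :: complex_lie_algebra)"
proof -
  have "lie (x + y) (x + y) = lie x y + lie y x"
    by (simp only: lie_add_left lie_add_right) simp
  then show ?thesis by (simp only: lie_self eq_neg_iff_add_eq_0)
qed

subsection \<open>The Lie algebra \<open>g \<otimes> B\<close>\<close>

text \<open>This is the bilinear map with \<open>[x \<otimes> b, y \<otimes> c] = [x, y] \<otimes> b c\<close>, see \<open>lie_tens\<close> below.\<close>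

definition tensor_bracket :: "('a::complex_lie_algebra, 'b::complex_comm_algebra) tensor
    \<Rightarrow> ('a, 'b) tensor \<Rightarrow> ('a, 'b) tensor"
  where "tensor_bracket X Y =
    tensor_lift (\<lambda>x b. tensor_lift (\<lambda>y c. lie x y \<otimes> (b * c)) Y) X"

lemma tensor_bracket_inner:
  fixes x :: "'a::complex_lie_algebra" and b :: "'b::complex_comm_algebra"
  shows "cbilinear (\<lambda>y c. lie x y \<otimes> (b * c))"
  unfolding cbilinear_def
  by (intro conjI allI clinearI)
    (simp_all add: lie_add_right lie_cscale_right tens_add_left tens_add_right tens_cscale_left
      tens_cscale_right distrib_left cscale_mult_right)

lemma tensor_bracket_outer:
  fixes Y :: "('a::complex_lie_algebra, 'b::complex_comm_algebra) tensor"
  shows "cbilinear (\<lambda>x b. tensor_lift (\<lambda>y c. lie x y \<otimes> (b * c)) Y)"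
proof -
  have a1: "tensor_lift (\<lambda>y c. lie (x + x') y \<otimes> (b * c)) Y =
      tensor_lift (\<lambda>y c. lie x y \<otimes> (b * c)) Y + tensor_lift (\<lambda>y c. lie x' y \<otimes> (b * c)) Y"
    for x x' :: 'a and b :: 'b
    by (simp only: lie_add_left tens_add_left tensor_lift_plus)
  have a2: "tensor_lift (\<lambda>y c. lie x y \<otimes> ((b + b') * c)) Y =
      tensor_lift (\<lambda>y c. lie x y \<otimes> (b * c)) Y + tensor_lift (\<lambda>y c. lie x y \<otimes> (b' * c)) Y"
    for x :: 'a and b b' :: 'b
    by (simp only: distrib_right tens_add_right tensor_lift_plus)
  have s1: "tensor_lift (\<lambda>y c. lie (k *\<^sub>C x) y \<otimes> (b * c)) Y =
      k *\<^sub>C tensor_lift (\<lambda>y c. lie x y \<otimes> (b * c)) Y" for k and x :: 'a and b :: 'b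
    by (simp only: lie_cscale_left tens_cscale_left tensor_lift_cscale)
  have s2: "tensor_lift (\<lambda>y c. lie x y \<otimes> ((k *\<^sub>C b) * c)) Y =
      k *\<^sub>C tensor_lift (\<lambda>y c. lie x y \<otimes> (b * c)) Y" for k and x :: 'a and b :: 'b
    by (simp only: cscale_mult tens_cscale_right tensor_lift_cscale)
  show ?thesis
    unfolding cbilinear_def
    by (intro conjI allI clinearI) (rule a2, rule s2, rule a1, rule s1)
qed

lemma tensor_bracket_tens_left:
  "tensor_bracket (x \<otimes> b) Y = tensor_lift (\<lambda>y c. lie x y \<otimes> (b * c)) Y"
  by (simp only: tensor_bracket_def tensor_lift_tens[OF tensor_bracket_outer])

lemma tensor_bracket_tens: "tensor_bracket (x \<otimes> b) (y \<otimes> c) = lie x y \<otimes> (b * c)"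
  by (simp only: tensor_bracket_tens_left tensor_lift_tens[OF tensor_bracket_inner])

lemma tensor_bracket_left:
  "tensor_bracket (X + X') Y = tensor_bracket X Y + tensor_bracket X' Y"
  "tensor_bracket (k *\<^sub>C X) Y = k *\<^sub>C tensor_bracket X Y"
  by (simp_all add: tensor_bracket_def clinearD[OF tensor_lift_linear[OF tensor_bracket_outer]])

lemma tensor_bracket_right:
  "tensor_bracket X (Y + Y') = tensor_bracket X Y + tensor_bracket X Y'"
  "tensor_bracket X (k *\<^sub>C Y) = k *\<^sub>C tensor_bracket X Y"
proof -
  note L = clinearD[OF tensor_lift_linear[OF tensor_bracket_inner]]
  show "tensor_bracket X (Y + Y') = tensor_bracket X Y + tensor_bracket X Y'"
  proof (induction X rule: tensor_induct)
    case tens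
    show ?case by (simp only: tensor_bracket_tens_left L)
  next
    case (add X X')
    show ?case by (simp only: tensor_bracket_left add add_ac)
  qed
  show "tensor_bracket X (k *\<^sub>C Y) = k *\<^sub>C tensor_bracket X Y"
  proof (induction X rule: tensor_induct)
    case tens
    show ?case by (simp only: tensor_bracket_tens_left L)
  next
    case (add X X')
    show ?case by (simp only: tensor_bracket_left add cscale_add_right)
  qed
qed

lemma tensor_bracket_antisym: "tensor_bracket X Y + tensor_bracket Y X = 0"
proof (induction X rule: tensor_induct)
  case (tens x b)
  show ?case
  proof (induction Y rule: tensor_induct)
    case (tens y c)
    have "tensor_bracket (x \<otimes> b) (y \<otimes> c) + tensor_bracket (y \<otimes> c) (x \<otimes> b) =
        (lie x y + lie y x) \<otimes> (b * c)"
      by (simp add: tensor_bracket_tens tens_add_left mult.commute)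
    also have "\<dots> = (0 *\<^sub>C 0) \<otimes> (b * c)"
      using lie_antisym[of x y] by simp
    also have "\<dots> = 0"
      by (simp only: tens_cscale_left) simp
    finally show ?case .
  next
    case (add Y Y')
    have "tensor_bracket (x \<otimes> b) (Y + Y') + tensor_bracket (Y + Y') (x \<otimes> b) =
        (tensor_bracket (x \<otimes> b) Y + tensor_bracket Y (x \<otimes> b))
        + (tensor_bracket (x \<otimes> b) Y' + tensor_bracket Y' (x \<otimes> b))"
      by (simp only: tensor_bracket_left tensor_bracket_right add_ac)
    then show ?case by (simp only: add) simp
  qed
next
  case (add X X')
  have "tensor_bracket (X + X') Y + tensor_bracket Y (X + X') =
      (tensor_bracket X Y + tensor_bracket Y X) + (tensor_bracket X' Y + tensor_bracket Y X')"
    by (simp only: tensor_bracket_left tensor_bracket_right add_ac)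
  then show ?case by (simp only: add) simp
qed

instantiation tensor :: (complex_lie_algebra, complex_comm_algebra) complex_lie_algebra
begin

definition lie_tensor :: "('a, 'b) tensor \<Rightarrow> ('a, 'b) tensor \<Rightarrow> ('a, 'b) tensor"
  where "lie_tensor = tensor_bracket"

instance
proof
  fix X Y Z :: "('a, 'b) tensor" and k
  show "lie (X + Y) Z = lie X Z + lie Y Z" "lie (k *\<^sub>C X) Y = k *\<^sub>C lie X Y"
    by (simp_all add: lie_tensor_def tensor_bracket_left)
  show "lie Z (X + Y) = lie Z X + lie Z Y" "lie X (k *\<^sub>C Y) = k *\<^sub>C lie X Y"
    by (simp_all add: lie_tensor_def tensor_bracket_right)
  show "lie X X = 0"
  proof -
    have "(2 :: complex) *\<^sub>C lie X X = lie X X + lie X X"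
      using cscale_add_left[of 1 1 "lie X X"] by simp
    then have "(2 :: complex) *\<^sub>C lie X X = 0"
      by (simp add: lie_tensor_def tensor_bracket_antisym)
    then show ?thesis by simp
  qed
  let ?J = "\<lambda>X Y Z :: ('a, 'b) tensor. lie X (lie Y Z) + lie Y (lie Z X) + lie Z (lie X Y)"
  have tens0: "(0 :: 'a) \<otimes> (b :: 'b) = 0" for b
    using tens_cscale_left[of 0 0 b] by simp
  have J: "?J (x \<otimes> a) (y \<otimes> b) (z \<otimes> c) = 0" for x y z :: 'a and a b c :: 'b
  proof -
    have "?J (x \<otimes> a) (y \<otimes> b) (z \<otimes> c) =
        (lie x (lie y z) + lie y (lie z x) + lie z (lie x y)) \<otimes> (a * (b * c))"
      by (simp add: lie_tensor_def tensor_bracket_tens tens_add_left mult_ac)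
    then show ?thesis by (simp add: lie_jacobi tens0)
  qed
  have add1: "?J (X + X') Y Z = ?J X Y Z + ?J X' Y Z" for X X' Y Z
    by (simp add: lie_tensor_def tensor_bracket_left tensor_bracket_right add_ac)
  have add2: "?J X (Y + Y') Z = ?J X Y Z + ?J X Y' Z" for X Y Y' Z
    by (simp add: lie_tensor_def tensor_bracket_left tensor_bracket_right add_ac)
  have add3: "?J X Y (Z + Z') = ?J X Y Z + ?J X Y Z'" for X Y Z Z'
    by (simp add: lie_tensor_def tensor_bracket_left tensor_bracket_right add_ac)
  have "?J (x \<otimes> a) (y \<otimes> b) Z = 0" for x y a b
  proof (induction Z rule: tensor_induct)
    case tens show ?case by (rule J)
  next
    case (add Z Z') then show ?case by (simp only: add3) simp
  qed
  then have "?J (x \<otimes> a) Y Z = 0" for x a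
  proof (induction Y rule: tensor_induct)
    case tens then show ?case by blast
  next
    case (add Y Y') then show ?case by (simp only: add2) simp
  qed
  then show "?J X Y Z = 0"
  proof (induction X rule: tensor_induct)
    case tens then show ?case by blast
  next
    case (add X X') then show ?case by (simp only: add1) simp
  qed
qed

end

lemma lie_tens: "lie (x \<otimes> b) (y \<otimes> c) = lie x y \<otimes> (b * c)"
  by (simp add: lie_tensor_def tensor_bracket_tens)

subsection \<open>Modules\<close>

definition lie_module :: "('g::complex_lie_algebra \<Rightarrow> 'v::complex_space \<Rightarrow> 'v) \<Rightarrow> bool"
  where "lie_module \<rho> \<longleftrightarrow> cbilinear \<rho> \<and>
    (\<forall>x y v. \<rho> (lie x y) v = \<rho> x (\<rho> y v) - \<rho> y (\<rho> x v))"

definition lie_submodule ::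
    "('g::complex_lie_algebra \<Rightarrow> 'v::complex_space \<Rightarrow> 'v) \<Rightarrow> 'v set \<Rightarrow> bool"
  where "lie_submodule \<rho> W \<longleftrightarrow> cvs.subspace W \<and> (\<forall>x. \<forall>w\<in>W. \<rho> x w \<in> W)"

definition irreducible_lie_module ::
    "('g::complex_lie_algebra \<Rightarrow> 'v::complex_space \<Rightarrow> 'v) \<Rightarrow> bool"
  where "irreducible_lie_module \<rho> \<longleftrightarrow> lie_module \<rho> \<and> (UNIV :: 'v set) \<noteq> {0} \<and>
    (\<forall>W. lie_submodule \<rho> W \<longrightarrow> W = {0} \<or> W = UNIV)"

section \<open>Universal enveloping algebras\<close>

text \<open>
  Words over \<open>g\<close> under concatenation form the free monoid, written additively so that the
  convolution product of \<^type>\<open>poly_mapping\<close> makes \<open>'g word \<Rightarrow>\<^sub>0 complex\<close> the free unital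
  associative algebra on the set \<open>g\<close>. Dividing by the two-sided ideal generated by the linearity
  relations (which gives the tensor algebra of \<open>g\<close>) and by \<open>x y - y x - [x, y]\<close> yields the
  universal enveloping algebra.
\<close>

datatype 'g word = Word (letters: "'g list")

instantiation word :: (type) monoid_add
begin
definition "zero_word = Word []"
definition "plus_word v w = Word (letters v @ letters w)"
instance
  by standard (simp_all add: zero_word_def plus_word_def)
end

lemma letters_zero [simp]: "letters 0 = []"
  and letters_plus [simp]: "letters (v + w) = letters v @ letters w"
  by (simp_all add: zero_word_def plus_word_def)

type_synonym 'g free_alg = "'g word \<Rightarrow>\<^sub>0 complex"

definition gen :: "'g \<Rightarrow> 'g free_alg"
  where "gen x = Poly_Mapping.single (Word [x]) 1"

inductive_set uea_ideal :: "'g::complex_lie_algebra free_alg set" where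
  zero: "0 \<in> uea_ideal"
| rel_add: "gen (x + y) - gen x - gen y \<in> uea_ideal"
| rel_cscale: "gen (c *\<^sub>C x) - c *\<^sub>C gen x \<in> uea_ideal"
| rel_lie: "gen x * gen y - gen y * gen x - gen (lie x y) \<in> uea_ideal"
| add: "p \<in> uea_ideal \<Longrightarrow> q \<in> uea_ideal \<Longrightarrow> p + q \<in> uea_ideal"
| mult_left: "p \<in> uea_ideal \<Longrightarrow> q * p \<in> uea_ideal"
| mult_right: "p \<in> uea_ideal \<Longrightarrow> p * q \<in> uea_ideal"

lemma uea_ideal_uminus: "p \<in> uea_ideal \<Longrightarrow> - p \<in> uea_ideal"
  using uea_ideal.mult_left[of p "-1"] by simp

lemma uea_ideal_diff: "p \<in> uea_ideal \<Longrightarrow> q \<in> uea_ideal \<Longrightarrow> p - q \<in> uea_ideal"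
  by (metis uea_ideal.add uea_ideal_uminus diff_conv_add_uminus)

lemma cscale_poly_mapping_conv_mult:
  "c *\<^sub>C p = Poly_Mapping.single 0 c * (p :: 'a::monoid_add \<Rightarrow>\<^sub>0 complex)"
  by (induction p rule: poly_mapping_single_induct)
    (auto simp: mult_single cscale_add_right distrib_left cscale_complex_def lookup_single when_def
      intro!: poly_mapping_eqI)

definition uea_eq :: "'g::complex_lie_algebra free_alg \<Rightarrow> 'g free_alg \<Rightarrow> bool"
  where "uea_eq p q \<longleftrightarrow> p - q \<in> uea_ideal"

lemma equivp_uea_eq: "equivp uea_eq"
proof (rule equivpI)
  show "reflp uea_eq"
    by (auto simp: reflp_def uea_eq_def uea_ideal.zero)
  show "symp uea_eq"
    unfolding symp_def uea_eq_def by (metis uea_ideal_uminus minus_diff_eq)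
  show "transp uea_eq"
    unfolding transp_def uea_eq_def by (intro allI impI, drule (1) uea_ideal.add) simp
qed

quotient_type (overloaded) 'g uea = "'g::complex_lie_algebra free_alg" / uea_eq
  by (rule equivp_uea_eq)

instantiation uea :: (complex_lie_algebra) "{ring, monoid_mult, complex_space}"
begin

lift_definition zero_uea :: "'a uea" is 0 .

lift_definition one_uea :: "'a uea" is 1 .

lift_definition plus_uea :: "'a uea \<Rightarrow> 'a uea \<Rightarrow> 'a uea" is "(+)"
  unfolding uea_eq_def by (drule (1) uea_ideal.add) (simp add: algebra_simps)

lift_definition uminus_uea :: "'a uea \<Rightarrow> 'a uea" is uminus
  unfolding uea_eq_def by (metis uea_ideal_uminus minus_diff_minus)

lift_definition minus_uea :: "'a uea \<Rightarrow> 'a uea \<Rightarrow> 'a uea" is "(-)"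
  unfolding uea_eq_def by (drule (1) uea_ideal_diff) (simp add: algebra_simps)

lift_definition times_uea :: "'a uea \<Rightarrow> 'a uea \<Rightarrow> 'a uea" is "(*)"
proof -
  fix p p' q q' :: "'a free_alg"
  assume "uea_eq p p'" "uea_eq q q'"
  moreover have "p * q - p' * q' = (p - p') * q + p' * (q - q')"
    by (simp add: algebra_simps)
  ultimately show "uea_eq (p * q) (p' * q')"
    unfolding uea_eq_def by (metis uea_ideal.add uea_ideal.mult_left uea_ideal.mult_right)
qed

lift_definition cscale_uea :: "complex \<Rightarrow> 'a uea \<Rightarrow> 'a uea" is cscale
  unfolding uea_eq_def
  by (metis cvs.scale_right_diff_distrib cscale_poly_mapping_conv_mult uea_ideal.mult_left)

instance
  by standard
    (transfer; simp add: equivp_reflp[OF equivp_uea_eq] algebra_simps cscale_add_right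
      cscale_add_left cscale_cscale)+

end

lift_definition uea_of :: "'g::complex_lie_algebra \<Rightarrow> 'g uea" is gen .

text \<open>
  The action of the enveloping algebra on a module: the class of the word \<open>x\<^sub>1 \<dots> x\<^sub>k\<close> acts as
  \<open>\<rho> x\<^sub>1 \<circ> \<dots> \<circ> \<rho> x\<^sub>k\<close>. The choice of representative is immaterial if \<open>\<rho>\<close> is a Lie algebra
  module, see \<open>uea_act_abs\<close>.
\<close>

definition free_act ::
    "('g \<Rightarrow> 'v::complex_space \<Rightarrow> 'v) \<Rightarrow> 'g free_alg \<Rightarrow> 'v \<Rightarrow> 'v"
  where "free_act \<rho> p v = lin_ext (\<lambda>w. foldr \<rho> (letters w) v) p"

definition uea_act ::
    "('g::complex_lie_algebra \<Rightarrow> 'v::complex_space \<Rightarrow> 'v) \<Rightarrow> 'g uea \<Rightarrow> 'v \<Rightarrow> 'v"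
  where "uea_act \<rho> u v = free_act \<rho> (rep_uea u) v"

lemma free_act_linear: "clinear (\<lambda>p. free_act \<rho> p v)"
  unfolding free_act_def using lin_ext_linear .

lemma free_act_linear_right:
  assumes "\<And>x. clinear (\<rho> x)"
  shows "clinear (free_act \<rho> p)"
proof -
  have f: "foldr \<rho> xs (v + w) = foldr \<rho> xs v + foldr \<rho> xs w"
    "foldr \<rho> xs (c *\<^sub>C v) = c *\<^sub>C foldr \<rho> xs v" for xs v w c
    by (induction xs) (simp_all add: clinearD[OF assms])
  show ?thesis
    by (rule clinearI)
      (simp_all add: free_act_def lin_ext_def f cscale_add_right sum.distrib cvs.scale_sum_right
        mult.commute)
qed

lemma free_act_mult:
  assumes "\<And>x. clinear (\<rho> x)"
  shows "free_act \<rho> (p * q) v = free_act \<rho> p (free_act \<rho> q v)"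
proof -
  note L = clinearD[OF free_act_linear] clinearD[OF free_act_linear_right[OF assms]]
  show ?thesis
  proof (induction p rule: poly_mapping_single_induct)
    case (single k c)
    show ?case
    proof (induction q rule: poly_mapping_single_induct)
      case (single l d)
      have f: "foldr \<rho> xs (e *\<^sub>C v) = e *\<^sub>C foldr \<rho> xs v" for xs v e
        by (induction xs) (simp_all add: clinearD[OF assms])
      show ?case by (simp add: mult_single free_act_def f)
    next
      case (add p q)
      then show ?case by (simp add: distrib_left L)
    qed
  next
    case (add p q)
    then show ?case by (simp add: distrib_right L)
  qed
qed

lemma free_act_gen: "free_act \<rho> (gen x) v = \<rho> x v"
  by (simp add: free_act_def gen_def)

lemma free_act_ideal:
  assumes "lie_module \<rho>" "p \<in> uea_ideal"
  shows "free_act \<rho> p v = 0"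
proof -
  have lin: "\<And>x. clinear (\<rho> x)" "\<And>v. clinear (\<lambda>x. \<rho> x v)"
    and br: "\<And>x y v. \<rho> (lie x y) v = \<rho> x (\<rho> y v) - \<rho> y (\<rho> x v)"
    using assms(1) by (auto simp: lie_module_def cbilinear_def)
  note L = clinearD[OF free_act_linear] clinear_diff[OF free_act_linear]
    clinear_zero[OF free_act_linear] clinear_zero[OF free_act_linear_right[OF lin(1)]]
    free_act_mult[OF lin(1)] free_act_gen clinearD[OF lin(2)] br
  from assms(2) show ?thesis
    by (induction arbitrary: v) (simp_all add: L)
qed

lemma uea_act_abs:
  assumes "lie_module \<rho>"
  shows "uea_act \<rho> (abs_uea p) v = free_act \<rho> p v"
proof -
  have "uea_eq (rep_uea (abs_uea p)) p"
    by (metis Quotient_uea Quotient_rep_abs equivp_reflp equivp_uea_eq)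
  then have "free_act \<rho> (rep_uea (abs_uea p) - p) v = 0"
    unfolding uea_eq_def by (rule free_act_ideal[OF assms])
  then show ?thesis
    by (simp add: uea_act_def clinear_diff[OF free_act_linear])
qed

lemma uea_act_mult:
  assumes "lie_module \<rho>"
  shows "uea_act \<rho> (u * u') v = uea_act \<rho> u (uea_act \<rho> u' v)"
proof -
  have lin: "\<And>x. clinear (\<rho> x)"
    using assms by (auto simp: lie_module_def cbilinear_def)
  obtain p q where "u = abs_uea p" "u' = abs_uea q"
    by (metis Quotient_uea Quotient_abs_rep)
  then show ?thesis
    by (simp add: times_uea.abs_eq uea_act_abs[OF assms] free_act_mult[OF lin])
qed

lemma uea_act_of:
  assumes "lie_module \<rho>"
  shows "uea_act \<rho> (uea_of x) v = \<rho> x v"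
  by (simp add: uea_of.abs_eq uea_act_abs[OF assms] free_act_gen)

section \<open>The Lie algebra of divergence zero vector fields on the torus\<close>

text \<open>
  The finite type \<open>'n\<close> indexes the variables \<open>t\<^sub>1, \<dots>, t\<^sub>N\<close>. A Laurent polynomial is a finitely
  supported function on exponents, \<open>Poly_Mapping.single m 1\<close> being the monomial of exponent \<open>m\<close>.
  A vector field \<open>\<Sum>\<^sub>i X\<^sub>i d\<^sub>i\<close>, where \<open>d\<^sub>i = t\<^sub>i d/dt\<^sub>i\<close> is \<open>deriv_t i\<close>, is given by its vector \<open>X\<close>
  of coefficients.
\<close>

type_synonym 'n laurent = "(int ^ 'n) \<Rightarrow>\<^sub>0 complex"
type_synonym 'n vfield = "'n laurent ^ 'n"

definition deriv_t :: "'n::finite \<Rightarrow> 'n laurent \<Rightarrow> 'n laurent"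
  where "deriv_t i = Poly_Mapping.mapp (\<lambda>m c. of_int (m $ i) * c)"

definition vf_act :: "'n::finite vfield \<Rightarrow> 'n laurent \<Rightarrow> 'n laurent"
  where "vf_act X f = (\<Sum>i\<in>UNIV. X $ i * deriv_t i f)"

text \<open>The commutator of derivations, see \<open>vf_act_lie\<close> below.\<close>

definition vf_lie :: "'n::finite vfield \<Rightarrow> 'n vfield \<Rightarrow> 'n vfield"
  where "vf_lie X Y = (\<chi> i. vf_act X (Y $ i) - vf_act Y (X $ i))"

definition pairing :: "complex ^ 'n::finite \<Rightarrow> int ^ 'n \<Rightarrow> complex"
  where "pairing u r = (\<Sum>i\<in>UNIV. u $ i * of_int (r $ i))"

definition vf_D :: "complex ^ 'n::finite \<Rightarrow> int ^ 'n \<Rightarrow> 'n vfield"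
  where "vf_D u r = (\<chi> i. Poly_Mapping.single r (u $ i))"

definition sdiff :: "'n::finite vfield set"
  where "sdiff = cvs.span {vf_D u r | u r. pairing u r = 0}"

lemma vf_lie_nth: "vf_lie X Y $ i = vf_act X (Y $ i) - vf_act Y (X $ i)"
  by (simp add: vf_lie_def)

lemma lookup_deriv_t:
  "Poly_Mapping.lookup (deriv_t i f) m = of_int (m $ i) * Poly_Mapping.lookup f m"
  by (simp add: deriv_t_def lookup_mapp when_def in_keys_iff)

lemma deriv_t_add: "deriv_t i (f + g) = deriv_t i f + deriv_t i g"
  by (rule poly_mapping_eqI) (simp add: lookup_deriv_t lookup_add distrib_left)

lemma deriv_t_cscale: "deriv_t i (c *\<^sub>C f) = c *\<^sub>C deriv_t i f"
  by (rule poly_mapping_eqI) (simp add: lookup_deriv_t cscale_complex_def)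

lemma deriv_t_single:
  "deriv_t i (Poly_Mapping.single m c) = Poly_Mapping.single m (of_int (m $ i) * c)"
  by (rule poly_mapping_eqI) (simp add: lookup_deriv_t lookup_single when_def)

lemma deriv_t_commute: "deriv_t i (deriv_t j f) = deriv_t j (deriv_t i f)"
  by (rule poly_mapping_eqI) (simp add: lookup_deriv_t)

lemma deriv_t_mult: "deriv_t i (f * g) = deriv_t i f * g + f * deriv_t i g"
proof (induction f rule: poly_mapping_single_induct)
  case (single k c)
  show ?case
  proof (induction g rule: poly_mapping_single_induct)
    case (single l d)
    show ?case
      by (simp add: mult_single deriv_t_single single_add[symmetric] algebra_simps)
  next
    case (add p q)
    then show ?case by (simp add: deriv_t_add algebra_simps)
  qed
next
  case (add p q)
  then show ?case by (simp add: deriv_t_add algebra_simps)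
qed

lemma deriv_t_sum: "deriv_t i (sum f A) = (\<Sum>a\<in>A. deriv_t i (f a))"
proof (induction A rule: infinite_finite_induct)
  case (insert x F)
  then show ?case by (simp add: deriv_t_add)
qed (auto intro!: poly_mapping_eqI simp: lookup_deriv_t)

lemma cscale_times:
  "(c *\<^sub>C p) * q = c *\<^sub>C (p * q)" "p * (c *\<^sub>C q) = c *\<^sub>C (p * q)"
  for p q :: "'n::finite laurent"
  by (simp_all add: cscale_poly_mapping_conv_mult mult_ac)

lemma vf_act_linear: "clinear (vf_act X)"
  by (rule clinearI)
    (simp_all add: vf_act_def deriv_t_add deriv_t_cscale distrib_left sum.distrib cscale_times
      cvs.scale_sum_right)

lemma vf_act_linear_left: "clinear (\<lambda>X. vf_act X f)"
  by (rule clinearI)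
    (simp_all add: vf_act_def distrib_right sum.distrib cscale_times cvs.scale_sum_right)

lemmas vf_act_simps = clinearD[OF vf_act_linear] clinear_diff[OF vf_act_linear]
  clinear_zero[OF vf_act_linear] clinearD[OF vf_act_linear_left]
  clinear_diff[OF vf_act_linear_left] clinear_zero[OF vf_act_linear_left]

lemma vf_act_D_single:
  fixes u :: "complex ^ 'n::finite"
  shows
  "vf_act (vf_D u r) (Poly_Mapping.single s c) = Poly_Mapping.single (r + s) (pairing u s * c)"
proof -
  have "Poly_Mapping.single k (sum g A) = (\<Sum>a\<in>A. Poly_Mapping.single k (g a))"
    for k :: "int ^ 'n" and g :: "'n \<Rightarrow> complex" and A
    by (induction A rule: infinite_finite_induct) (simp_all add: single_add)
  then show ?thesis
    by (simp add: vf_act_def vf_D_def deriv_t_single mult_single pairing_def sum_distrib_right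
        mult.assoc)
qed

lemma vf_act_lie: "vf_act (vf_lie X Y) f = vf_act X (vf_act Y f) - vf_act Y (vf_act X f)"
proof -
  have e: "vf_act X (vf_act Y f) = (\<Sum>j\<in>UNIV. vf_act X (Y $ j) * deriv_t j f)
      + (\<Sum>i\<in>UNIV. \<Sum>j\<in>UNIV. X $ i * Y $ j * deriv_t i (deriv_t j f))" for X Y :: "'a vfield"
  proof -
    have "vf_act X (vf_act Y f) = (\<Sum>i\<in>UNIV. \<Sum>j\<in>UNIV. X $ i * deriv_t i (Y $ j) * deriv_t j f)
      + (\<Sum>i\<in>UNIV. \<Sum>j\<in>UNIV. X $ i * Y $ j * deriv_t i (deriv_t j f))"
      by (simp add: vf_act_def deriv_t_sum deriv_t_mult sum_distrib_left distrib_left sum.distrib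
          mult.assoc)
    also have "(\<Sum>i\<in>UNIV. \<Sum>j\<in>UNIV. X $ i * deriv_t i (Y $ j) * deriv_t j f) =
        (\<Sum>j\<in>UNIV. vf_act X (Y $ j) * deriv_t j f)"
      unfolding vf_act_def sum_distrib_right by (rule sum.swap)
    finally show ?thesis .
  qed
  have s: "(\<Sum>i\<in>UNIV. \<Sum>j\<in>UNIV. X $ i * Y $ j * deriv_t i (deriv_t j f)) =
      (\<Sum>i\<in>UNIV. \<Sum>j\<in>UNIV. Y $ i * X $ j * deriv_t i (deriv_t j f))"
    by (subst sum.swap) (simp add: deriv_t_commute mult.commute)
  have "vf_act (vf_lie X Y) f = (\<Sum>j\<in>UNIV. vf_act X (Y $ j) * deriv_t j f)
      - (\<Sum>j\<in>UNIV. vf_act Y (X $ j) * deriv_t j f)"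
    by (simp add: vf_act_def[of "vf_lie X Y"] vf_lie_nth left_diff_distrib sum_subtractf)
  then show ?thesis by (simp add: e[of X Y] e[of Y X] s)
qed

lemma vf_lie_D:
  "vf_lie (vf_D u r) (vf_D v s) = vf_D (pairing u s *\<^sub>C v - pairing v r *\<^sub>C u) (r + s)"
proof -
  have "vf_act (vf_D u r) (vf_D v s $ i) - vf_act (vf_D v s) (vf_D u r $ i) =
      Poly_Mapping.single (r + s) (pairing u s * v $ i - pairing v r * u $ i)" for i
    using vf_act_D_single[of u r s "v $ i"] vf_act_D_single[of v s r "u $ i"]
    by (simp add: vf_D_def single_diff add.commute)
  then show ?thesis
    by (simp add: vf_lie_def vf_D_def vec_eq_iff cscale_complex_def)
qed

lemma vf_lie_bilinear: "cbilinear vf_lie"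
  unfolding cbilinear_def
  by (intro conjI allI clinearI)
    (simp_all add: vf_lie_def vec_eq_iff vf_act_simps cvs.scale_right_diff_distrib)

lemma pairing_linear:
  "pairing (c *\<^sub>C u - d *\<^sub>C v) r = c * pairing u r - d * pairing v r"
  "pairing u (r + s) = pairing u r + pairing u s"
  by (simp_all add: pairing_def cscale_complex_def sum_distrib_left sum.distrib sum_subtractf
      algebra_simps)

lemma vf_lie_sdiff:
  assumes "X \<in> sdiff" "Y \<in> sdiff"
  shows "vf_lie X Y \<in> sdiff"
proof -
  have lin: "clinear (vf_lie X)" "clinear (\<lambda>X. vf_lie X Y)" for X Y :: "'a vfield"
    using vf_lie_bilinear by (auto simp: cbilinear_def)
  have gen: "vf_lie (vf_D u r) Y \<in> sdiff" if u: "pairing u r = 0" for u :: "complex ^ 'a" and r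
    using assms(2) unfolding sdiff_def
  proof (induction rule: cvs.span_induct_alt)
    case base
    show ?case by (simp add: clinear_zero[OF lin(1)] cvs.span_zero)
  next
    case (step c x y)
    then obtain v s where v: "x = vf_D v s" "pairing v s = 0" by blast
    have "vf_lie (vf_D u r) x \<in> {vf_D u r | u r. pairing u r = 0}"
      unfolding v vf_lie_D using u v(2)
      by (auto intro!: exI simp: pairing_linear algebra_simps)
    then show ?case
      using step by (simp add: clinearD[OF lin(1)] cvs.span_add cvs.span_scale cvs.span_base)
  qed
  from assms(1) show ?thesis
    unfolding sdiff_def
  proof (induction rule: cvs.span_induct_alt)
    case base
    show ?case by (simp add: clinear_zero[OF lin(2)] cvs.span_zero)
  next
    case (step c x y)
    then obtain u r where v: "x = vf_D u r" "pairing u r = 0" by blast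
    then show ?case
      using step gen[of u r]
      by (simp add: clinearD[OF lin(2)] cvs.span_add cvs.span_scale sdiff_def)
  qed
qed

lemma vf_D_axis_sdiff: "vf_D (axis i 1) 0 \<in> sdiff"
  unfolding sdiff_def
  by (rule cvs.span_base) (auto intro!: exI simp: pairing_def)

subsection \<open>The semidirect product with the Laurent polynomials\<close>

typedef (overloaded) 'n sdiff_laurent =
    "{(X, f) | X f. X \<in> (sdiff :: 'n::finite vfield set) \<and> f \<in> (UNIV :: 'n laurent set)}"
  morphisms sl_pair Abs_sdiff_laurent
  by (rule exI[of _ "(0, 0)"]) (simp add: sdiff_def cvs.span_zero)

setup_lifting type_definition_sdiff_laurent

instantiation sdiff_laurent :: (finite) complex_lie_algebra
begin

lift_definition zero_sdiff_laurent :: "'a sdiff_laurent" is "(0, 0)"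
  by (simp add: sdiff_def cvs.span_zero)

lift_definition plus_sdiff_laurent ::
    "'a sdiff_laurent \<Rightarrow> 'a sdiff_laurent \<Rightarrow> 'a sdiff_laurent"
  is "\<lambda>(X, f) (Y, g). (X + Y, f + g)"
  by (auto simp: sdiff_def cvs.span_add)

lift_definition minus_sdiff_laurent ::
    "'a sdiff_laurent \<Rightarrow> 'a sdiff_laurent \<Rightarrow> 'a sdiff_laurent"
  is "\<lambda>(X, f) (Y, g). (X - Y, f - g)"
  by (auto simp: sdiff_def cvs.span_diff)

lift_definition uminus_sdiff_laurent :: "'a sdiff_laurent \<Rightarrow> 'a sdiff_laurent"
  is "\<lambda>(X, f). (- X, - f)"
  by (auto simp: sdiff_def cvs.span_neg)

lift_definition cscale_sdiff_laurent :: "complex \<Rightarrow> 'a sdiff_laurent \<Rightarrow> 'a sdiff_laurent"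
  is "\<lambda>c (X, f). (c *\<^sub>C X, c *\<^sub>C f)"
  by (auto simp: sdiff_def cvs.span_scale)

lift_definition lie_sdiff_laurent ::
    "'a sdiff_laurent \<Rightarrow> 'a sdiff_laurent \<Rightarrow> 'a sdiff_laurent"
  is "\<lambda>(X, f) (Y, g). (vf_lie X Y, vf_act X g - vf_act Y f)"
  by (auto simp: vf_lie_sdiff)

instance
proof
  have lin: "clinear (vf_lie X)" "clinear (\<lambda>X. vf_lie X Y)" for X Y :: "'a vfield"
    using vf_lie_bilinear by (auto simp: cbilinear_def)
  note L = clinearD[OF lin(1)] clinearD[OF lin(2)] vf_act_simps
  fix x y z :: "'a sdiff_laurent" and c d
  show "x + y + z = x + (y + z)" "x + y = y + x" "0 + x = x" "- x + x = 0" "x - y = x + - y"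
    "c *\<^sub>C (x + y) = c *\<^sub>C x + c *\<^sub>C y" "(c + d) *\<^sub>C x = c *\<^sub>C x + d *\<^sub>C x"
    "c *\<^sub>C d *\<^sub>C x = (c * d) *\<^sub>C x" "1 *\<^sub>C x = x"
    by (transfer; auto simp: algebra_simps cscale_add_right cscale_add_left cscale_cscale)+
  show "lie (x + y) z = lie x z + lie y z" "lie z (x + y) = lie z x + lie z y"
    "lie (c *\<^sub>C x) y = c *\<^sub>C lie x y" "lie x (c *\<^sub>C y) = c *\<^sub>C lie x y"
    by (transfer; auto simp: L algebra_simps cvs.scale_right_diff_distrib)+
  show "lie x x = 0"
    by transfer (auto simp: vf_lie_def vec_eq_iff)
  have "vf_lie X (vf_lie Y Z) + vf_lie Y (vf_lie Z X) + vf_lie Z (vf_lie X Y) = 0"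
    for X Y Z :: "'a vfield"
    by (simp add: vec_eq_iff vf_lie_def[of _ "vf_lie _ _"] vf_act_lie)
      (simp add: vf_lie_def vf_act_simps)
  then show "lie x (lie y z) + lie y (lie z x) + lie z (lie x y) = 0"
    by transfer (auto simp: vf_act_lie vf_act_simps)
qed

end

text \<open>The vector field \<open>D(u, r)\<close>; \<open>0\<close> is a junk value for \<open>u\<close>, \<open>r\<close> with nonzero pairing.\<close>

lift_definition sl_D :: "complex ^ 'n::finite \<Rightarrow> int ^ 'n \<Rightarrow> 'n sdiff_laurent"
  is "\<lambda>u r. (if pairing u r = 0 then vf_D u r else 0, 0)"
  by (auto simp: sdiff_def intro: cvs.span_base cvs.span_zero)

lift_definition sl_t :: "int ^ 'n::finite \<Rightarrow> 'n sdiff_laurent"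
  is "\<lambda>s. (0, Poly_Mapping.single s 1)"
  by (simp add: sdiff_def cvs.span_zero)

lemma lie_sl_D_D:
  assumes "pairing u r = 0" "pairing v s = 0"
  shows "lie (sl_D u r) (sl_D v s) = sl_D (pairing u s *\<^sub>C v - pairing v r *\<^sub>C u) (r + s)"
proof -
  have "pairing (pairing u s *\<^sub>C v - pairing v r *\<^sub>C u) (r + s) = 0"
    using assms by (simp add: pairing_linear algebra_simps)
  then show ?thesis
    using assms by transfer (simp add: vf_lie_D vf_act_simps)
qed

lemma lie_sl_D_t:
  assumes "pairing u r = 0"
  shows "lie (sl_D u r) (sl_t s) = pairing u s *\<^sub>C sl_t (r + s)"
proof -
  have "Poly_Mapping.single (r + s) (pairing u s) =
      pairing u s *\<^sub>C Poly_Mapping.single (r + s) (1 :: complex)"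
    by (rule poly_mapping_eqI) (simp add: lookup_single when_def cscale_complex_def)
  moreover have "vf_lie (vf_D u r) 0 = 0"
    by (simp add: vf_lie_def vec_eq_iff vf_act_simps)
  ultimately show ?thesis
    using assms by transfer (simp add: vf_act_D_single vf_act_simps)
qed

lemma lie_sl_t_t: "lie (sl_t r) (sl_t s) = 0"
  by transfer (simp add: vf_lie_def vec_eq_iff vf_act_simps)

section \<open>Weight modules\<close>

definition cartan :: "'n::finite sdiff_laurent set"
  where "cartan = cvs.span (range (\<lambda>i. sl_D (axis i 1) 0))"

text \<open>
  A linear functional on the subspace \<open>cartan\<close> is represented by the unique function that
  restricts to it and vanishes off \<open>cartan\<close>.
\<close>

definition cartan_dual :: "('n::finite sdiff_laurent \<Rightarrow> complex) set"
  where "cartan_dual = {l. (\<forall>x\<in>cartan. \<forall>y\<in>cartan. l (x + y) = l x + l y) \<and>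
    (\<forall>c. \<forall>x\<in>cartan. l (c *\<^sub>C x) = c * l x) \<and> (\<forall>x. x \<notin> cartan \<longrightarrow> l x = 0)}"

definition weight_space ::
    "(('n::finite sdiff_laurent, 'b::complex_comm_algebra) tensor \<Rightarrow> 'v::complex_space \<Rightarrow> 'v)
      \<Rightarrow> ('n sdiff_laurent \<Rightarrow> complex) \<Rightarrow> 'v set"
  where "weight_space \<rho> l = {v. \<forall>h\<in>cartan. \<rho> (h \<otimes> 1) v = l h *\<^sub>C v}"

definition internal_direct_sum :: "'i set \<Rightarrow> ('i \<Rightarrow> 'v::complex_space set) \<Rightarrow> bool"
  where "internal_direct_sum I U \<longleftrightarrow> (\<forall>v. \<exists>!f. finite {i. f i \<noteq> 0} \<and> {i. f i \<noteq> 0} \<subseteq> I \<and>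
    (\<forall>i\<in>I. f i \<in> U i) \<and> v = (\<Sum>i | f i \<noteq> 0. f i))"

text \<open>
  \<open>cvs.dim\<close> is \<open>0\<close> on spaces without a finite basis, hence the separate finiteness requirement.
\<close>

definition dim_at_most :: "'v::complex_space set \<Rightarrow> nat \<Rightarrow> bool"
  where "dim_at_most W M \<longleftrightarrow> (\<exists>S. finite S \<and> cvs.span S = W) \<and> cvs.dim W \<le> M"

definition uniformly_bounded_weight_module ::
    "(('n::finite sdiff_laurent, 'b::complex_comm_algebra) tensor \<Rightarrow> 'v::complex_space \<Rightarrow> 'v)
      \<Rightarrow> bool"
  where "uniformly_bounded_weight_module \<rho> \<longleftrightarrow> lie_module \<rho> \<and>
    internal_direct_sum cartan_dual (weight_space \<rho>) \<and>
    (\<exists>M > 0. \<forall>l\<in>cartan_dual. dim_at_most (weight_space \<rho> l) M)"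

end

theory Submission
  imports Defs "HOL-Computational_Algebra.Fundamental_Theorem_Algebra"
begin

text \<open>
  Write \<open>x\<^sub>s\<close> for the action of \<open>t\<^sup>s\<close> on \<open>V\<close>. The idea is that \<open>V\<close> is an evaluation module up to a
  twist: there is a character \<open>\<psi>\<close> of \<open>B\<close> such that \<open>t\<^sup>s \<otimes> b\<close> acts as \<open>\<psi> b x\<^sub>s\<close> and \<open>D(u, r) \<otimes> b\<close> as
  \<open>\<psi> b D(u, r)\<close> for nonzero \<open>s\<close> and \<open>r\<close>, while \<open>t\<^sup>0 \<otimes> b\<close> and \<open>D(u, 0) \<otimes> b - \<psi> b D(u, 0)\<close> act as
  scalars. Hence every subspace that is stable under \<open>S\<^sub>N \<ltimes> A\<^sub>N\<close> is stable under
  \<open>(S\<^sub>N \<ltimes> A\<^sub>N) \<otimes> B\<close>, and the orbit of a nonzero vector under the enveloping algebra is everything.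

  Two tools are used throughout. First, if an operator \<open>z\<close> of weight zero commutes with its
  commutators with the Lie algebra, then its generalized eigenspaces are submodules, so by
  irreducibility \<open>z\<close> has a single eigenvalue \<open>\<alpha>\<close>, and \<open>(z - \<alpha>)\<^sup>M = 0\<close>, where \<open>M\<close> bounds the
  dimensions of the weight spaces (\<open>one_eigenvalue\<close>). Second, in a commutative algebra of
  operators, products of sufficiently many derivatives of a fixed nilpotent element vanish
  (\<open>derivatives_of_nilpotent\<close>).

  Let \<open>s \<noteq> 0\<close>. If the single eigenvalue of \<open>x\<^sub>s x\<^sub>-\<^sub>s\<close> were zero, the second tool would show that
  products of sufficiently many \<open>t\<^sup>q \<otimes> b\<close> with \<open>q \<noteq> 0\<close> vanish, so these operators would kill a
  nonzero vector, thus all of \<open>V\<close> (\<open>X_product_not_nilp\<close>). Hence every \<open>x\<^sub>s\<close> is injective. Using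
  \<open>x\<^sub>-\<^sub>r\<close> to move operators of weight \<open>r\<close> to weight zero, and a common kernel vector of commuting
  nilpotent operators on one weight space, homogeneous nilpotent polynomials in the \<open>t\<^sup>s \<otimes> b\<close>
  vanish (\<open>nilp_XA_zero\<close>); applied to \<open>(t\<^sup>s \<otimes> b) x\<^sub>-\<^sub>s\<close> minus its eigenvalue, this gives the
  character (\<open>X_eval\<close>).

  Now let \<open>b\<close> be in the kernel of \<open>\<psi>\<close>. Then \<open>D(u, r) \<otimes> b\<close> commutes with all \<open>x\<^sub>s\<close> and is determined
  by its restriction to one weight space. So the \<open>D(v, s) \<otimes> b\<close>, with \<open>v\<close> and \<open>s\<close> fixed, form a
  finite-dimensional space. If it is nonzero, it has a common eigenvector \<open>D(v, s) \<otimes> c\<close> for the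
  adjoint action of the \<open>D(u, 0) \<otimes> b\<close>, whose eigenvalues must be zero since they would otherwise
  grow linearly with \<open>s\<close> (\<open>kernel_eigenvector\<close>, \<open>kernel_eigenvalue_zero\<close>). Then the
  \<open>D(v, r) \<otimes> c\<close>, \<open>r \<noteq> 0\<close>, are commuting nilpotent operators whose common kernel is a nonzero
  submodule, a contradiction (\<open>D_kernel_zero\<close>).
\<close>

section \<open>The algebra of linear endomorphisms\<close>

text \<open>The associative unital algebra of linear endomorphisms; multiplication is composition.\<close>

typedef (overloaded) 'v endo = "{f :: 'v::complex_space \<Rightarrow> 'v. clinear f}"
  morphisms app Endo
  by (rule exI[of _ "\<lambda>x. x"]) (simp add: clinearI)

setup_lifting type_definition_endo

instantiation endo :: (complex_space) "{ring, monoid_mult, complex_space}"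
begin

lift_definition zero_endo :: "'a endo" is "\<lambda>_. 0" by (rule clinearI) simp_all
lift_definition one_endo :: "'a endo" is "\<lambda>x. x" by (rule clinearI) simp_all
lift_definition plus_endo :: "'a endo \<Rightarrow> 'a endo \<Rightarrow> 'a endo" is "\<lambda>f g x. f x + g x"
  by (rule clinearI) (simp_all add: clinearD cscale_add_right)
lift_definition minus_endo :: "'a endo \<Rightarrow> 'a endo \<Rightarrow> 'a endo" is "\<lambda>f g x. f x - g x"
  by (rule clinearI) (simp_all add: clinearD cvs.scale_right_diff_distrib)
lift_definition uminus_endo :: "'a endo \<Rightarrow> 'a endo" is "\<lambda>f x. - f x"
  by (rule clinearI) (simp_all add: clinearD)
lift_definition times_endo :: "'a endo \<Rightarrow> 'a endo \<Rightarrow> 'a endo" is "\<lambda>f g x. f (g x)"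
  by (rule clinearI) (simp_all add: clinearD)
lift_definition cscale_endo :: "complex \<Rightarrow> 'a endo \<Rightarrow> 'a endo" is "\<lambda>c f x. c *\<^sub>C f x"
  by (rule clinearI) (simp_all add: clinearD cscale_add_right mult.commute)

instance
  by standard
    (transfer; auto simp: fun_eq_iff clinearD cscale_add_right cscale_add_left algebra_simps)+

end

lemma app_linear: "clinear (app a)"
  using app by blast

lemma app_Endo: "clinear f \<Longrightarrow> app (Endo f) = f"
  by (simp add: Endo_inverse)

lemma app_simps [simp]:
  "app 0 v = 0" "app 1 v = v" "app (a + b) v = app a v + app b v"
  "app (a - b) v = app a v - app b v" "app (- a) v = - app a v"
  "app (a * b) v = app a (app b v)" "app (c *\<^sub>C a) v = c *\<^sub>C app a v"
  "app a 0 = 0" "app a (v + w) = app a v + app a w" "app a (v - w) = app a v - app a w"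
  "app a (c *\<^sub>C v) = c *\<^sub>C app a v"
  by (transfer; simp add: clinearD clinear_zero clinear_diff)+

lemma endo_eqI: "(\<And>v. app a v = app b v) \<Longrightarrow> a = b"
  by transfer auto

lemma endo_scale_mult [simp]:
  fixes a b :: "'v::complex_space endo"
  shows "(c *\<^sub>C a) * b = c *\<^sub>C (a * b)" "a * (c *\<^sub>C b) = c *\<^sub>C (a * b)"
  by (rule endo_eqI, simp)+

lemma app_sum: "app a (sum f S) = (\<Sum>i\<in>S. app a (f i))"
  by (induction S rule: infinite_finite_induct) simp_all

lemma app_sum_left: "app (sum f S) v = (\<Sum>i\<in>S. app (f i) v)"
  by (induction S rule: infinite_finite_induct) simp_all

lemma app_power_stable: "(\<And>w. w \<in> F \<Longrightarrow> app a w \<in> F) \<Longrightarrow> w \<in> F \<Longrightarrow> app (a ^ i) w \<in> F"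
  by (induction i) simp_all

lemma app_commute: "a * b = b * a \<Longrightarrow> app a (app b w) = app b (app a w)"
  by (metis app_simps(6))

section \<open>Finite-dimensional linear algebra\<close>

text \<open>Contained in the span of a finite set; \<open>W\<close> need not be a subspace.\<close>

definition fin_dim :: "'v::complex_space set \<Rightarrow> bool"
  where "fin_dim W \<longleftrightarrow> (\<exists>T. finite T \<and> W \<subseteq> cvs.span T)"

lemma fin_dim_basis:
  fixes W :: "'v::complex_space set"
  assumes "fin_dim W"
  obtains B where "B \<subseteq> W" "finite B" "cvs.independent B" "W \<subseteq> cvs.span B" "card B = cvs.dim W"
proof -
  obtain B where B: "B \<subseteq> W" "cvs.independent B" "W \<subseteq> cvs.span B" "card B = cvs.dim W"
    using cvs.basis_exists by blast
  obtain T where "finite T" "W \<subseteq> cvs.span T"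
    using assms by (auto simp: fin_dim_def)
  then have "finite B"
    using cvs.independent_span_bound B by blast
  then show ?thesis using B that by blast
qed

lemma dim_at_most_fin_dim: "dim_at_most W M \<Longrightarrow> fin_dim W"
  by (auto simp: dim_at_most_def fin_dim_def)

lemma fin_dim_mono: "fin_dim W \<Longrightarrow> U \<subseteq> W \<Longrightarrow> fin_dim U"
  by (auto simp: fin_dim_def)

lemma dim_psubset:
  fixes W :: "'v::complex_space set"
  assumes "fin_dim W" "cvs.subspace U" "U \<subset> W"
  shows "cvs.dim U < cvs.dim W"
proof -
  have "fin_dim U" using assms fin_dim_mono by blast
  then obtain B where B: "B \<subseteq> U" "finite B" "cvs.independent B" "U \<subseteq> cvs.span B"
    "card B = cvs.dim U" by (rule fin_dim_basis)
  obtain C where C: "C \<subseteq> W" "finite C" "cvs.independent C" "W \<subseteq> cvs.span C"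
    "card C = cvs.dim W" using assms(1) by (rule fin_dim_basis)
  obtain x where x: "x \<in> W" "x \<notin> U" using assms(3) by blast
  have "cvs.span B \<subseteq> U" using B(1) assms(2) by (simp add: cvs.span_minimal)
  then have xs: "x \<notin> cvs.span B" using x by blast
  then have "cvs.independent (insert x B)"
    using B(3) by (simp add: cvs.independent_insert)
  moreover have "insert x B \<subseteq> cvs.span C" using x B(1) C(4) assms(3) by blast
  ultimately have "card (insert x B) \<le> card C"
    using cvs.independent_span_bound C(2) by blast
  moreover have "x \<notin> B" using xs cvs.span_base by blast
  ultimately show ?thesis using B C by simp
qed

lemma nontrivial_relation:
  fixes v :: "nat \<Rightarrow> 'v::complex_space"
  assumes T: "finite T" "card T \<le> n" and v: "\<And>i. v i \<in> cvs.span T"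
  obtains g where "\<exists>i\<le>n. g i \<noteq> 0" "(\<Sum>i\<le>n. g i *\<^sub>C v i) = 0"
proof (cases "inj_on v {..n}")
  case True
  have "\<not> cvs.independent (v ` {..n})"
  proof
    assume "cvs.independent (v ` {..n})"
    then have "card (v ` {..n}) \<le> card T"
      using cvs.independent_span_bound[OF T(1)] v by blast
    then show False using T(2) True by (simp add: card_image)
  qed
  then obtain u where u: "\<exists>x\<in>v ` {..n}. u x \<noteq> 0" "(\<Sum>x\<in>v ` {..n}. u x *\<^sub>C x) = 0"
    by (auto simp: cvs.dependent_finite)
  have "(\<Sum>i\<le>n. u (v i) *\<^sub>C v i) = 0"
    using u(2) True by (simp add: sum.reindex)
  then show ?thesis using u(1) that[of "\<lambda>i. u (v i)"] by auto
next
  case False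
  then obtain i j where ij: "i \<le> n" "j \<le> n" "i \<noteq> j" "v i = v j"
    by (auto simp: inj_on_def)
  let ?g = "\<lambda>k. if k = i then 1 else if k = j then -1 else 0 :: complex"
  have "(\<Sum>k\<le>n. ?g k *\<^sub>C v k) = (\<Sum>k\<in>{i, j}. ?g k *\<^sub>C v k)"
    by (rule sum.mono_neutral_right) (use ij in auto)
  also have "\<dots> = 0" using ij by simp
  finally have "(\<Sum>k\<le>n. ?g k *\<^sub>C v k) = 0" .
  moreover have "\<exists>k\<le>n. ?g k \<noteq> 0" using ij(1) by (intro exI[of _ i]) simp
  ultimately show ?thesis by (rule that[rotated])
qed

text \<open>The product of the \<open>a - \<alpha>\<close> over a list of scalars \<open>\<alpha>\<close>.\<close>

definition shifts :: "complex list \<Rightarrow> 'v::complex_space endo \<Rightarrow> 'v endo"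
  where "shifts \<alpha>s a = prod_list (map (\<lambda>\<alpha>. a - \<alpha> *\<^sub>C 1) \<alpha>s)"

lemma shifts_simps [simp]:
  "shifts [] a = 1" "shifts (\<alpha> # \<alpha>s) a = (a - \<alpha> *\<^sub>C 1) * shifts \<alpha>s a"
  "shifts (\<alpha>s @ \<beta>s) a = shifts \<alpha>s a * shifts \<beta>s a"
  by (simp_all add: shifts_def)

lemma shifts_commute: "a * b = b * a \<Longrightarrow> shifts \<alpha>s a * b = b * shifts \<alpha>s a"
proof (induction \<alpha>s)
  case (Cons \<alpha> \<alpha>s)
  have "shifts (\<alpha> # \<alpha>s) a * b = (a - \<alpha> *\<^sub>C 1) * (shifts \<alpha>s a * b)"
    by (simp add: mult.assoc)
  also have "\<dots> = ((a - \<alpha> *\<^sub>C 1) * b) * shifts \<alpha>s a"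
    by (simp only: Cons mult.assoc)
  also have "(a - \<alpha> *\<^sub>C 1) * b = b * (a - \<alpha> *\<^sub>C 1)"
    using Cons.prems by (simp add: algebra_simps)
  finally show ?case by (simp add: mult.assoc)
qed simp

lemma shifts_stable:
  assumes "cvs.subspace F" "\<And>w. w \<in> F \<Longrightarrow> app a w \<in> F" "w \<in> F"
  shows "app (shifts \<alpha>s a) w \<in> F"
  using assms by (induction \<alpha>s) (auto simp: cvs.subspace_diff cvs.subspace_scale)

text \<open>The value of a polynomial at an endomorphism, by the Horner scheme.\<close>

definition poly_endo :: "complex poly \<Rightarrow> 'v::complex_space endo \<Rightarrow> 'v endo"
  where "poly_endo p a = fold_coeffs (\<lambda>c r. c *\<^sub>C 1 + a * r) p 0"

lemma poly_endo_simps [simp]: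
  "poly_endo 0 a = 0" "poly_endo (pCons c p) a = c *\<^sub>C 1 + a * poly_endo p a"
  by (cases "p = 0"; cases "c = 0"; simp add: poly_endo_def)+

lemma poly_endo_add: "poly_endo (p + q) a = poly_endo p a + poly_endo q a"
  by (induction p q rule: poly_induct2) (simp_all add: algebra_simps cscale_add_left)

lemma poly_endo_smult: "poly_endo (smult c p) a = c *\<^sub>C poly_endo p a"
  by (induction p) (simp_all add: cscale_add_right)

lemma poly_endo_diff: "poly_endo (p - q) a = poly_endo p a - poly_endo q a"
  using poly_endo_add[of "p - q" q a] by simp

lemma poly_endo_sum: "poly_endo (sum f S) a = (\<Sum>i\<in>S. poly_endo (f i) a)"
  by (induction S rule: infinite_finite_induct) (simp_all add: poly_endo_add)

lemma poly_endo_monom: "poly_endo (monom c i) a = c *\<^sub>C a ^ i"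
  by (induction i) (simp_all add: monom_0 monom_Suc)

lemma poly_endo_linear_factor:
  "poly_endo ([:- \<alpha>, 1:] * p) a = (a - \<alpha> *\<^sub>C 1) * poly_endo p a"
  by (simp add: poly_endo_diff poly_endo_smult left_diff_distrib)

lemma shifts_of_poly_endo:
  "p \<noteq> 0 \<Longrightarrow> app (poly_endo p a) w = 0 \<Longrightarrow> \<exists>\<alpha>s. app (shifts \<alpha>s a) w = 0"
proof (induction "degree p" arbitrary: p w)
  case 0
  then obtain c where "p = [:c:]" "c \<noteq> 0"
    by (metis degree_eq_zeroE pCons_0_0)
  then have "w = 0" using 0 by simp
  then show ?case by (intro exI[of _ "[]"]) simp
next
  case (Suc n)
  then have "\<not> constant (poly p)" by (simp add: constant_degree)
  then obtain \<alpha> where "poly p \<alpha> = 0" using fundamental_theorem_of_algebra by blast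
  then obtain q where q: "p = [:- \<alpha>, 1:] * q" by (auto simp: poly_eq_0_iff_dvd elim: dvdE)
  then have "q \<noteq> 0" using Suc.prems by auto
  then have "degree q = n" using Suc(2) q by (subst (asm) q, subst (asm) degree_mult_eq) auto
  have c: "poly_endo q a * (a - \<alpha> *\<^sub>C 1) = (a - \<alpha> *\<^sub>C 1) * poly_endo q a"
  proof -
    have "poly_endo q a * a = a * poly_endo q a"
      by (induction q) (simp_all add: algebra_simps)
    then show ?thesis by (simp add: algebra_simps)
  qed
  have "app (poly_endo q a) (app (a - \<alpha> *\<^sub>C 1) w) = 0"
    using Suc.prems(2) app_commute[OF c, of w]
    unfolding q poly_endo_linear_factor by simp
  then obtain \<alpha>s where "app (shifts \<alpha>s a) (app (a - \<alpha> *\<^sub>C 1) w) = 0"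
    using Suc(1) \<open>degree q = n\<close> \<open>q \<noteq> 0\<close> by metis
  then have "app (shifts (\<alpha>s @ [\<alpha>]) a) w = 0" by simp
  then show ?case by blast
qed

lemma shifts_kill_vector:
  assumes F: "fin_dim F" "\<And>w. w \<in> F \<Longrightarrow> app a w \<in> F" and w: "w \<in> F"
  shows "\<exists>\<alpha>s. app (shifts \<alpha>s a) w = 0"
proof -
  obtain T where T: "finite T" "F \<subseteq> cvs.span T" using F(1) by (auto simp: fin_dim_def)
  have "app (a ^ i) w \<in> cvs.span T" for i
    using app_power_stable[of F a w i] F(2) w T(2) by blast
  then obtain g where g: "\<exists>i\<le>card T. g i \<noteq> 0"
    and 0: "(\<Sum>i\<le>card T. g i *\<^sub>C app (a ^ i) w) = 0"
    using nontrivial_relation[OF T(1) order_refl, of "\<lambda>i. app (a ^ i) w"] by blast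
  define p where "p = (\<Sum>i\<le>card T. monom (g i) i)"
  have "coeff p i = g i" if "i \<le> card T" for i
    using that by (simp add: p_def coeff_sum)
  then have "p \<noteq> 0" using g by force
  moreover have "app (poly_endo p a) w = 0"
    using 0 by (simp add: p_def poly_endo_sum poly_endo_monom app_sum_left)
  ultimately show ?thesis by (rule shifts_of_poly_endo)
qed

lemma eigenvector_exists:
  assumes F: "cvs.subspace F" "fin_dim F" "\<And>w. w \<in> F \<Longrightarrow> app a w \<in> F" and "F \<noteq> {0}"
  shows "\<exists>w\<in>F. w \<noteq> 0 \<and> (\<exists>\<alpha>. app a w = \<alpha> *\<^sub>C w)"
proof -
  obtain w where w: "w \<in> F" "w \<noteq> 0"
    using assms(4) F(1) cvs.subspace_0 by blast
  obtain \<alpha>s where "app (shifts \<alpha>s a) w = 0"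
    using shifts_kill_vector[OF F(2,3) w(1)] by blast
  then show ?thesis
  proof (induction \<alpha>s)
    case Nil
    then show ?case using w by simp
  next
    case (Cons \<alpha> \<alpha>s)
    show ?case
    proof (cases "app (shifts \<alpha>s a) w = 0")
      case False
      have "app (shifts \<alpha>s a) w \<in> F" using shifts_stable[OF F(1,3) w(1)] .
      then show ?thesis using Cons.prems False by (auto intro!: bexI[of _ "app (shifts \<alpha>s a) w"])
    qed (use Cons in simp)
  qed
qed

lemma shifts_annihilate:
  assumes F: "fin_dim F" "\<And>w. w \<in> F \<Longrightarrow> app a w \<in> F"
  obtains \<alpha>s where "\<And>w. w \<in> F \<Longrightarrow> app (shifts \<alpha>s a) w = 0"
proof -
  obtain B where B: "B \<subseteq> F" "finite B" "F \<subseteq> cvs.span B"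
    using fin_dim_basis[OF F(1)] by metis
  from B(2,1) have "\<exists>\<alpha>s. \<forall>w\<in>B. app (shifts \<alpha>s a) w = 0"
  proof (induction rule: finite_induct)
    case (insert x B)
    then obtain \<alpha>s where "\<forall>w\<in>B. app (shifts \<alpha>s a) w = 0" by auto
    moreover obtain \<beta>s where "app (shifts \<beta>s a) x = 0"
      using shifts_kill_vector[OF F, of x] insert.prems by auto
    moreover have "shifts \<alpha>s a * shifts \<beta>s a = shifts \<beta>s a * shifts \<alpha>s a"
      by (intro shifts_commute shifts_commute[symmetric]) simp
    ultimately have "\<forall>w\<in>insert x B. app (shifts (\<beta>s @ \<alpha>s) a) w = 0"
      using app_commute[of "shifts \<alpha>s a" "shifts \<beta>s a" x] by auto
    then show ?case by blast
  qed simp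
  then obtain \<alpha>s where "\<And>w. w \<in> B \<Longrightarrow> app (shifts \<alpha>s a) w = 0" by blast
  then have "app (shifts \<alpha>s a) w = 0" if "w \<in> F" for w
    using clinear_vanish_on_span[OF app_linear] that B(3) by blast
  then show ?thesis using that by blast
qed

text \<open>The eigenvalues of \<open>a\<close> are among the \<open>\<alpha>s\<close> if the product of the \<open>a - \<alpha>\<close> vanishes.\<close>

lemma shifts_cancel:
  assumes 0: "shifts \<alpha>s a = 0" and "\<beta> \<notin> set \<alpha>s" "app a w = \<beta> *\<^sub>C w"
  shows "w = 0"
proof -
  have "\<exists>c. c \<noteq> 0 \<and> app (shifts \<alpha>s a) w = c *\<^sub>C w"
    using assms(2)
  proof (induction \<alpha>s)
    case Nil
    show ?case by (auto intro!: exI[of _ 1])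
  next
    case (Cons \<alpha> \<alpha>s)
    then obtain c where "c \<noteq> 0" "app (shifts \<alpha>s a) w = c *\<^sub>C w" by auto
    then show ?case using Cons.prems assms(3)
      by (auto intro!: exI[of _ "c * (\<beta> - \<alpha>)"] simp: algebra_simps)
  qed
  then show ?thesis using 0 by auto
qed

lemma common_eigenvector:
  assumes F: "cvs.subspace F" "fin_dim F" "F \<noteq> {0}"
    and T: "\<And>a w. a \<in> T \<Longrightarrow> w \<in> F \<Longrightarrow> app a w \<in> F"
    and comm: "\<And>a b. a \<in> T \<Longrightarrow> b \<in> T \<Longrightarrow> a * b = b * a"
  shows "\<exists>w\<in>F. w \<noteq> 0 \<and> (\<forall>a\<in>T. \<exists>\<alpha>. app a w = \<alpha> *\<^sub>C w)"
  using F T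
proof (induction "cvs.dim F" arbitrary: F rule: less_induct)
  case less
  obtain w0 where w0: "w0 \<in> F" "w0 \<noteq> 0"
    using less.prems(1,3) cvs.subspace_0 by blast
  show ?case
  proof (cases "\<forall>a\<in>T. \<exists>\<alpha>. \<forall>w\<in>F. app a w = \<alpha> *\<^sub>C w")
    case True
    then show ?thesis using w0 by blast
  next
    case False
    then obtain a where a: "a \<in> T" "\<And>\<alpha>. \<exists>w\<in>F. app a w \<noteq> \<alpha> *\<^sub>C w" by blast
    obtain w \<alpha> where w: "w \<in> F" "w \<noteq> 0" "app a w = \<alpha> *\<^sub>C w"
      using eigenvector_exists[OF less.prems(1,2) less.prems(4)[OF a(1)] less.prems(3)] by blast
    define U where "U = {x \<in> F. app a x = \<alpha> *\<^sub>C x}"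
    have sub: "cvs.subspace U"
      using less.prems(1) unfolding U_def cvs.subspace_def
      by (auto simp: cscale_add_right mult.commute)
    have "U \<subset> F" using a(2)[of \<alpha>] by (auto simp: U_def)
    then have "cvs.dim U < cvs.dim F" "fin_dim U"
      using dim_psubset[OF less.prems(2) sub] fin_dim_mono less.prems(2) by blast+
    moreover have "U \<noteq> {0}" using w by (auto simp: U_def)
    moreover have "app b x \<in> U" if "b \<in> T" "x \<in> U" for b x
      using that less.prems(4) app_commute[OF comm[OF a(1) that(1)], of x] by (auto simp: U_def)
    ultimately obtain x where "x \<in> U" "x \<noteq> 0" "\<forall>a\<in>T. \<exists>\<alpha>. app a x = \<alpha> *\<^sub>C x"
      using less.hyps[of U] sub by blast
    then show ?thesis by (auto simp: U_def)
  qed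
qed

text \<open>A vector killed by some power of \<open>n\<close> is killed by \<open>n ^ M\<close>, \<open>M\<close> bounding the dimension.\<close>

lemma nilpotency_index:
  assumes F: "dim_at_most F M" "\<And>w. w \<in> F \<Longrightarrow> app n w \<in> F"
    and w: "w \<in> F" "app (n ^ k) w = 0"
  shows "app (n ^ M) w = 0"
proof (rule ccontr)
  assume nz: "app (n ^ M) w \<noteq> 0"
  have sh: "app (n ^ (i + j)) w = app (n ^ i) (app (n ^ j) w)" for i j
    by (simp add: power_add)
  obtain B where B: "finite B" "F \<subseteq> cvs.span B" "card B \<le> M"
    using fin_dim_basis[OF dim_at_most_fin_dim[OF F(1)]] F(1) by (metis dim_at_most_def)
  define l where "l = (LEAST i. app (n ^ i) w = 0)"
  have l: "app (n ^ l) w = 0" "\<And>i. i < l \<Longrightarrow> app (n ^ i) w \<noteq> 0"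
    unfolding l_def using w(2) by (rule LeastI) (rule not_less_Least)
  have after: "app (n ^ i) w = 0" if "l \<le> i" for i
    using sh[of "i - l" l] that l(1) by simp
  have Ml: "M < l" using nz after linorder_not_less by blast
  have "app (n ^ i) w \<in> cvs.span B" for i
    using app_power_stable[of F n w i] F(2) w(1) B(2) by blast
  then obtain g where g: "\<exists>i\<le>M. g i \<noteq> 0" and 0: "(\<Sum>i\<le>M. g i *\<^sub>C app (n ^ i) w) = 0"
    using nontrivial_relation[OF B(1,3), of "\<lambda>i. app (n ^ i) w"] by blast
  define j where "j = (LEAST i. g i \<noteq> 0)"
  have j: "g j \<noteq> 0" "\<And>i. i < j \<Longrightarrow> g i = 0" "j \<le> M"
    unfolding j_def using g
    by (metis (mono_tags, lifting) LeastI, metis (mono_tags, lifting) not_less_Least,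
        metis (mono_tags, lifting) Least_le order_trans)
  \<comment> \<open>Applying \<open>n ^ (l - 1 - j)\<close> leaves only the term of index \<open>j\<close>.\<close>
  have "0 = app (n ^ (l - 1 - j)) (\<Sum>i\<le>M. g i *\<^sub>C app (n ^ i) w)" by (simp add: 0)
  also have "\<dots> = (\<Sum>i\<le>M. g i *\<^sub>C app (n ^ (l - 1 - j + i)) w)"
    by (simp add: app_sum sh)
  also have "\<dots> = (\<Sum>i\<in>{j}. g i *\<^sub>C app (n ^ (l - 1 - j + i)) w)"
  proof (rule sum.mono_neutral_right)
    show "\<forall>i\<in>{..M} - {j}. g i *\<^sub>C app (n ^ (l - 1 - j + i)) w = 0"
    proof
      fix i assume "i \<in> {..M} - {j}"
      then consider "i < j" | "i > j" by force
      then show "g i *\<^sub>C app (n ^ (l - 1 - j + i)) w = 0"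
        by cases (use j after Ml in auto)
    qed
  qed (use j in auto)
  also have "\<dots> = g j *\<^sub>C app (n ^ (l - 1)) w" using j(3) Ml by simp
  finally show False using j(1) l(2)[of "l - 1"] Ml by simp
qed

lemma fin_dim_by_linear_map:
  assumes W: "cvs.subspace W" and f: "clinear f" "fin_dim (f ` W)" "fin_dim {w \<in> W. f w = 0}"
  shows "fin_dim W"
proof -
  obtain B where B: "B \<subseteq> f ` W" "finite B" "f ` W \<subseteq> cvs.span B"
    using fin_dim_basis[OF f(2)] by metis
  then obtain P where P: "P \<subseteq> W" "finite P" "B = f ` P"
    using finite_subset_image by metis
  obtain T where T: "finite T" "{w \<in> W. f w = 0} \<subseteq> cvs.span T"
    using f(3) by (auto simp: fin_dim_def)
  have "w \<in> cvs.span (P \<union> T)" if "w \<in> W" for w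
  proof -
    have "f w \<in> cvs.span (f ` P)" using that B(3) P(3) by blast
    then have "f w \<in> f ` cvs.span P"
      using module_hom.span_image[of cscale cscale f P] f(1) by (simp add: Vector_Spaces.linear_def)
    then obtain p where p: "p \<in> cvs.span P" "f w = f p" by blast
    have "p \<in> W" using p(1) P(1) W cvs.span_minimal by blast
    then have "w - p \<in> cvs.span T"
      using T(2) that W p(2) by (auto simp: cvs.subspace_diff clinear_diff[OF f(1)])
    then have "p + (w - p) \<in> cvs.span (P \<union> T)"
      using p(1) by (intro cvs.span_add) (meson cvs.span_mono in_mono sup_ge1 sup_ge2)+
    then show ?thesis by simp
  qed
  then show ?thesis using P(2) T(1) unfolding fin_dim_def by blast
qed

text \<open>
  A space of operators that are determined by their values on a finite set \<open>S\<close>, and take values in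
  a finite-dimensional space there, is finite-dimensional.
\<close>

lemma fin_dim_endo:
  assumes "finite S" "fin_dim U" "cvs.subspace Y"
    and "\<And>y w. y \<in> Y \<Longrightarrow> w \<in> S \<Longrightarrow> app y w \<in> U"
    and "\<And>y. y \<in> Y \<Longrightarrow> (\<forall>w\<in>S. app y w = 0) \<Longrightarrow> y = 0"
  shows "fin_dim Y"
  using assms
proof (induction S arbitrary: Y rule: finite_induct)
  case empty
  then have "Y \<subseteq> cvs.span {}" by auto
  then show ?case unfolding fin_dim_def by blast
next
  case (insert x S)
  have "fin_dim {y \<in> Y. app y x = 0}"
    by (rule insert.IH) (use insert in \<open>auto simp: cvs.subspace_def\<close>)
  moreover have "clinear (\<lambda>y. app y x)" by (rule clinearI) simp_all
  moreover have "fin_dim ((\<lambda>y. app y x) ` Y)"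
    using insert.prems(1) by (rule fin_dim_mono) (use insert.prems(3) in auto)
  ultimately show ?case using fin_dim_by_linear_map insert.prems(2) by blast
qed

section \<open>Commutators and nilpotent elements\<close>

text \<open>The commutator \<open>a b - b a\<close>; \<open>cmt d\<close> is a derivation, see \<open>cmt_mult\<close>.\<close>

definition cmt :: "'v::complex_space endo \<Rightarrow> 'v endo \<Rightarrow> 'v endo"
  where "cmt a b = a * b - b * a"

lemma cmt_eq_0_iff: "cmt a b = 0 \<longleftrightarrow> a * b = b * a"
  by (simp add: cmt_def)

lemma cmt_simps [simp]:
  "cmt d 1 = 0" "cmt d 0 = 0" "cmt d (a + b) = cmt d a + cmt d b" "cmt d (a - b) = cmt d a - cmt d b"
  "cmt d (c *\<^sub>C a) = c *\<^sub>C cmt d a" "cmt (c *\<^sub>C d) a = c *\<^sub>C cmt d a" "cmt d (- a) = - cmt d a"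
  by (simp_all add: cmt_def algebra_simps cvs.scale_right_diff_distrib)

lemma cmt_mult: "cmt d (a * b) = cmt d a * b + a * cmt d b"
  by (simp add: cmt_def algebra_simps)

lemma cmt_jacobi: "cmt d (cmt a b) = cmt (cmt d a) b + cmt a (cmt d b)"
  by (simp add: cmt_def algebra_simps)

lemma app_cmt: "app a (app d w) = app d (app a w) - app (cmt d a) w"
  by (simp add: cmt_def)

lemma cmt_power:
  assumes "a * cmt d a = cmt d a * a"
  shows "cmt d (a ^ Suc k) = of_nat (Suc k) *\<^sub>C (a ^ k * cmt d a)"
proof (induction k)
  case (Suc k)
  have "cmt d (a ^ Suc (Suc k)) = cmt d a * a ^ Suc k + a * cmt d (a ^ Suc k)"
    by (simp only: power_Suc cmt_mult)
  also have "cmt d a * a ^ Suc k = a ^ Suc k * cmt d a"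
    by (rule power_commuting_commutes[symmetric]) (rule assms)
  finally have "cmt d (a ^ Suc (Suc k)) =
      a ^ Suc k * cmt d a + of_nat (Suc k) *\<^sub>C (a ^ Suc k * cmt d a)"
    unfolding Suc.IH by (simp only: endo_scale_mult power_Suc mult.assoc)
  then show ?case
    by (simp only: of_nat_Suc[of "Suc k"] cscale_add_left cscale_one)
qed simp

text \<open>Nilpotent endomorphisms. The exponent \<open>0\<close> is allowed; it matters only if \<open>1 = 0\<close>.\<close>

definition nilp :: "'v::complex_space endo \<Rightarrow> bool"
  where "nilp a \<longleftrightarrow> (\<exists>k. a ^ k = 0)"

lemma nilp_of_power: "nilp (a ^ k) \<Longrightarrow> nilp a"
  by (auto simp: nilp_def power_mult[symmetric])

lemma nilp_scale: "nilp a \<Longrightarrow> nilp (c *\<^sub>C a)"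
proof -
  have "(c *\<^sub>C a) ^ k = c ^ k *\<^sub>C a ^ k" for k
    by (induction k) (simp_all add: mult.commute)
  then show "nilp a \<Longrightarrow> nilp (c *\<^sub>C a)" by (auto simp: nilp_def)
qed

lemma nilp_mult:
  assumes "a * b = b * a" "nilp a"
  shows "nilp (a * b)"
proof -
  have "(a * b) ^ k = b ^ k * a ^ k" for k
  proof (induction k)
    case (Suc k)
    have "(a * b) ^ Suc k = b * a * (b ^ k * a ^ k)"
      by (simp only: power_Suc Suc.IH) (simp only: assms(1))
    also have "\<dots> = b * (a * b ^ k) * a ^ k" by (simp add: mult.assoc)
    also have "a * b ^ k = b ^ k * a"
      by (rule power_commuting_commutes[symmetric]) (rule assms(1)[symmetric])
    finally show ?case by (simp add: mult.assoc)
  qed simp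
  then show ?thesis using assms(2) unfolding nilp_def by (metis mult_zero_right)
qed

lemma nilp_add:
  assumes ab: "a * b = b * a" and "nilp a" "nilp b"
  shows "nilp (a + b)"
proof -
  obtain k l where kl: "a ^ k = 0" "b ^ l = 0" using assms by (auto simp: nilp_def)
  have z: "a ^ i * b ^ j = 0" if "k \<le> i \<or> l \<le> j" for i j
    using that kl by (metis le_add_diff_inverse mult_zero_left mult_zero_right power_add)
  have "(a + b) ^ m * (a ^ i * b ^ j) = 0" if "k + l \<le> m + i + j" for m i j
    using that
  proof (induction m arbitrary: i j)
    case 0
    then show ?case using z by (metis add_0 add_less_mono linorder_not_less mult_zero_right)
  next
    case (Suc m)
    have "b * a ^ i = a ^ i * b"
      by (rule power_commuting_commutes[symmetric]) (rule ab)
    then have "(a + b) * (a ^ i * b ^ j) = a ^ Suc i * b ^ j + a ^ i * b ^ Suc j"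
      by (simp add: distrib_right mult.assoc[symmetric])
    moreover have "(a + b) ^ Suc m * (a ^ i * b ^ j) = (a + b) ^ m * ((a + b) * (a ^ i * b ^ j))"
      by (simp only: power_Suc2 mult.assoc)
    ultimately have "(a + b) ^ Suc m * (a ^ i * b ^ j) =
        (a + b) ^ m * (a ^ Suc i * b ^ j) + (a + b) ^ m * (a ^ i * b ^ Suc j)"
      by (simp only: distrib_left)
    then show ?case
      using Suc.IH[of "Suc i" j] Suc.IH[of i "Suc j"] Suc.prems
      by simp
  qed
  from this[of "k + l" 0 0] show ?thesis by (auto simp: nilp_def)
qed

lemma nilp_diff: "a * b = b * a \<Longrightarrow> nilp a \<Longrightarrow> nilp b \<Longrightarrow> nilp (a - b)"
  using nilp_add[of a "(-1) *\<^sub>C b"] nilp_scale[of b "-1"] by simp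

lemma nilp_eigenvalue: "nilp a \<Longrightarrow> app a w = \<alpha> *\<^sub>C w \<Longrightarrow> w \<noteq> 0 \<Longrightarrow> \<alpha> = 0"
proof -
  assume a: "nilp a" "app a w = \<alpha> *\<^sub>C w" "w \<noteq> 0"
  have "app (a ^ k) w = \<alpha> ^ k *\<^sub>C w" for k
    by (induction k) (simp_all add: a(2) mult.commute)
  then show "\<alpha> = 0" using a(1,3) by (auto simp: nilp_def) (metis app_simps(1) cvs.scale_eq_0_iff power_not_zero)
qed

lemma commute_prod_list:
  assumes "\<And>x. x \<in> set xs \<Longrightarrow> c * x = x * c"
  shows "c * prod_list xs = prod_list xs * (c :: 'v::complex_space endo)"
  using assms
proof (induction xs)
  case (Cons x xs)
  have "c * prod_list (x # xs) = x * (c * prod_list xs)"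
    using Cons.prems[of x] by (simp add: mult.assoc[symmetric])
  also have "\<dots> = prod_list (x # xs) * c"
    using Cons by (simp add: mult.assoc)
  finally show ?case .
qed simp

text \<open>
  In a commutative algebra over a field of characteristic zero, the derivatives of a nilpotent
  element are nilpotent. More precisely: if \<open>n ^ k = 0\<close>, then any product of \<open>2 k\<close> derivatives of
  \<open>n\<close>, along arbitrary derivations, vanishes. Inductively, \<open>n ^ (k - j)\<close> annihilates the products
  of \<open>2 j\<close> derivatives: differentiate the relation for \<open>j\<close> and multiply by one further derivative.
\<close>

lemma derivatives_of_nilpotent:
  fixes n :: "'v::complex_space endo"
  assumes comm: "\<And>a b. a \<in> S \<Longrightarrow> b \<in> S \<Longrightarrow> a * b = b * a"
    and der: "\<And>d a. d \<in> \<D> \<Longrightarrow> a \<in> S \<Longrightarrow> cmt d a \<in> S"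
    and n: "n \<in> S" "n ^ k = 0"
    and xs: "set xs \<subseteq> (\<lambda>d. cmt d n) ` \<D>" "length xs = 2 * k"
  shows "prod_list xs = 0"
proof -
  let ?T = "(\<lambda>d. cmt d n) ` \<D>"
  have TS: "?T \<subseteq> S" using der n(1) by blast
  have "n ^ (k - j) * prod_list xs = 0" if "j \<le> k" "set xs \<subseteq> ?T" "length xs = 2 * j" for j xs
    using that
  proof (induction j arbitrary: xs)
    case 0
    then show ?case using n(2) by simp
  next
    case (Suc j)
    obtain x zs where zs: "xs = x # zs" "length zs = Suc (2 * j)"
      using Suc.prems(3) by (cases xs) auto
    obtain ys y where ys: "zs = ys @ [y]" "length ys = 2 * j"
      using zs(2) by (cases zs rule: rev_cases) auto
    obtain d where d: "d \<in> \<D>" "x = cmt d n" using Suc.prems(2) zs(1) by auto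
    have yT: "y \<in> ?T" "set ys \<subseteq> ?T" using Suc.prems(2) zs(1) ys(1) by auto
    define A where "A = n ^ (k - j)"
    have IH: "A * prod_list us = 0" if "set us \<subseteq> ?T" "length us = 2 * j" for us
      using Suc.IH[of us] Suc.prems(1) that by (simp add: A_def)
    have aux: "A * prod_list pre * cmt d (prod_list us) * y = 0"
      if "set (pre @ us) \<subseteq> ?T" "length (pre @ us) = 2 * j" for pre us
      using that
    proof (induction us arbitrary: pre)
      case (Cons u us)
      have "cmt d u \<in> S" using Cons.prems(1) TS d(1) der by auto
      then have c: "cmt d u * prod_list (us @ [y]) = prod_list (us @ [y]) * cmt d u"
        by (intro commute_prod_list comm) (use Cons.prems(1) yT TS in auto)
      have "A * prod_list pre * (cmt d u * prod_list us) * y =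
          A * prod_list pre * (cmt d u * prod_list (us @ [y]))"
        by (simp add: mult.assoc)
      also have "\<dots> = A * prod_list (pre @ us @ [y]) * cmt d u"
        by (simp only: c) (simp add: mult.assoc)
      also have "A * prod_list (pre @ us @ [y]) = 0"
        by (rule IH) (use Cons.prems yT in auto)
      finally have "A * prod_list pre * (cmt d u * prod_list us) * y = 0" by simp
      moreover have "A * prod_list pre * (u * cmt d (prod_list us)) * y = 0"
        using Cons.IH[of "pre @ [u]"] Cons.prems by (simp add: mult.assoc)
      ultimately show ?case by (simp add: cmt_mult distrib_left distrib_right)
    qed simp
    have "A * prod_list ys = 0" using IH yT ys by blast
    then have "cmt d (A * prod_list ys) * y = 0" by simp
    then have "cmt d A * prod_list ys * y = 0"
      using aux[of "[]" ys] yT ys by (simp add: cmt_mult distrib_right)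
    moreover have "cmt d A = of_nat (Suc (k - Suc j)) *\<^sub>C (n ^ (k - Suc j) * x)"
    proof -
      have "Suc (k - Suc j) = k - j" using Suc.prems(1) by simp
      then show ?thesis
        using cmt_power[of n d "k - Suc j"] comm[OF n(1) der[OF d(1) n(1)]] d(2)
        by (simp add: A_def del: power_Suc of_nat_Suc)
    qed
    ultimately have "of_nat (Suc (k - Suc j)) *\<^sub>C (n ^ (k - Suc j) * prod_list xs) = 0"
      by (simp add: zs ys mult.assoc del: of_nat_Suc)
    then show ?case by (simp del: of_nat_Suc)
  qed
  from this[of k xs] xs show ?thesis by simp
qed

lemma nilp_derivative:
  assumes "\<And>a b. a \<in> S \<Longrightarrow> b \<in> S \<Longrightarrow> a * b = b * a" "\<And>a. a \<in> S \<Longrightarrow> cmt d a \<in> S"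
    and "n \<in> S" "nilp n"
  shows "nilp (cmt d n)"
proof -
  obtain k where "n ^ k = 0" using assms(4) by (auto simp: nilp_def)
  then have "prod_list (replicate (2 * k) (cmt d n)) = 0"
    by (intro derivatives_of_nilpotent[of S "{d}" n k]) (use assms in auto)
  then show ?thesis by (auto simp: nilp_def prod_list_replicate)
qed

text \<open>The unital subalgebra generated by a set.\<close>

inductive_set alg :: "'v::complex_space endo set \<Rightarrow> 'v endo set" for G where
  gen: "g \<in> G \<Longrightarrow> g \<in> alg G"
| one: "1 \<in> alg G"
| add: "a \<in> alg G \<Longrightarrow> b \<in> alg G \<Longrightarrow> a + b \<in> alg G"
| mult: "a \<in> alg G \<Longrightarrow> b \<in> alg G \<Longrightarrow> a * b \<in> alg G"
| scale: "a \<in> alg G \<Longrightarrow> c *\<^sub>C a \<in> alg G"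

lemma alg_diff: "a \<in> alg G \<Longrightarrow> b \<in> alg G \<Longrightarrow> a - b \<in> alg G"
  using alg.add[OF _ alg.scale[of b G "-1"], of a] by simp

lemma alg_commute_gens:
  assumes "a \<in> alg G" "\<And>g. g \<in> G \<Longrightarrow> g * c = c * g"
  shows "a * c = c * a"
  using assms(1)
proof induction
  case (mult a b)
  then show ?case by (metis mult.assoc)
qed (use assms(2) in \<open>simp_all add: algebra_simps\<close>)

lemma alg_commute:
  assumes "a \<in> alg G" "b \<in> alg G" "\<And>g h. g \<in> G \<Longrightarrow> h \<in> G \<Longrightarrow> g * h = h * g"
  shows "a * b = b * a"
  using assms(1)
proof (rule alg_commute_gens)
  fix g assume "g \<in> G"
  then show "g * b = b * g" using alg_commute_gens[OF assms(2), of g] assms(3) by simp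
qed

lemma alg_cmt:
  assumes "a \<in> alg G" "\<And>g. g \<in> G \<Longrightarrow> cmt d g \<in> alg G"
  shows "cmt d a \<in> alg G"
  using assms(1)
proof induction
  case one
  show ?case using alg.scale[OF alg.one, of 0 G] by simp
qed (use assms(2) in \<open>simp_all add: cmt_mult alg.intros\<close>)

section \<open>Integral vectors and the pairing\<close>

lemma pairing_simps [simp]:
  "pairing u 0 = 0" "pairing 0 r = 0" "pairing u (r + s) = pairing u r + pairing u s"
  "pairing u (r - s) = pairing u r - pairing u s" "pairing u (- r) = - pairing u r"
  "pairing (u + v) r = pairing u r + pairing v r" "pairing (u - v) r = pairing u r - pairing v r"
  "pairing (c *\<^sub>C u) r = c * pairing u r" "pairing (- u) r = - pairing u r"
  by (simp_all add: pairing_def cscale_complex_def algebra_simps sum.distrib sum_subtractf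
      sum_negf sum_distrib_left)

lemma pairing_axis [simp]: "pairing (axis i a) r = a * of_int (r $ i)"
proof -
  have "pairing (axis i a) r = (\<Sum>k\<in>UNIV. if k = i then a * of_int (r $ k) else 0)"
    unfolding pairing_def by (rule sum.cong) (auto simp: axis_def)
  then show ?thesis by simp
qed

lemma pairing_axis_right [simp]: "pairing u (axis i a) = u $ i * of_int a"
proof -
  have "pairing u (axis i a) = (\<Sum>k\<in>UNIV. if k = i then u $ k * of_int a else 0)"
    unfolding pairing_def by (rule sum.cong) (auto simp: axis_def)
  then show ?thesis by simp
qed

text \<open>Linear dependence of two vectors, as the vanishing of all \<open>2 \<times> 2\<close> minors.\<close>

definition parallel :: "int ^ 'n \<Rightarrow> int ^ 'n \<Rightarrow> bool"
  where "parallel p q \<longleftrightarrow> (\<forall>i j. p $ i * q $ j = p $ j * q $ i)"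

lemma parallel_sym: "parallel p q \<Longrightarrow> parallel q p"
  by (metis parallel_def mult.commute)

lemma parallel_trans:
  assumes "parallel p q" "parallel q r" "q \<noteq> 0"
  shows "parallel p r"
  unfolding parallel_def
proof (intro allI)
  fix i j
  obtain k where k: "q $ k \<noteq> 0" using assms(3) by (auto simp: vec_eq_iff)
  have p: "p $ l * q $ k = p $ k * q $ l" and r: "q $ k * r $ l = q $ l * r $ k" for l
    using assms by (auto simp: parallel_def)
  have "(q $ k * q $ k) * (p $ i * r $ j) = (p $ i * q $ k) * (q $ k * r $ j)" by simp
  also have "\<dots> = (p $ j * q $ k) * (q $ k * r $ i)" by (simp add: p r)
  finally show "p $ i * r $ j = p $ j * r $ i" using k by simp
qed

lemma parallel_zero [simp]: "parallel 0 q" "parallel q 0"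
  by (simp_all add: parallel_def)

text \<open>Cramer's rule for two coordinates with a nonzero minor.\<close>

lemma pairing_interpolate:
  fixes p q :: "int ^ 'n::finite"
  assumes "\<not> parallel p q"
  obtains u where "pairing u p = a" "pairing u q = b"
proof -
  obtain i j where ij: "p $ i * q $ j \<noteq> p $ j * q $ i"
    using assms by (auto simp: parallel_def)
  define \<delta> :: complex where "\<delta> = of_int (p $ i * q $ j - p $ j * q $ i)"
  have \<delta>: "\<delta> \<noteq> 0" using ij by (simp add: \<delta>_def del: of_int_diff of_int_mult)
  define u :: "complex ^ 'n" where "u =
    axis i ((a * of_int (q $ j) - b * of_int (p $ j)) / \<delta>)
    + axis j ((b * of_int (p $ i) - a * of_int (q $ i)) / \<delta>)"
  have "pairing u p = a * (\<delta> / \<delta>)" "pairing u q = b * (\<delta> / \<delta>)"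
    by (simp_all add: u_def field_simps \<delta>) (simp_all add: \<delta>_def algebra_simps)
  then show ?thesis using that \<delta> by simp
qed

lemma not_parallel_exists:
  fixes s :: "int ^ 'n::finite"
  assumes "2 \<le> CARD('n)" "s \<noteq> 0"
  obtains p where "\<not> parallel p s"
proof -
  obtain i where i: "s $ i \<noteq> 0" using assms(2) by (auto simp: vec_eq_iff)
  have "\<exists>j. j \<noteq> i"
  proof (rule ccontr)
    assume "\<nexists>j. j \<noteq> i"
    then have "UNIV = {i}" by auto
    then have "CARD('n) = 1" by (metis card.empty card.insert empty_iff finite.emptyI One_nat_def)
    then show False using assms(1) by simp
  qed
  then obtain j where "j \<noteq> i" by blast
  then have "\<not> parallel (axis j 1) s"
    using i by (auto simp: parallel_def axis_def intro!: exI[of _ j] exI[of _ i])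
  then show ?thesis using that by blast
qed

section \<open>Irreducible representations in terms of operators\<close>

text \<open>An exponent as a complex vector, by which operators of that degree shift weights.\<close>

definition cvec :: "int ^ 'n \<Rightarrow> complex ^ 'n"
  where "cvec r = (\<chi> i. of_int (r $ i))"

text \<open>
  The vectors of weight \<open>l\<close>, where \<open>l\<close> lists the eigenvalues of \<open>d\<^sub>1, \<dots>, d\<^sub>N\<close>;
  \<open>D u r b\<close> stands for the action of \<open>D(u, r) \<otimes> b\<close>.
\<close>

definition weight_vectors ::
    "(complex ^ 'n::finite \<Rightarrow> int ^ 'n \<Rightarrow> 'b::one \<Rightarrow> 'v::complex_space endo) \<Rightarrow> complex ^ 'n \<Rightarrow> 'v set"
  where "weight_vectors D l = {w. \<forall>u. app (D u 0 1) w = (\<Sum>i\<in>UNIV. u $ i * l $ i) *\<^sub>C w}"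

text \<open>
  An irreducible representation of \<open>(S\<^sub>N \<ltimes> A\<^sub>N) \<otimes> B\<close> with weight spaces of dimension at most \<open>M\<close>,
  on which some \<open>t\<^sup>s\<close>, \<open>s \<noteq> 0\<close>, acts nontrivially, given by the actions \<open>D u r b\<close> of \<open>D(u, r) \<otimes> b\<close>
  and \<open>X s b\<close> of \<open>t\<^sup>s \<otimes> b\<close>. If the pairing of \<open>u\<close> and \<open>r\<close> is not zero, \<open>D u r b\<close> is only required to be
  linear in \<open>b\<close>.
\<close>

locale bounded_irreducible_rep =
  fixes D :: "complex ^ 'n::finite \<Rightarrow> int ^ 'n \<Rightarrow> 'b::complex_comm_algebra \<Rightarrow> 'v::complex_space endo"
    and X :: "int ^ 'n \<Rightarrow> 'b \<Rightarrow> 'v endo"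
    and M :: nat
  assumes rank: "2 \<le> CARD('n)"
    and D_scale_vector: "pairing u r = 0 \<Longrightarrow> D (c *\<^sub>C u) r b = c *\<^sub>C D u r b"
    and D_add: "D u r (b + b') = D u r b + D u r b'"
    and D_scale: "D u r (c *\<^sub>C b) = c *\<^sub>C D u r b"
    and X_add: "X s (b + b') = X s b + X s b'"
    and X_scale: "X s (c *\<^sub>C b) = c *\<^sub>C X s b"
    and D_D: "pairing u r = 0 \<Longrightarrow> pairing v s = 0 \<Longrightarrow>
      cmt (D u r b) (D v s b') = D (pairing u s *\<^sub>C v - pairing v r *\<^sub>C u) (r + s) (b * b')"
    and D_X: "pairing u r = 0 \<Longrightarrow> cmt (D u r b) (X s b') = pairing u s *\<^sub>C X (r + s) (b * b')"
    and X_X: "X r b * X s b' = X s b' * X r b"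
    and irreducible: "cvs.subspace W \<Longrightarrow>
      (\<And>u r b w. pairing u r = 0 \<Longrightarrow> w \<in> W \<Longrightarrow> app (D u r b) w \<in> W) \<Longrightarrow>
      (\<And>s b w. w \<in> W \<Longrightarrow> app (X s b) w \<in> W) \<Longrightarrow> W = {0} \<or> W = UNIV"
    and nontrivial: "\<exists>w::'v. w \<noteq> 0"
    and weights_span: "cvs.span (\<Union>l. weight_vectors D l) = UNIV"
    and weights_bounded: "dim_at_most (weight_vectors D l) M"
    and X_nonzero: "\<exists>s. s \<noteq> 0 \<and> X s 1 \<noteq> 0"
begin

lemma submodule_UNIV:
  assumes "cvs.subspace W" "\<And>u r b w. pairing u r = 0 \<Longrightarrow> w \<in> W \<Longrightarrow> app (D u r b) w \<in> W"
    "\<And>s b w. w \<in> W \<Longrightarrow> app (X s b) w \<in> W" "w \<in> W" "w \<noteq> 0"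
  shows "x \<in> W"
  using irreducible[OF assms(1-3)] assms(4,5) by auto

lemma D_zero_vector [simp]: "D 0 r b = 0"
  using D_scale_vector[of 0 r 0 b] by simp

lemma D_diff: "D u r (b - b') = D u r b - D u r b'"
  using D_add[of u r "b - b'" b'] by simp

abbreviation wt :: "complex ^ 'n \<Rightarrow> 'v set"
  where "wt \<equiv> weight_vectors D"

lemma wt_subspace: "cvs.subspace (wt l)"
  by (auto simp: weight_vectors_def cvs.subspace_def cscale_add_right mult.commute)

lemma wt_fin_dim: "fin_dim (wt l)"
  using weights_bounded dim_at_most_fin_dim by blast

lemma wt_nonzero_exists:
  obtains \<mu> where "wt \<mu> \<noteq> {0}"
proof (rule ccontr)
  assume "\<not> thesis"
  then have "wt \<mu> = {0}" for \<mu> using that by blast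
  then have "cvs.span (\<Union>l. wt l) \<subseteq> {0}" by simp
  then show False using weights_span nontrivial by auto
qed

lemma eq_on_weights:
  assumes "\<And>l w. w \<in> wt l \<Longrightarrow> app a w = 0"
  shows "a = 0"
proof (rule endo_eqI)
  fix v
  have "app a v = 0"
    by (rule clinear_vanish_on_span[OF app_linear, of "\<Union>l. wt l"])
      (use assms weights_span in auto)
  then show "app a v = app 0 v" by simp
qed

text \<open>Operators that shift weights by \<open>r\<close>.\<close>

definition homog :: "int ^ 'n \<Rightarrow> 'v endo \<Rightarrow> bool"
  where "homog r a \<longleftrightarrow> (\<forall>u. cmt (D u 0 1) a = pairing u r *\<^sub>C a)"

lemma homog_shift:
  assumes "homog r a" "w \<in> wt l"
  shows "app a w \<in> wt (l + cvec r)"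
proof -
  have "app (D u 0 1) (app a w) = app a (app (D u 0 1) w) + app (cmt (D u 0 1) a) w" for u
    by (simp add: cmt_def)
  then show ?thesis
    using assms unfolding weight_vectors_def homog_def
    by (auto simp: cvec_def pairing_def cscale_add_left[symmetric] sum.distrib distrib_left)
qed

lemma cvec_zero [simp]: "cvec 0 = (0 :: complex ^ 'n)"
  by (simp add: cvec_def vec_eq_iff)

lemma cvec_add: "cvec (r + s) = cvec r + (cvec s :: complex ^ 'n)"
  by (simp add: cvec_def vec_eq_iff)

lemma homog_zero_stable: "homog 0 a \<Longrightarrow> w \<in> wt l \<Longrightarrow> app a w \<in> wt l"
  using homog_shift[of 0 a w l] by simp

lemma homog_X: "homog s (X s b)"
  by (simp add: homog_def D_X)

lemma homog_D: "pairing v s = 0 \<Longrightarrow> homog s (D v s b)"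
  by (simp add: homog_def D_D D_scale_vector)

lemma homog_mult: "homog r a \<Longrightarrow> homog s b \<Longrightarrow> homog (r + s) (a * b)"
  by (simp add: homog_def cmt_mult cscale_add_left)

lemma homog_cmt: "homog r a \<Longrightarrow> homog s b \<Longrightarrow> homog (r + s) (cmt a b)"
  unfolding homog_def
  by (simp only: cmt_jacobi) (simp add: cscale_add_left)

lemma homog_shift_scalar: "homog 0 a \<Longrightarrow> homog 0 (a - c *\<^sub>C 1)"
  by (simp add: homog_def)

text \<open>
  A variant of Schur's lemma: \<open>z\<close>, of weight zero, need not commute with the \<open>D u r b\<close>, but only with
  its commutators with them; then \<open>z\<close> is a scalar up to a nilpotent operator.
\<close>

lemma one_eigenvalue:
  assumes z: "homog 0 z"
    and D: "\<And>u r b. pairing u r = 0 \<Longrightarrow> cmt (D u r b) z * z = z * cmt (D u r b) z"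
    and X: "\<And>s b. X s b * z = z * X s b"
  obtains \<alpha> where "(z - \<alpha> *\<^sub>C 1) ^ M = 0"
proof -
  obtain \<mu> where "wt \<mu> \<noteq> {0}" by (rule wt_nonzero_exists)
  then obtain w \<alpha> where w: "w \<in> wt \<mu>" "w \<noteq> 0" "app z w = \<alpha> *\<^sub>C w"
    using eigenvector_exists[OF wt_subspace wt_fin_dim homog_zero_stable[OF z]] by blast
  define n where "n = z - \<alpha> *\<^sub>C 1"
  \<comment> \<open>The generalized eigenspace of \<open>\<alpha>\<close> is a submodule.\<close>
  define K where "K = {v. \<exists>k. app (n ^ k) v = 0}"
  have after: "app (n ^ (k + l)) v = 0" if "app (n ^ l) v = 0" for k l v
    using that by (simp add: power_add)
  have "cvs.subspace K"
  proof (rule cvs.subspaceI)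
    fix x y assume "x \<in> K" "y \<in> K"
    then obtain k l where "app (n ^ k) x = 0" "app (n ^ l) y = 0" by (auto simp: K_def)
    then have "app (n ^ (k + l)) (x + y) = 0"
      using after[of l y k] after[of k x l] by (simp add: add.commute)
    then show "x + y \<in> K" unfolding K_def by blast
  qed (auto simp: K_def)
  moreover have "app (D u r b) v \<in> K" if ur: "pairing u r = 0" and v: "v \<in> K" for u r b v
  proof -
    let ?d = "D u r b"
    obtain k where k: "app (n ^ k) v = 0" using v by (auto simp: K_def)
    have c: "n * cmt ?d n = cmt ?d n * n"
      using D[OF ur] by (simp add: n_def algebra_simps)
    have "n ^ k * cmt ?d n = cmt ?d n * n ^ k"
      by (rule power_commuting_commutes) (rule c)
    then have "app (n ^ k) (app (cmt ?d n) v) = 0"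
      using app_commute k by (metis app_simps(8))
    then have "app (cmt ?d (n ^ Suc k)) v = 0"
      by (simp only: cmt_power[OF c] app_simps(6,7)) simp
    then have "app (n ^ Suc k) (app ?d v) = 0"
      using app_cmt[of "n ^ Suc k" ?d v] after[OF k, of 1] by simp
    then show ?thesis unfolding K_def by blast
  qed
  moreover have "app (X s b) v \<in> K" if v: "v \<in> K" for s b v
  proof -
    obtain k where k: "app (n ^ k) v = 0" using v by (auto simp: K_def)
    have "n * X s b = X s b * n" using X by (simp add: n_def algebra_simps)
    then have "n ^ k * X s b = X s b * n ^ k" by (rule power_commuting_commutes)
    then have "app (n ^ k) (app (X s b) v) = 0"
      using app_commute k by (metis app_simps(8))
    then show ?thesis unfolding K_def by blast
  qed
  moreover have "w \<in> K" using w(3) by (auto simp: K_def n_def intro!: exI[of _ 1])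
  ultimately have K: "v \<in> K" for v using submodule_UNIV w(2) by blast
  have "n ^ M = 0"
  proof (rule eq_on_weights)
    fix l v assume v: "v \<in> wt l"
    obtain k where "app (n ^ k) v = 0" using K[of v] by (auto simp: K_def)
    then show "app (n ^ M) v = 0"
      using nilpotency_index[OF weights_bounded _ v] homog_zero_stable homog_shift_scalar[OF z]
      unfolding n_def by blast
  qed
  then show ?thesis using that unfolding n_def by blast
qed

lemma schur:
  assumes D: "\<And>u r b. pairing u r = 0 \<Longrightarrow> cmt (D u r b) z = 0"
    and X: "\<And>s b. X s b * z = z * X s b"
  obtains \<alpha> where "z = \<alpha> *\<^sub>C 1"
proof -
  have "homog 0 z" using D by (simp add: homog_def)
  then obtain \<alpha> where \<alpha>: "(z - \<alpha> *\<^sub>C 1) ^ M = 0"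
    using one_eigenvalue[of z] D X by force
  have "\<exists>w. w \<noteq> 0 \<and> app z w = \<alpha> *\<^sub>C w"
  proof (rule ccontr)
    assume "\<nexists>w. w \<noteq> 0 \<and> app z w = \<alpha> *\<^sub>C w"
    then have inj: "app (z - \<alpha> *\<^sub>C 1) w = 0 \<Longrightarrow> w = 0" for w by auto
    have "app ((z - \<alpha> *\<^sub>C 1) ^ k) w = 0 \<Longrightarrow> w = 0" for k w
      by (induction k) (simp_all add: inj del: app_simps(4))
    then show False using \<alpha> nontrivial by (metis app_simps(1))
  qed
  then obtain w where w: "w \<noteq> 0" "app z w = \<alpha> *\<^sub>C w" by blast
  have "v \<in> {v. app z v = \<alpha> *\<^sub>C v}" for v
  proof (rule submodule_UNIV[OF _ _ _ _ w(1)])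
    show "cvs.subspace {v. app z v = \<alpha> *\<^sub>C v}"
      by (auto simp: cvs.subspace_def cscale_add_right mult.commute)
    show "app (D u r b) w \<in> {v. app z v = \<alpha> *\<^sub>C v}"
      if "pairing u r = 0" "w \<in> {v. app z v = \<alpha> *\<^sub>C v}" for u r b w
      using that D[OF that(1), of b] by (simp add: app_cmt[of z "D u r b"])
    show "app (X s b) w \<in> {v. app z v = \<alpha> *\<^sub>C v}" if "w \<in> {v. app z v = \<alpha> *\<^sub>C v}" for s b w
      using that app_commute[OF X, of s b w] by simp
  qed (use w in auto)
  then have "z = \<alpha> *\<^sub>C 1" by (intro endo_eqI) simp
  then show ?thesis by (rule that)
qed

text \<open>The commutative algebra of polynomials in the operators \<open>X s b\<close>.\<close>

definition XA :: "'v endo set"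
  where "XA = alg {X s b | s b. True}"

lemma X_in_XA: "X s b \<in> XA"
  unfolding XA_def by (rule alg.gen) blast

lemmas XA_intros = X_in_XA alg.mult[of _ "{X s b | s b. True}", folded XA_def]
  alg.scale[of _ "{X s b | s b. True}", folded XA_def]
  alg.one[of "{X s b | s b. True}", folded XA_def] alg_diff[of _ "{X s b | s b. True}", folded XA_def]
  alg.add[of _ "{X s b | s b. True}", folded XA_def]

lemma XA_commute: "a \<in> XA \<Longrightarrow> b \<in> XA \<Longrightarrow> a * b = b * a"
  unfolding XA_def by (rule alg_commute) (auto simp: X_X)

lemma XA_cmt: "pairing u r = 0 \<Longrightarrow> a \<in> XA \<Longrightarrow> cmt (D u r b) a \<in> XA"
  unfolding XA_def
proof (erule alg_cmt)
  fix g assume "pairing u r = 0" "g \<in> {X s b | s b. True}"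
  then show "cmt (D u r b) g \<in> alg {X s b | s b. True}"
    using alg.scale[OF X_in_XA[unfolded XA_def]] by (auto simp only: D_X mem_Collect_eq)
qed

lemma nilp_XA_derivative:
  assumes "pairing u r = 0" "a \<in> XA" "nilp a"
  shows "nilp (cmt (D u r b) a)"
  by (rule nilp_derivative[of XA]) (use assms XA_commute XA_cmt in auto)

lemma one_eigenvalue_XA:
  assumes "z \<in> XA" "homog 0 z"
  obtains \<alpha> where "(z - \<alpha> *\<^sub>C 1) ^ M = 0"
  using one_eigenvalue[of z] XA_commute XA_cmt assms X_in_XA by metis

text \<open>
  For linearly independent \<open>s\<close> and \<open>t\<close>, a vector field of degree \<open>t - s\<close> moves the monomial with
  exponent \<open>s\<close> to the one with exponent \<open>t\<close>.
\<close>

lemma X_step: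
  assumes "\<not> parallel t s"
  obtains u where "pairing u (t - s) = 0" "pairing u t = 1" "pairing u s = 1"
    "\<And>b c. cmt (D u (t - s) b) (X s c) = X t (b * c)"
proof -
  obtain u where "pairing u t = 1" "pairing u s = 1"
    using assms by (rule pairing_interpolate)
  then show ?thesis using that[of u] by (simp add: D_X)
qed

lemma X_one_nonzero:
  assumes "s \<noteq> 0"
  shows "X s 1 \<noteq> 0"
proof
  assume s: "X s 1 = 0"
  have step: "X q 1 = 0" if 0: "X p 1 = 0" and np: "\<not> parallel q p" for p q
  proof -
    obtain u where u: "\<And>b c. cmt (D u (q - p) b) (X p c) = X q (b * c)"
      using X_step[OF np] by metis
    show ?thesis using u[of 1 1] 0 by simp
  qed
  obtain t where t: "t \<noteq> 0" "X t 1 \<noteq> 0" using X_nonzero by blast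
  obtain p where p: "\<not> parallel p s" using not_parallel_exists[OF rank assms] .
  then have "X p 1 = 0" using step s by blast
  then show False
    using step s t p parallel_trans[of p t s] parallel_sym by blast
qed

text \<open>
  If \<open>t\<^sup>s t\<^sup>-\<^sup>s\<close> were nilpotent, derivations would show first that \<open>t\<^sup>s\<close> is nilpotent, and then
  that products of sufficiently many elements \<open>t\<^sup>q \<otimes> b\<close>, \<open>q \<noteq> 0\<close>, vanish. The vectors killed by
  all \<open>t\<^sup>q \<otimes> b\<close>, \<open>q \<noteq> 0\<close>, would therefore form a nonzero submodule.
\<close>

lemma X_power_nilp:
  assumes s: "\<not> parallel p s" and z: "nilp (X s 1 * X (- s) 1)"
  shows "nilp (X s 1)"
proof -
  have X: "X r 1 \<in> XA" "a \<in> XA \<Longrightarrow> b \<in> XA \<Longrightarrow> a * b \<in> XA" for r a b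
    by (rule XA_intros, rule XA_intros)
  have comm: "X r 1 * X r' 1 = X r' 1 * X r 1" "X r 1 * (X r' 1 * y) = X r' 1 * (X r 1 * y)"
    for r r' y
    by (rule X_X) (simp add: mult.assoc[symmetric] X_X)
  have nm: "nilp (a * b)" "nilp (b * a)" if "nilp a" "a \<in> XA" "b \<in> XA" for a b
    using nilp_mult[of a b] XA_commute[of a b] that by auto
  have nd: "nilp (b - a)" if "nilp a" "nilp b" "a \<in> XA" "b \<in> XA" for a b
    using nilp_diff[of b a] XA_commute[of a b] that by auto
  \<comment> \<open>Deriving \<open>x\<^sub>s x\<^sub>-\<^sub>s\<close> and multiplying by \<open>x\<^sub>s x\<^sub>p\<close> shows that \<open>(x\<^sub>s x\<^sub>p)\<^sup>2\<close> is nilpotent.\<close>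
  have sp: "nilp (X s 1 * X p 1)"
  proof -
    obtain u where u: "pairing u p = -1" "pairing u s = 1"
      using pairing_interpolate[OF s] by metis
    have "nilp (cmt (D u (p + s) 1) (X s 1 * X (- s) 1))"
      by (rule nilp_XA_derivative) (use u z X in auto)
    also have "cmt (D u (p + s) 1) (X s 1 * X (- s) 1) =
        X (p + s + s) 1 * X (- s) 1 - X s 1 * X p 1"
      using u by (simp add: cmt_mult D_X)
    finally have "nilp ((X (p + s + s) 1 * X (- s) 1 - X s 1 * X p 1) * (X s 1 * X p 1))"
      by (rule nm) (intro XA_intros)+
    moreover have "nilp (X s 1 * X (- s) 1 * (X (p + s + s) 1 * X p 1))"
      using z by (rule nm) (intro XA_intros)+
    ultimately have "nilp (X s 1 * X (- s) 1 * (X (p + s + s) 1 * X p 1)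
        - (X (p + s + s) 1 * X (- s) 1 - X s 1 * X p 1) * (X s 1 * X p 1))"
      by (rule nd) (intro XA_intros)+
    also have "X s 1 * X (- s) 1 * (X (p + s + s) 1 * X p 1)
        - (X (p + s + s) 1 * X (- s) 1 - X s 1 * X p 1) * (X s 1 * X p 1) = (X s 1 * X p 1) ^ 2"
      by (simp add: algebra_simps power2_eq_square comm)
    finally show ?thesis by (rule nilp_of_power)
  qed
  \<comment> \<open>Deriving \<open>x\<^sub>s x\<^sub>p\<close> and multiplying by \<open>x\<^sub>s\<close> shows that \<open>x\<^sub>s\<^sup>3\<close> is nilpotent.\<close>
  obtain u where u: "pairing u p = 1" "pairing u s = 1"
    using pairing_interpolate[OF s] by metis
  have "nilp (cmt (D u (s - p) 1) (X s 1 * X p 1))"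
    by (rule nilp_XA_derivative) (use u sp X in auto)
  also have "cmt (D u (s - p) 1) (X s 1 * X p 1) = X (s - p + s) 1 * X p 1 + X s 1 * X s 1"
    using u by (simp add: cmt_mult D_X)
  finally have n1: "nilp ((X (s - p + s) 1 * X p 1 + X s 1 * X s 1) * X s 1)"
    by (rule nm) (intro XA_intros)+
  have n2: "nilp (X s 1 * X p 1 * X (s - p + s) 1)"
    using sp by (rule nm) (intro XA_intros)+
  have "nilp ((X (s - p + s) 1 * X p 1 + X s 1 * X s 1) * X s 1
      - X s 1 * X p 1 * X (s - p + s) 1)"
    by (rule nd[OF n2 n1]) (intro XA_intros)+
  also have "(X (s - p + s) 1 * X p 1 + X s 1 * X s 1) * X s 1
      - X s 1 * X p 1 * X (s - p + s) 1 = X s 1 ^ 3"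
    by (simp add: algebra_simps power3_eq_cube comm)
  finally show ?thesis by (rule nilp_of_power)
qed

text \<open>If \<open>q\<close> and \<open>s\<close> are linearly independent, then \<open>X q b\<close> is a derivative of \<open>X s 1\<close>.\<close>

lemma X_products_vanish:
  assumes "X s 1 ^ k = 0" "length xs = 2 * k"
    "\<And>x. x \<in> set xs \<Longrightarrow> \<exists>q b. x = X q b \<and> \<not> parallel q s"
  shows "prod_list xs = 0"
proof (rule derivatives_of_nilpotent[of XA "{D u r b | u r b. pairing u r = 0}" "X s 1" k])
  show "set xs \<subseteq> (\<lambda>d. cmt d (X s 1)) ` {D u r b |u r b. pairing u r = 0}"
  proof
    fix x assume "x \<in> set xs"
    then obtain q b where q: "x = X q b" "\<not> parallel q s" using assms(3) by blast
    obtain u where u: "pairing u (q - s) = 0" "\<And>b c. cmt (D u (q - s) b) (X s c) = X q (b * c)"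
      using X_step[OF q(2)] by metis
    then have "x = cmt (D u (q - s) b) (X s 1)" by (simp add: q)
    then show "x \<in> (\<lambda>d. cmt d (X s 1)) ` {D u r b |u r b. pairing u r = 0}" using u(1) by blast
  qed
qed (use assms XA_commute XA_cmt X_in_XA in auto)

lemma X_product_not_nilp:
  assumes s0: "s \<noteq> 0"
  shows "\<not> nilp (X s 1 * X (- s) 1)"
proof
  assume z: "nilp (X s 1 * X (- s) 1)"
  obtain p where p: "\<not> parallel p s" using not_parallel_exists[OF rank s0] .
  have ns: "nilp (X s 1)" using X_power_nilp[OF p z] .
  obtain u where u: "pairing u (p - s) = 0" "\<And>b c. cmt (D u (p - s) b) (X s c) = X p (b * c)"
    using X_step[OF p] by metis
  have np: "nilp (X p 1)"
    using nilp_XA_derivative[OF u(1) X_in_XA ns, of 1] by (simp add: u(2))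
  obtain k l where kl: "X s 1 ^ k = 0" "X p 1 ^ l = 0" using ns np by (auto simp: nilp_def)
  define G where "G = {X q b | q b. q \<noteq> 0}"
  have GX: "G \<subseteq> XA" using X_in_XA by (auto simp: G_def)
  have "prod_list xs = 0" if xs: "set xs \<subseteq> G" "length xs = 2 * k + 2 * l" for xs
  proof -
    \<comment> \<open>Every \<open>q \<noteq> 0\<close> is linearly independent of \<open>s\<close> or of \<open>p\<close>.\<close>
    define P where "P x \<longleftrightarrow> (\<exists>q b. x = X q b \<and> \<not> parallel q s)" for x
    have nP: "\<exists>q b. x = X q b \<and> \<not> parallel q p" if "x \<in> G" "\<not> P x" for x
      using that p parallel_trans[of p _ s] parallel_sym unfolding G_def P_def by blast
    have split: "prod_list ys = prod_list (filter P ys) * prod_list (filter (Not \<circ> P) ys)"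
      if "set ys \<subseteq> G" for ys
      using that
    proof (induction ys)
      case (Cons y ys)
      have "y * prod_list (filter P ys) = prod_list (filter P ys) * y"
        by (rule commute_prod_list, rule XA_commute) (use Cons.prems GX in auto)
      then show ?case using Cons by (simp add: mult.assoc[symmetric])
    qed simp
    have len: "length (filter P xs) + length (filter (Not \<circ> P) xs) = 2 * k + 2 * l"
      using sum_length_filter_compl[of P xs] xs(2) by (simp add: comp_def)
    have cut: "prod_list ys = 0" if "prod_list (take m ys) = 0" for m and ys :: "'v endo list"
      using that by (metis append_take_drop_id mult_zero_left prod_list.append)
    show ?thesis
    proof (cases "2 * k \<le> length (filter P xs)")
      case True
      have "prod_list (filter P xs) = 0"
        by (rule cut[of "2 * k"], rule X_products_vanish[OF kl(1)])
          (use True in \<open>auto dest!: in_set_takeD simp: P_def\<close>)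
      then show ?thesis using split[OF xs(1)] by simp
    next
      case False
      then have "2 * l \<le> length (filter (Not \<circ> P) xs)" using len by linarith
      have "prod_list (filter (Not \<circ> P) xs) = 0"
        by (rule cut[of "2 * l"], rule X_products_vanish[OF kl(2)])
          (use \<open>2 * l \<le> _\<close> xs(1) nP in \<open>auto dest!: in_set_takeD\<close>)
      then show ?thesis using split[OF xs(1)] by simp
    qed
  qed
  note L = this
  define Q where "Q m \<longleftrightarrow> (\<exists>xs. set xs \<subseteq> G \<and> length xs = m \<and> prod_list xs \<noteq> 0)" for m
  have "Q 0"
    using nontrivial by (auto simp: Q_def) (metis app_simps(1) app_simps(2))
  have "\<exists>m. Q m \<and> \<not> Q (Suc m)"
  proof (rule ccontr)
    assume "\<nexists>m. Q m \<and> \<not> Q (Suc m)"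
    then have "Q m" for m by (induction m) (use \<open>Q 0\<close> in auto)
    then show False using L by (auto simp: Q_def)
  qed
  then obtain m where "Q m" "\<not> Q (Suc m)" by blast
  then obtain xs where xs: "set xs \<subseteq> G" "length xs = m" "prod_list xs \<noteq> 0"
    by (auto simp: Q_def)
  obtain v where v: "app (prod_list xs) v \<noteq> 0"
    using xs(3) endo_eqI[of "prod_list xs" 0] by auto
  define K where "K = {w. \<forall>q b. q \<noteq> 0 \<longrightarrow> app (X q b) w = 0}"
  have "app (X q b) (app (prod_list xs) v) = 0" if "q \<noteq> 0" for q b
  proof -
    have "prod_list (X q b # xs) = 0"
      using \<open>\<not> Q (Suc m)\<close> xs that unfolding Q_def G_def
      by (metis (mono_tags, lifting) insert_subset length_Cons list.simps(15) mem_Collect_eq)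
    then show ?thesis by (metis app_simps(1,6) prod_list.Cons)
  qed
  then have vK: "app (prod_list xs) v \<in> K" by (simp add: K_def)
  have "w \<in> K" for w
  proof (rule submodule_UNIV[OF _ _ _ vK v])
    show "cvs.subspace K" by (auto simp: cvs.subspace_def K_def)
    show "app (X r c) w \<in> K" if "w \<in> K" for r c w
    proof -
      have "app (X q b) (app (X r c) w) = 0" if "q \<noteq> 0" for q b
        using app_commute[OF X_X[of q b r c], of w] that \<open>w \<in> K\<close> by (simp add: K_def)
      then show ?thesis by (simp add: K_def)
    qed
    show "app (D u r c) w \<in> K" if ur: "pairing u r = 0" and "w \<in> K" for u r c w
    proof -
      have "app (X q b) (app (D u r c) w) = 0" if "q \<noteq> 0" for q b
      proof (cases "r + q = 0")
        case True
        then have "pairing u q = 0" using ur by (metis add_0 pairing_simps(1,3))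
        then show ?thesis
          using app_cmt[of "X q b" "D u r c" w] \<open>w \<in> K\<close> that by (simp add: D_X[OF ur] K_def)
      next
        case False
        then show ?thesis
          using app_cmt[of "X q b" "D u r c" w] \<open>w \<in> K\<close> that by (simp add: D_X[OF ur] K_def)
      qed
      then show ?thesis by (simp add: K_def)
    qed
  qed
  then have "X s 1 = 0" using s0 by (intro endo_eqI) (simp add: K_def)
  then show False using X_one_nonzero s0 by blast
qed

lemma X_injective:
  assumes s: "s \<noteq> 0" and w: "app (X s 1) w = 0"
  shows "w = 0"
proof -
  let ?z = "X s 1 * X (- s) 1"
  have "homog 0 ?z" using homog_mult[OF homog_X[of s 1] homog_X[of "- s" 1]] by simp
  then obtain \<alpha> where \<alpha>: "(?z - \<alpha> *\<^sub>C 1) ^ M = 0"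
    using one_eigenvalue_XA[of ?z] XA_intros(1,2) by metis
  have "\<alpha> \<noteq> 0" using \<alpha> X_product_not_nilp[OF s] by (auto simp: nilp_def)
  have "app ?z w = 0" using w app_commute[OF X_X[of s 1 "- s" 1]] by simp
  then have "app (?z - \<alpha> *\<^sub>C 1) w = (- \<alpha>) *\<^sub>C w" by simp
  then show "w = 0"
    using nilp_eigenvalue[of "?z - \<alpha> *\<^sub>C 1" w "- \<alpha>"] \<alpha> \<open>\<alpha> \<noteq> 0\<close> by (auto simp: nilp_def)
qed

lemma X_mult_cancel:
  assumes "s \<noteq> 0" "X s 1 * a = 0"
  shows "a = 0"
proof (rule endo_eqI)
  fix w
  have "app (X s 1) (app a w) = 0" using assms(2) by (metis app_simps(1,6))
  then show "app a w = app 0 w" using X_injective[OF assms(1)] by simp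
qed

text \<open>
  The commuting nilpotent operators of weight zero have a common kernel vector in a weight space,
  and it is killed by the homogeneous nilpotent elements of other weights, because \<open>t\<^sup>-\<^sup>r\<close> is
  injective. Hence the common kernel of all homogeneous nilpotent elements is a nonzero submodule.
\<close>

lemma nilp_XA_zero:
  assumes a: "a \<in> XA" "nilp a" "homog r a"
  shows "a = 0"
proof -
  define N where "N = {a \<in> XA. nilp a \<and> (\<exists>r. homog r a)}"
  define K where "K = {w. \<forall>a\<in>N. app a w = 0}"
  obtain \<mu> where \<mu>: "wt \<mu> \<noteq> {0}" by (rule wt_nonzero_exists)
  let ?T = "{a \<in> XA. nilp a \<and> homog 0 a}"
  have "\<exists>w\<in>wt \<mu>. w \<noteq> 0 \<and> (\<forall>a\<in>?T. \<exists>\<alpha>. app a w = \<alpha> *\<^sub>C w)"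
    by (rule common_eigenvector[OF wt_subspace wt_fin_dim \<mu>])
      (simp add: homog_zero_stable, rule XA_commute, simp_all)
  then obtain w where w: "w \<noteq> 0" "\<forall>a\<in>?T. \<exists>\<alpha>. app a w = \<alpha> *\<^sub>C w" by blast
  have T: "app a w = 0" if a: "a \<in> ?T" for a
  proof -
    obtain \<alpha> where \<alpha>: "app a w = \<alpha> *\<^sub>C w" using w(2) a by blast
    then have "\<alpha> = 0" using nilp_eigenvalue[OF _ \<alpha> w(1)] a by blast
    then show ?thesis using \<alpha> by simp
  qed
  have "app a w = 0" if "a \<in> N" for a
  proof -
    obtain r where r: "a \<in> XA" "nilp a" "homog r a" using \<open>a \<in> N\<close> by (auto simp: N_def)
    show ?thesis
    proof (cases "r = 0")
      case True
      then show ?thesis using T r by auto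
    next
      case False
      have "homog 0 (a * X (- r) 1)" using homog_mult[OF r(3) homog_X[of "- r" 1]] by simp
      moreover have c: "a * X (- r) 1 = X (- r) 1 * a" using XA_commute r(1) X_in_XA by blast
      ultimately have "a * X (- r) 1 \<in> ?T"
        using nilp_mult[OF c r(2)] XA_intros(2)[OF r(1) X_in_XA] by blast
      then have "app (a * X (- r) 1) w = 0" by (rule T)
      then have "app (X (- r) 1) (app a w) = 0" unfolding c by simp
      then show ?thesis using X_injective[of "- r"] False by simp
    qed
  qed
  then have wK: "w \<in> K" by (simp add: K_def)
  have "v \<in> K" for v
  proof (rule submodule_UNIV[OF _ _ _ wK w(1)])
    show "cvs.subspace K" by (auto simp: cvs.subspace_def K_def)
    show "app (X s b) w \<in> K" if "w \<in> K" for s b w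
      using that app_commute[OF XA_commute[OF _ X_in_XA], of _ s b w] by (simp add: K_def N_def)
    show "app (D u r b) w \<in> K" if ur: "pairing u r = 0" and w: "w \<in> K" for u r b w
    proof -
      have "cmt (D u r b) a \<in> N" if "a \<in> N" for a
        using that XA_cmt[OF ur] nilp_XA_derivative[OF ur] homog_cmt[OF homog_D[OF ur]]
        unfolding N_def by blast
      then show ?thesis using w by (simp add: K_def app_cmt[of _ "D u r b"])
    qed
  qed
  then have "app a v = 0" for v using a by (auto simp: K_def N_def)
  then show ?thesis by (intro endo_eqI) simp
qed

section \<open>Evaluation at a character of the coefficient algebra\<close>

lemma X_proportional:
  assumes s: "s \<noteq> 0"
  shows "\<exists>c. X s b = c *\<^sub>C X s 1"
proof -
  have scalar: "\<exists>\<alpha>. X s b * X (- s) 1 = \<alpha> *\<^sub>C 1" for b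
  proof -
    let ?z = "X s b * X (- s) 1"
    have z: "?z \<in> XA" "homog 0 ?z"
      using homog_mult[OF homog_X[of s b] homog_X[of "- s" 1]] XA_intros(2)[OF X_in_XA X_in_XA] by simp_all
    then obtain \<alpha> where \<alpha>: "(?z - \<alpha> *\<^sub>C 1) ^ M = 0" by (rule one_eigenvalue_XA)
    have "?z - \<alpha> *\<^sub>C 1 = 0"
      by (rule nilp_XA_zero[where r = 0])
        (use \<alpha> z in \<open>auto simp: nilp_def homog_shift_scalar intro!: XA_intros\<close>)
    then show ?thesis by auto
  qed
  obtain \<alpha> \<beta> where \<alpha>: "X s b * X (- s) 1 = \<alpha> *\<^sub>C 1" and \<beta>: "X s 1 * X (- s) 1 = \<beta> *\<^sub>C 1"
    using scalar by blast
  have "\<beta> \<noteq> 0"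
    using X_product_not_nilp[OF s] \<beta> unfolding nilp_def
    by (metis cvs.scale_zero_left power_one_right)
  have "X (- s) 1 * (X s b - (\<alpha> / \<beta>) *\<^sub>C X s 1) = 0"
    using \<alpha> \<beta> \<open>\<beta> \<noteq> 0\<close> by (simp add: right_diff_distrib X_X[of "- s"])
  then have "X s b - (\<alpha> / \<beta>) *\<^sub>C X s 1 = 0" using X_mult_cancel[of "- s"] s by (metis neg_equal_0_iff_equal)
  then show ?thesis by auto
qed

text \<open>The character \<open>\<psi>\<close> of \<open>B\<close> with \<open>t\<^sup>s \<otimes> b = \<psi> b t\<^sup>s\<close> for all \<open>s \<noteq> 0\<close>.\<close>

definition \<psi> :: "'b \<Rightarrow> complex"
  where "\<psi> b = (SOME c. \<forall>s. s \<noteq> 0 \<longrightarrow> X s b = c *\<^sub>C X s 1)"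

lemma X_eval:
  assumes "s \<noteq> 0"
  shows "X s b = \<psi> b *\<^sub>C X s 1"
proof -
  have step: "X t b = c *\<^sub>C X t 1" if c: "X s b = c *\<^sub>C X s 1" and np: "\<not> parallel t s" for s t c
  proof -
    obtain u where u: "\<And>b c. cmt (D u (t - s) b) (X s c) = X t (b * c)"
      using X_step[OF np] by metis
    show ?thesis using u[of 1 b] u[of 1 1] c by simp
  qed
  obtain c where c: "X s b = c *\<^sub>C X s 1" using X_proportional[OF assms] by blast
  obtain p where p: "\<not> parallel p s" using not_parallel_exists[OF rank assms] .
  have "X t b = c *\<^sub>C X t 1" if "t \<noteq> 0" for t
    using step[OF c, of t] step[OF step[OF c p], of t] parallel_trans[of p t s] parallel_sym p that
    by blast
  then have "\<exists>c. \<forall>s. s \<noteq> 0 \<longrightarrow> X s b = c *\<^sub>C X s 1" by blast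
  then have "\<forall>s. s \<noteq> 0 \<longrightarrow> X s b = \<psi> b *\<^sub>C X s 1" unfolding \<psi>_def by (rule someI_ex)
  then show ?thesis using assms by blast
qed

lemma psi_eqI:
  assumes "s \<noteq> 0" "X s b = c *\<^sub>C X s 1"
  shows "\<psi> b = c"
  using X_eval[OF assms(1), of b] assms X_one_nonzero[OF assms(1)]
  by (metis cvs.scale_cancel_right)

lemma nonzero_exponent: obtains s :: "int ^ 'n" where "s \<noteq> 0"
  using X_nonzero by blast

lemma psi_one [simp]: "\<psi> 1 = 1"
  by (rule nonzero_exponent, rule psi_eqI) simp_all

lemma psi_add: "\<psi> (b + c) = \<psi> b + \<psi> c"
  by (rule nonzero_exponent, rule psi_eqI, assumption)
    (simp add: X_add cscale_add_left X_eval[of _ b] X_eval[of _ c])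

lemma psi_scale: "\<psi> (k *\<^sub>C b) = k * \<psi> b"
  by (rule nonzero_exponent, rule psi_eqI, assumption) (simp add: X_scale X_eval[of _ b])

lemma psi_diff: "\<psi> (b - c) = \<psi> b - \<psi> c"
  using psi_add[of "b - c" c] by simp

lemma psi_mult: "\<psi> (b * c) = \<psi> b * \<psi> c"
proof -
  obtain s :: "int ^ 'n" where s: "s \<noteq> 0" by (rule nonzero_exponent)
  obtain t where t: "\<not> parallel t s" using not_parallel_exists[OF rank s] .
  then have t0: "t \<noteq> 0" by auto
  obtain u where u: "\<And>b c. cmt (D u (t - s) b) (X s c) = X t (b * c)"
    using X_step[OF t] by metis
  have "X t (b * c) = \<psi> c *\<^sub>C X t b"
    using u[of b c] u[of b 1] X_eval[OF s, of c] by simp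
  then show ?thesis
    using X_eval[OF t0, of b] by (intro psi_eqI[OF t0]) (simp add: mult.commute)
qed

lemma psi_split: obtains b' where "b = \<psi> b *\<^sub>C 1 + b'" "\<psi> b' = 0"
proof (rule that)
  show "b = \<psi> b *\<^sub>C 1 + (b - \<psi> b *\<^sub>C 1)" by simp
qed (simp add: psi_diff psi_scale)

section \<open>The vector fields with coefficients in the kernel of the character\<close>

lemma D_X_commute:
  assumes "\<psi> b = 0" "pairing u r = 0"
  shows "D u r b * X s c = X s c * D u r b"
proof -
  have "pairing u s *\<^sub>C X (r + s) (b * c) = 0"
  proof (cases "r + s = 0")
    case True
    then have "pairing u s = 0" using assms(2) by (metis add_0 pairing_simps(1,3))
    then show ?thesis by simp
  next
    case False
    then show ?thesis using X_eval[of "r + s" "b * c"] by (simp add: psi_mult assms(1))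
  qed
  then show ?thesis by (simp only: D_X[OF assms(2)] cmt_eq_0_iff[symmetric])
qed

text \<open>The translates by \<open>\<int>\<^sup>N\<close> of one nonzero weight space span a submodule, hence everything.\<close>

lemma vanish_on_weight:
  assumes \<mu>: "wt \<mu> \<noteq> {0}" and a: "\<And>w. w \<in> wt \<mu> \<Longrightarrow> app a w = 0"
    and X: "\<And>s. a * X s 1 = X s 1 * a"
  shows "a = 0"
proof -
  define U where "U = (\<Union>r. wt (\<mu> + cvec r))"
  have stable: "app g w \<in> cvs.span U" if g: "homog s g" and w: "w \<in> cvs.span U" for g s w
    using w
  proof (induction rule: cvs.span_induct_alt)
    case base
    show ?case by (simp add: cvs.span_zero)
  next
    case (step c x y)
    then obtain r where "x \<in> wt (\<mu> + cvec r)" by (auto simp: U_def)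
    then have "app g x \<in> wt (\<mu> + cvec (r + s))"
      using homog_shift[OF g, of x "\<mu> + cvec r"] by (simp add: cvec_add add.assoc)
    then have "app g x \<in> cvs.span U" unfolding U_def by (intro cvs.span_base) blast
    then show ?case using step by (simp add: cvs.span_add cvs.span_scale)
  qed
  obtain w where w: "w \<in> wt \<mu>" "w \<noteq> 0" using \<mu> wt_subspace cvs.subspace_0 by blast
  have wU: "w \<in> cvs.span U"
    by (rule cvs.span_base) (use w in \<open>auto simp: U_def intro!: exI[of _ 0]\<close>)
  have span: "v \<in> cvs.span U" for v
    by (rule submodule_UNIV[OF _ _ _ wU w(2)])
      (auto intro: stable[OF homog_X] stable[OF homog_D])
  have "app a v = 0" if "v \<in> U" for v
  proof -
    obtain r where r: "v \<in> wt (\<mu> + cvec r)" using \<open>v \<in> U\<close> by (auto simp: U_def)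
    show ?thesis
    proof (cases "r = 0")
      case True
      then show ?thesis using r a by simp
    next
      case False
      have "app (X (- r) 1) v \<in> wt (\<mu> + cvec r + cvec (- r))"
        using homog_shift[OF homog_X r] .
      then have "app (X (- r) 1) v \<in> wt \<mu>"
        by (simp add: add.assoc cvec_add[symmetric])
      then have "app (X (- r) 1) (app a v) = 0"
        using a app_commute[OF X, of "- r" v] by simp
      then show ?thesis using X_injective[of "- r"] False by simp
    qed
  qed
  then have "app a v = 0" for v using clinear_vanish_on_span[OF app_linear] span by blast
  then show ?thesis by (intro endo_eqI) simp
qed

text \<open>
  The adjoint action moves a nonzero \<open>D(v, s) \<otimes> c\<close> to every \<open>D(y, q) \<otimes> c\<close> with \<open>q \<noteq> 0\<close>.
\<close>

lemma D_vanish: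
  assumes vs: "pairing v s = 0" "v \<noteq> 0" "D v s c = 0" and q: "q \<noteq> 0" "pairing y q = 0"
  shows "D y q c = 0"
proof -
  have one: "D y q c = 0"
    if vs: "pairing v s = 0" "D v s c = 0" and q: "pairing v q \<noteq> 0" "pairing y q = 0" for v s y q
  proof -
    let ?\<beta> = "pairing v q"
    \<comment> \<open>The vector \<open>w\<close> solves \<open>(w, s) v - (v, r) w = y\<close> for \<open>r = q - s\<close>.\<close>
    define w where "w = (pairing y (q - s) / ?\<beta>^2) *\<^sub>C v - (1 / ?\<beta>) *\<^sub>C y"
    have w: "pairing w (q - s) = 0"
      using vs q by (simp add: w_def power2_eq_square field_simps)
    have "pairing w s *\<^sub>C v - pairing v (q - s) *\<^sub>C w = y"
      using vs(1) q by (simp add: w_def vec_eq_iff cscale_complex_def power2_eq_square field_simps)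
    then have "cmt (D w (q - s) 1) (D v s c) = D y q c"
      using D_D[OF w vs(1), of 1 c] by simp
    then show ?thesis by (simp add: vs(2))
  qed
  show ?thesis
  proof (cases "pairing v q = 0")
    case False
    then show ?thesis using one vs(1,3) q(2) by blast
  next
    case True
    obtain i where i: "v $ i \<noteq> 0" using vs(2) by (auto simp: vec_eq_iff)
    have np: "\<not> parallel q (axis i 1)"
    proof
      assume "parallel q (axis i 1)"
      then have e: "q $ j * axis i 1 $ i = q $ i * axis i 1 $ j" for j
        unfolding parallel_def by blast
      have z: "q $ j = 0" if "j \<noteq> i" for j
        using e[of j] that by (simp add: axis_def)
      then have "q = axis i (q $ i)" by (auto simp: vec_eq_iff axis_def)
      then have "pairing v q = v $ i * of_int (q $ i)" by (metis pairing_axis_right)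
      then have "q $ i = 0" using True i by simp
      then show False using z q(1) by (metis vec_eq_iff zero_index)
    qed
    then obtain y' where y': "pairing y' q = 1" "pairing y' (axis i 1) = 0"
      using pairing_interpolate by blast
    have "D y' (axis i 1) c = 0"
      by (rule one[OF vs(1,3)]) (use i y' in auto)
    then show ?thesis using one[OF y'(2)] y'(1) q(2) by simp
  qed
qed

text \<open>
  Suppose that \<open>D v s c \<noteq> 0\<close> for some \<open>c\<close> in the kernel of \<open>\<psi>\<close>. For suitable \<open>v\<close> and \<open>s\<close>, these
  operators form a finite-dimensional space, on which the \<open>D(u, 0) \<otimes> b\<close>, \<open>\<psi> b = 0\<close>, act by
  commuting operators. This yields a common eigenvector; its eigenvalues do not depend on \<open>v\<close>, \<open>s\<close>.
\<close>

lemma kernel_eigenvector: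
  assumes "pairing y q = 0" "q \<noteq> 0" "\<psi> b = 0" "D y q b \<noteq> 0"
  obtains c \<nu> where "\<psi> c = 0"
    "\<And>y q. pairing y q = 0 \<Longrightarrow> y \<noteq> 0 \<Longrightarrow> q \<noteq> 0 \<Longrightarrow> D y q c \<noteq> 0"
    "\<And>y q b. \<psi> b = 0 \<Longrightarrow> pairing y q = 0 \<Longrightarrow> q \<noteq> 0 \<Longrightarrow> D y q (b * c) = \<nu> b *\<^sub>C D y q c"
proof -
  obtain s :: "int ^ 'n" where s: "s \<noteq> 0" by (rule nonzero_exponent)
  obtain p where p: "\<not> parallel p s" using not_parallel_exists[OF rank s] .
  obtain v where v: "pairing v p = 1" "pairing v s = 0" using pairing_interpolate[OF p] by blast
  obtain u where u: "pairing u p = 0" "pairing u s = 1" using pairing_interpolate[OF p] by blast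
  have v0: "v \<noteq> 0" using v by auto
  define Y where "Y = {D v s c | c. \<psi> c = 0}"
  have sub: "cvs.subspace Y"
  proof (rule cvs.subspaceI)
    show "0 \<in> Y" unfolding Y_def using D_scale[of v s 0 0] psi_scale[of 0 0]
      by (auto intro!: exI[of _ 0])
    show "x + y \<in> Y" if xy: "x \<in> Y" "y \<in> Y" for x y
    proof -
      obtain c c' where "x = D v s c" "y = D v s c'" "\<psi> c = 0" "\<psi> c' = 0"
        using xy by (auto simp: Y_def)
      then have "x + y = D v s (c + c')" "\<psi> (c + c') = 0" by (simp_all add: D_add psi_add)
      then show ?thesis unfolding Y_def by blast
    qed
    show "k *\<^sub>C x \<in> Y" if x: "x \<in> Y" for k x
    proof -
      obtain c where "x = D v s c" "\<psi> c = 0" using x by (auto simp: Y_def)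
      then have "k *\<^sub>C x = D v s (k *\<^sub>C c)" "\<psi> (k *\<^sub>C c) = 0" by (simp_all add: D_scale psi_scale)
      then show ?thesis unfolding Y_def by blast
    qed
  qed
  obtain \<mu> where \<mu>: "wt \<mu> \<noteq> {0}" by (rule wt_nonzero_exists)
  obtain S where S: "S \<subseteq> wt \<mu>" "finite S" "wt \<mu> \<subseteq> cvs.span S"
    using fin_dim_basis[OF wt_fin_dim] by metis
  have fd: "fin_dim Y"
  proof (rule fin_dim_endo[OF S(2) wt_fin_dim[of "\<mu> + cvec s"] sub])
    show "app y w \<in> wt (\<mu> + cvec s)" if y: "y \<in> Y" and w: "w \<in> S" for y w
      using y w S(1) homog_shift[OF homog_D[OF v(2)]] by (auto simp: Y_def)
    show "y = 0" if y: "y \<in> Y" and 0: "\<forall>w\<in>S. app y w = 0" for y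
    proof (rule vanish_on_weight[OF \<mu>])
      show "app y w = 0" if w: "w \<in> wt \<mu>" for w
        by (rule clinear_vanish_on_span[OF app_linear, of S]) (use 0 w S(3) in auto)
      show "y * X r 1 = X r 1 * y" for r
        using y D_X_commute[OF _ v(2)] by (auto simp: Y_def)
    qed
  qed
  have "D v s b \<noteq> 0" using D_vanish[OF v(2) v0 _ assms(2,1)] assms(4) by blast
  then have nz: "Y \<noteq> {0}" using assms(3) by (auto simp: Y_def)
  define ad where "ad a = Endo (cmt a)" for a :: "'v endo"
  have ad: "app (ad a) x = cmt a x" for a x
    unfolding ad_def by (subst app_Endo) (auto intro!: clinearI)
  define T where "T = (\<lambda>b. ad (D u 0 b)) ` {b. \<psi> b = 0}"
  have uv: "cmt (D u 0 b) (D v s c) = D v s (b * c)" for b c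
    using D_D[of u 0 v s b c] u(2) v(2) by simp
  have "\<exists>x\<in>Y. x \<noteq> 0 \<and> (\<forall>a\<in>T. \<exists>\<alpha>. app a x = \<alpha> *\<^sub>C x)"
  proof (rule common_eigenvector[OF sub fd nz])
    show "app a x \<in> Y" if "a \<in> T" "x \<in> Y" for a x
      using that by (auto simp: T_def Y_def ad uv psi_mult)
    have comm: "D u 0 b * D u 0 b' = D u 0 b' * D u 0 b" for b b'
      using D_D[of u 0 u 0 b b'] by (simp add: cmt_eq_0_iff)
    have "ad (D u 0 b) * ad (D u 0 b') = ad (D u 0 b') * ad (D u 0 b)" for b b'
    proof (rule endo_eqI)
      fix x
      have "cmt (cmt (D u 0 b) (D u 0 b')) x = 0"
        using comm by (simp add: cmt_def)
      then show "app (ad (D u 0 b) * ad (D u 0 b')) x = app (ad (D u 0 b') * ad (D u 0 b)) x"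
        using cmt_jacobi[of "D u 0 b" "D u 0 b'" x] by (simp add: ad)
    qed
    then show "a * a' = a' * a" if "a \<in> T" "a' \<in> T" for a a'
      using that by (auto simp: T_def)
  qed
  then obtain c where c: "\<psi> c = 0" "D v s c \<noteq> 0"
    "\<forall>a\<in>T. \<exists>\<alpha>. app a (D v s c) = \<alpha> *\<^sub>C D v s c"
    by (auto simp: Y_def)
  have "\<exists>\<alpha>. D v s (b * c) = \<alpha> *\<^sub>C D v s c" if "\<psi> b = 0" for b
    using c(3) that by (auto simp: T_def ad uv)
  then obtain \<nu> where \<nu>: "\<And>b. \<psi> b = 0 \<Longrightarrow> D v s (b * c) = \<nu> b *\<^sub>C D v s c" by metis
  show ?thesis
  proof (rule that[OF c(1)])
    show "D y q c \<noteq> 0" if yq: "pairing y q = 0" "y \<noteq> 0" "q \<noteq> 0" for y q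
      using D_vanish[OF yq(1,2) _ s v(2)] c(2) by blast
    show "D y q (b * c) = \<nu> b *\<^sub>C D y q c" if b: "\<psi> b = 0" "pairing y q = 0" "q \<noteq> 0" for y q b
    proof -
      have "D v s (b * c - \<nu> b *\<^sub>C c) = 0" by (simp add: D_diff D_scale \<nu>[OF b(1)])
      then have "D y q (b * c - \<nu> b *\<^sub>C c) = 0" using D_vanish[OF v(2) v0 _ b(3,2)] by blast
      then show ?thesis by (simp add: D_diff D_scale)
    qed
  qed
qed

text \<open>
  The eigenvalues are zero: otherwise the adjoint action of \<open>D(u, 0) \<otimes> b\<close>, an operator satisfying
  a polynomial equation, would have the infinitely many eigenvalues \<open>k \<nu>\<close>, \<open>k \<ge> 1\<close>.
\<close>

lemma kernel_eigenvalue_zero: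
  assumes b: "\<psi> b = 0" and c: "\<psi> c = 0"
    "\<And>y q. pairing y q = 0 \<Longrightarrow> y \<noteq> 0 \<Longrightarrow> q \<noteq> 0 \<Longrightarrow> D y q c \<noteq> 0"
    "\<And>y q. pairing y q = 0 \<Longrightarrow> q \<noteq> 0 \<Longrightarrow> D y q (b * c) = \<nu> *\<^sub>C D y q c"
  shows "\<nu> = 0"
proof (rule ccontr)
  assume nu: "\<nu> \<noteq> 0"
  obtain s :: "int ^ 'n" where s: "s \<noteq> 0" by (rule nonzero_exponent)
  obtain p where p: "\<not> parallel p s" using not_parallel_exists[OF rank s] .
  obtain v where v: "pairing v p = 1" "pairing v s = 0" using pairing_interpolate[OF p] by blast
  obtain u where u: "pairing u p = 0" "pairing u s = 1" using pairing_interpolate[OF p] by blast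
  have v0: "v \<noteq> 0" using v by auto
  define a where "a = D u 0 b"
  obtain \<mu> where \<mu>: "wt \<mu> \<noteq> {0}" by (rule wt_nonzero_exists)
  have "homog 0 a" unfolding a_def by (rule homog_D) simp
  then obtain \<alpha>s where \<alpha>s: "\<And>w. w \<in> wt \<mu> \<Longrightarrow> app (shifts \<alpha>s a) w = 0"
    using shifts_annihilate[OF wt_fin_dim homog_zero_stable] by blast
  have "a * X r 1 = X r 1 * a" for r unfolding a_def by (rule D_X_commute) (simp_all add: b)
  then have a0: "shifts \<alpha>s a = 0"
    by (intro vanish_on_weight[OF \<mu> \<alpha>s] shifts_commute)
  define f where "f k = of_nat (Suc k) * \<nu>" for k
  \<comment> \<open>A multiple \<open>k \<nu>\<close> that is not the difference of two roots.\<close>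
  have "infinite (range f)"
    by (rule range_inj_infinite) (auto simp: inj_def f_def nu simp del: of_nat_Suc)
  moreover have "finite ((\<lambda>(x, y). x - y) ` (set \<alpha>s \<times> set \<alpha>s))" by simp
  ultimately obtain k where k: "f k \<notin> (\<lambda>(x, y). x - y) ` (set \<alpha>s \<times> set \<alpha>s)"
    by (meson finite_subset image_subsetI)
  define q :: "int ^ 'n" where "q = (\<chi> i. int (Suc k) * s $ i)"
  have q0: "q \<noteq> 0" using s by (auto simp: q_def vec_eq_iff simp del: of_nat_Suc)
  have pq: "pairing w q = of_nat (Suc k) * pairing w s" for w
    unfolding pairing_def sum_distrib_left by (rule sum.cong) (auto simp: q_def)
  define y where "y = D v q c"
  have vq: "pairing v q = 0" using pq[of v] v(2) by simp
  have y0: "y \<noteq> 0" unfolding y_def using c(2)[OF vq v0 q0] .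
  have "cmt a y = pairing u q *\<^sub>C D v q (b * c)"
    using D_D[of u 0 v q b c] vq by (simp add: a_def y_def D_scale_vector)
  also have "\<dots> = f k *\<^sub>C y"
    using c(3)[OF vq q0] u(2) by (simp add: y_def f_def pq del: of_nat_Suc)
  finally have ay: "(a - (\<alpha> + f k) *\<^sub>C 1) * y = y * (a - \<alpha> *\<^sub>C 1)" for \<alpha>
    by (simp add: cmt_def algebra_simps cscale_add_left)
  have "shifts (map (\<lambda>\<alpha>. \<alpha> + f k) \<beta>s) a * y = y * shifts \<beta>s a" for \<beta>s
  proof (induction \<beta>s)
    case (Cons \<beta> \<beta>s)
    have "shifts (map (\<lambda>\<alpha>. \<alpha> + f k) (\<beta> # \<beta>s)) a * y =
        (a - (\<beta> + f k) *\<^sub>C 1) * (shifts (map (\<lambda>\<alpha>. \<alpha> + f k) \<beta>s) a * y)"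
      by (simp add: mult.assoc)
    also have "\<dots> = (a - (\<beta> + f k) *\<^sub>C 1) * y * shifts \<beta>s a"
      by (simp only: Cons.IH mult.assoc)
    also have "\<dots> = y * shifts (\<beta> # \<beta>s) a"
      by (simp only: ay shifts_simps mult.assoc)
    finally show ?case .
  qed simp
  then have yz: "shifts (map (\<lambda>\<alpha>. \<alpha> + f k) \<alpha>s) a * y = 0" using a0 by simp
  have inj: "app (shifts (map (\<lambda>\<alpha>. \<alpha> + f k) \<beta>s) a) w = 0 \<Longrightarrow> w = 0" if "set \<beta>s \<subseteq> set \<alpha>s" for \<beta>s w
    using that
  proof (induction \<beta>s)
    case (Cons \<beta> \<beta>s)
    let ?w = "app (shifts (map (\<lambda>\<alpha>. \<alpha> + f k) \<beta>s) a) w"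
    have "\<beta> + f k \<notin> set \<alpha>s"
    proof
      assume "\<beta> + f k \<in> set \<alpha>s"
      then have "(\<beta> + f k, \<beta>) \<in> set \<alpha>s \<times> set \<alpha>s" using Cons.prems by simp
      then show False using k by (force simp: image_iff)
    qed
    moreover have "app a ?w = (\<beta> + f k) *\<^sub>C ?w" using Cons.prems(1) by simp
    ultimately have "?w = 0" using shifts_cancel[OF a0] by blast
    then show ?case using Cons by simp
  qed simp
  have "app (shifts (map (\<lambda>\<alpha>. \<alpha> + f k) \<alpha>s) a) (app y w) = 0" for w
    using yz by (metis app_simps(1,6))
  then have "app y w = 0" for w using inj by blast
  then have "y = 0" by (intro endo_eqI) simp
  then show False using y0 by blast
qed

text \<open>
  With eigenvalues zero, the operators \<open>D(v, r) \<otimes> c\<close>, \<open>r \<noteq> 0\<close>, commute with each other and are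
  nilpotent, as derivatives of the nilpotent part of \<open>D(u, 0) \<otimes> c\<close>. Their common kernel is a nonzero
  submodule, which is a contradiction.
\<close>

lemma D_kernel_zero:
  assumes "\<psi> b = 0" "pairing y q = 0" "q \<noteq> 0"
  shows "D y q b = 0"
proof (rule ccontr)
  assume nz: "D y q b \<noteq> 0"
  obtain c \<nu> where c: "\<psi> c = 0"
    "\<And>y q. pairing y q = 0 \<Longrightarrow> y \<noteq> 0 \<Longrightarrow> q \<noteq> 0 \<Longrightarrow> D y q c \<noteq> 0"
    "\<And>y q b. \<psi> b = 0 \<Longrightarrow> pairing y q = 0 \<Longrightarrow> q \<noteq> 0 \<Longrightarrow> D y q (b * c) = \<nu> b *\<^sub>C D y q c"
    using kernel_eigenvector[OF assms(2,3,1) nz] by blast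
  have "\<nu> b = 0" if "\<psi> b = 0" for b
    by (rule kernel_eigenvalue_zero[of b c]) (use that c in auto)
  then have kc: "D y q (b * c) = 0" if "\<psi> b = 0" "pairing y q = 0" "q \<noteq> 0" for y q b
    using c(3) that by simp
  have act: "cmt (D u r b) (D v s c) = \<psi> b *\<^sub>C D (pairing u s *\<^sub>C v - pairing v r *\<^sub>C u) (r + s) c"
    if ur: "pairing u r = 0" and vs: "pairing v s = 0" and n0: "r \<noteq> 0 \<or> s \<noteq> 0" for u r b v s
  proof -
    let ?w = "pairing u s *\<^sub>C v - pairing v r *\<^sub>C u"
    obtain b' where b': "b = \<psi> b *\<^sub>C 1 + b'" "\<psi> b' = 0" by (rule psi_split)
    have "b * c = \<psi> b *\<^sub>C c + b' * c"
      by (subst b'(1)) (simp add: distrib_right cscale_mult)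
    moreover have "D ?w (r + s) (b' * c) = 0"
    proof (cases "r + s = 0")
      case True
      then have "pairing u s = 0" "pairing v r = 0"
        using ur vs by (metis add_0 pairing_simps(1,3), metis add.right_neutral pairing_simps(1,3))
      then show ?thesis by simp
    next
      case False
      have "pairing ?w (r + s) = 0" using ur vs by simp
      then show ?thesis using kc[OF b'(2)] False by blast
    qed
    ultimately show ?thesis using D_D[OF ur vs, of b c] by (simp add: D_add D_scale)
  qed
  have comm: "D u r c * D v s c = D v s c * D u r c" if "pairing u r = 0" "pairing v s = 0" for u r v s
  proof (cases "r = 0 \<and> s = 0")
    case True
    then show ?thesis using D_D[OF that, of c c] by (simp add: cmt_eq_0_iff)
  next
    case False
    then have "cmt (D u r c) (D v s c) = 0" using act[OF that, of c] c(1) by simp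
    then show ?thesis by (simp add: cmt_eq_0_iff)
  qed
  have act0: "cmt (D v r b) (D u 0 c) = (- pairing u r * \<psi> b) *\<^sub>C D v r c"
    if vr: "pairing v r = 0" for v r b u
  proof (cases "r = 0")
    case True
    then show ?thesis using D_D[of v 0 u 0 b c] by simp
  next
    case False
    then show ?thesis
      using act[OF vr, of u 0 b] D_scale_vector[OF vr, of "- pairing u r" c] by (simp add: mult.commute)
  qed
  have nilp: "nilp (D v r c)" if vr: "pairing v r = 0" and r: "r \<noteq> 0" for v r
  proof -
    obtain p where p: "\<not> parallel p r" using not_parallel_exists[OF rank r] .
    obtain u where u: "pairing u r = 1" using pairing_interpolate[OF p] by blast
    let ?z = "D u 0 c"
    have "homog 0 ?z" by (rule homog_D) simp
    moreover have "cmt (D u' r' b) ?z * ?z = ?z * cmt (D u' r' b) ?z" if "pairing u' r' = 0" for u' r' b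
      using act0[OF that, of b u] comm[OF that, of u 0] by simp
    moreover have "X s b * ?z = ?z * X s b" for s b
      using D_X_commute[OF c(1), of u 0 s b] by simp
    ultimately obtain \<alpha> where \<alpha>: "(?z - \<alpha> *\<^sub>C 1) ^ M = 0"
      by (rule one_eigenvalue[of ?z])
    let ?n = "?z - \<alpha> *\<^sub>C 1"
    have n: "cmt (D v r 1) ?n = (-1) *\<^sub>C D v r c"
      using act0[OF vr, of 1 u] u by simp
    have "cmt (D v r 1) (D v r c) = 0"
      using act[OF vr vr, of 1] r vr by simp
    moreover have "?n * D v r c = D v r c * ?n"
      using comm[OF vr, of u 0] by (simp add: algebra_simps)
    ultimately have "nilp (cmt (D v r 1) ?n)"
      using n \<alpha> by (intro nilp_derivative[of "{0, ?n, D v r c, (-1) *\<^sub>C D v r c}"])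
        (auto simp: nilp_def)
    then show ?thesis using nilp_scale[of "(-1) *\<^sub>C D v r c" "-1"] n by simp
  qed
  define G where "G = {X (- r) 1 * D v r c | r v. r \<noteq> 0 \<and> pairing v r = 0}"
  obtain \<mu> where \<mu>: "wt \<mu> \<noteq> {0}" by (rule wt_nonzero_exists)
  have XD: "D v r c * X s 1 = X s 1 * D v r c" if "pairing v r = 0" for v r s
    using D_X_commute[OF c(1) that] .
  have "\<exists>w\<in>wt \<mu>. w \<noteq> 0 \<and> (\<forall>a\<in>G. \<exists>\<alpha>. app a w = \<alpha> *\<^sub>C w)"
  proof (rule common_eigenvector[OF wt_subspace wt_fin_dim \<mu>])
    show "app a w \<in> wt \<mu>" if a: "a \<in> G" and w: "w \<in> wt \<mu>" for a w
    proof -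
      obtain r v where r: "a = X (- r) 1 * D v r c" "pairing v r = 0" using a by (auto simp: G_def)
      have "homog (- r + r) a"
        unfolding r(1) by (intro homog_mult homog_X homog_D r(2))
      then show ?thesis using homog_zero_stable w by simp
    qed
    show "a * a' = a' * a" if a: "a \<in> G" "a' \<in> G" for a a'
    proof -
      obtain r v s w where r: "a = X (- r) 1 * D v r c" "pairing v r = 0"
        "a' = X (- s) 1 * D w s c" "pairing w s = 0" using a by (auto simp: G_def)
      have "a * a' = X (- r) 1 * X (- s) 1 * (D v r c * D w s c)"
        using XD[OF r(2)] by (metis mult.assoc r(1,3))
      also have "\<dots> = X (- s) 1 * X (- r) 1 * (D w s c * D v r c)"
        using X_X comm r(2,4) by metis
      also have "\<dots> = a' * a"
        using XD[OF r(4)] by (metis mult.assoc r(1,3))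
      finally show ?thesis .
    qed
  qed
  then obtain w where w: "w \<noteq> 0" "\<forall>a\<in>G. \<exists>\<alpha>. app a w = \<alpha> *\<^sub>C w" by blast
  define K where "K = {w. \<forall>v r. r \<noteq> 0 \<longrightarrow> pairing v r = 0 \<longrightarrow> app (D v r c) w = 0}"
  have "app (D v r c) w = 0" if r: "r \<noteq> 0" "pairing v r = 0" for v r
  proof -
    let ?a = "X (- r) 1 * D v r c"
    have "?a \<in> G" using r by (auto simp: G_def)
    then obtain \<alpha> where \<alpha>: "app ?a w = \<alpha> *\<^sub>C w" using w(2) by blast
    have "nilp ?a"
      using nilp_mult[OF XD[OF r(2)] nilp[OF r(2,1)], of "- r"] XD[OF r(2)] by simp
    then have "\<alpha> = 0" using nilp_eigenvalue[OF _ \<alpha> w(1)] by blast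
    then have "app (X (- r) 1) (app (D v r c) w) = 0" using \<alpha> by simp
    then show ?thesis using X_injective[of "- r"] r(1) by simp
  qed
  then have wK: "w \<in> K" by (simp add: K_def)
  have K: "x \<in> K" for x
  proof (rule submodule_UNIV[OF _ _ _ wK w(1)])
    show "cvs.subspace K" by (auto simp: cvs.subspace_def K_def)
    show "app (X s b) x \<in> K" if x: "x \<in> K" for s b x
      using x app_commute[OF D_X_commute[OF c(1)], of _ _ s b x] by (simp add: K_def)
    show "app (D u r b) x \<in> K" if ur: "pairing u r = 0" and x: "x \<in> K" for u r b x
    proof -
      have "app (D v s c) (app (D u r b) x) = 0" if s: "s \<noteq> 0" "pairing v s = 0" for v s
      proof -
        let ?w = "pairing u s *\<^sub>C v - pairing v r *\<^sub>C u"
        have "app (D ?w (r + s) c) x = 0"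
        proof (cases "r + s = 0")
          case True
          then have "pairing u s = 0" "pairing v r = 0"
            using ur s(2)
            by (metis add_0 pairing_simps(1,3), metis add.right_neutral pairing_simps(1,3))
          then show ?thesis by simp
        next
          case False
          moreover have "pairing ?w (r + s) = 0" using ur s by simp
          ultimately show ?thesis using x unfolding K_def by blast
        qed
        moreover have "app (D v s c) x = 0" using x s by (simp add: K_def)
        ultimately show ?thesis
          using act[OF ur s(2), of b] s(1) by (simp add: app_cmt[of "D v s c" "D u r b"])
      qed
      then show ?thesis by (simp add: K_def)
    qed
  qed
  have "y \<noteq> 0" using nz by auto
  moreover have "D y q c = 0"
    using K assms by (intro endo_eqI) (auto simp: K_def)
  ultimately show False using c(2) assms by blast
qed

lemma D_kernel_scalar:
  assumes "\<psi> b = 0"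
  shows "\<exists>\<alpha>. D u 0 b = \<alpha> *\<^sub>C 1"
proof -
  have "cmt (D v r b') (D u 0 b) = 0" if vr: "pairing v r = 0" for v r b'
  proof (cases "r = 0")
    case True
    then show ?thesis using D_D[of v 0 u 0 b' b] by simp
  next
    case False
    have "\<psi> (b' * b) = 0" using assms by (simp add: psi_mult)
    then have "D v r (b' * b) = 0" using D_kernel_zero False vr by blast
    then show ?thesis
      using D_D[OF vr, of u 0 b' b] D_scale_vector[OF vr, of "- pairing u r"] by simp
  qed
  then show ?thesis using schur[of "D u 0 b"] D_X_commute[OF assms, of u 0] by (metis pairing_simps(1))
qed

theorem irreducible_evaluated:
  assumes W: "cvs.subspace W"
    and D: "\<And>u r w. pairing u r = 0 \<Longrightarrow> w \<in> W \<Longrightarrow> app (D u r 1) w \<in> W"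
    and X: "\<And>s w. w \<in> W \<Longrightarrow> app (X s 1) w \<in> W"
  shows "W = {0} \<or> W = UNIV"
proof (rule irreducible[OF W])
  note sub = cvs.subspace_add[OF W] cvs.subspace_scale[OF W]
  fix w assume w: "w \<in> W"
  show "app (X s b) w \<in> W" for s b
  proof (cases "s = 0")
    case True
    have "cmt (D u r c) (X 0 b) = 0" if "pairing u r = 0" for u r c
      using D_X[OF that] by simp
    then obtain \<alpha> where "X 0 b = \<alpha> *\<^sub>C 1" using schur[of "X 0 b"] X_X by metis
    then show ?thesis using True w sub by simp
  next
    case False
    have "app (X s b) w = \<psi> b *\<^sub>C app (X s 1) w" by (simp add: X_eval[OF False, of b])
    then show ?thesis using X[OF w] sub by simp
  qed
  show "app (D u r b) w \<in> W" if ur: "pairing u r = 0" for u r b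
  proof -
    obtain b' where b': "b = \<psi> b *\<^sub>C 1 + b'" "\<psi> b' = 0" by (rule psi_split)
    have "\<exists>\<alpha>. D u r b' = \<alpha> *\<^sub>C 1"
    proof (cases "r = 0")
      case True
      then show ?thesis using D_kernel_scalar[OF b'(2)] by blast
    next
      case False
      then show ?thesis using D_kernel_zero[OF b'(2) ur] by (auto intro: exI[of _ 0])
    qed
    then obtain \<alpha> where "D u r b' = \<alpha> *\<^sub>C 1" by blast
    then have "D u r b = \<psi> b *\<^sub>C D u r 1 + \<alpha> *\<^sub>C 1"
      by (subst b'(1)) (simp add: D_add D_scale)
    then show ?thesis using D[OF ur w] w sub by simp
  qed
qed

end

section \<open>The Lie algebra and its modules in terms of operators\<close>

lemma clinear_sum: "clinear f \<Longrightarrow> f (sum g S) = (\<Sum>i\<in>S. f (g i))"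
  by (induction S rule: infinite_finite_induct) (simp_all add: clinearD clinear_zero)

lemma clinear_range_subspace: "clinear f \<Longrightarrow> cvs.subspace (range f)"
  by (rule cvs.subspaceI)
    (auto simp: image_iff clinear_zero clinearD[symmetric] intro: exI[of _ 0])

lemma sl_D_linear_at_0: "clinear (\<lambda>u. sl_D u 0 :: 'n::finite sdiff_laurent)"
  by (rule clinearI; transfer)
    (simp_all add: vf_D_def vec_eq_iff single_add cscale_poly_mapping_conv_mult mult_single cscale_complex_def)

lemma sl_D_scale:
  assumes "pairing u r = 0"
  shows "sl_D (c *\<^sub>C u) r = c *\<^sub>C sl_D u r"
  using assms
  by transfer
    (simp add: vf_D_def vec_eq_iff cscale_poly_mapping_conv_mult mult_single cscale_complex_def)

lemma axis_decomposition: "u = (\<Sum>i\<in>UNIV. u $ i *\<^sub>C axis i (1 :: complex))"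
proof -
  have "(\<Sum>i\<in>UNIV. u $ i *\<^sub>C axis i (1 :: complex)) $ j = (\<Sum>i\<in>UNIV. if i = j then u $ i else 0)" for j
    unfolding sum_component
    by (rule sum.cong) (auto simp: axis_def cscale_complex_def)
  then show ?thesis by (simp add: vec_eq_iff)
qed

lemma cartan_eq: "cartan = range (\<lambda>u :: complex ^ 'n::finite. sl_D u 0)"
proof
  show "cartan \<subseteq> range (\<lambda>u. sl_D u 0)"
    unfolding cartan_def
    by (rule cvs.span_minimal[OF _ clinear_range_subspace[OF sl_D_linear_at_0]]) blast
  have "sl_D u 0 \<in> cartan" for u :: "complex ^ 'n"
  proof -
    have "sl_D u 0 = (\<Sum>i\<in>UNIV. u $ i *\<^sub>C sl_D (axis i 1) 0)"
      by (subst axis_decomposition)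
        (simp only: clinear_sum[OF sl_D_linear_at_0] clinearD(2)[OF sl_D_linear_at_0])
    then show ?thesis
      unfolding cartan_def by (simp add: cvs.span_sum cvs.span_scale cvs.span_base)
  qed
  then show "range (\<lambda>u :: complex ^ 'n. sl_D u 0) \<subseteq> cartan" by (intro image_subsetI)
qed

lemma sl_span:
  "x \<in> cvs.span ({sl_D u r | u r. pairing u r = 0} \<union> range sl_t)" (is "_ \<in> cvs.span ?G")
  for x :: "'n::finite sdiff_laurent"
proof -
  have inv: "sl_pair (Abs_sdiff_laurent (Y, f)) = (Y, f)" if "Y \<in> sdiff" for Y :: "'n vfield" and f
    using that by (simp add: Abs_sdiff_laurent_inverse)
  have zero: "(0 :: 'n vfield) \<in> sdiff" by (simp add: sdiff_def cvs.span_zero)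
  have t: "Abs_sdiff_laurent (0, f) \<in> cvs.span ?G" for f :: "'n laurent"
  proof (induction f rule: poly_mapping_single_induct)
    case (single k c)
    have "Abs_sdiff_laurent (0, Poly_Mapping.single k c) = c *\<^sub>C sl_t k"
      by (simp add: sl_pair_inject[symmetric] inv[OF zero] cscale_sdiff_laurent.rep_eq sl_t.rep_eq
          cscale_poly_mapping_conv_mult mult_single)
    then show ?case by (simp add: cvs.span_scale cvs.span_base)
  next
    case (add p q)
    have "Abs_sdiff_laurent (0, p + q) = Abs_sdiff_laurent (0, p) + Abs_sdiff_laurent (0, q)"
      by (simp add: sl_pair_inject[symmetric] inv[OF zero] plus_sdiff_laurent.rep_eq)
    then show ?case using add by (simp add: cvs.span_add)
  qed
  have D: "Y \<in> sdiff \<and> Abs_sdiff_laurent (Y, 0) \<in> cvs.span ?G" if Y: "Y \<in> sdiff" for Y :: "'n vfield"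
    using Y[unfolded sdiff_def]
  proof (induction rule: cvs.span_induct_alt)
    case base
    show ?case using t zero by blast
  next
    case (step c x y)
    then obtain u r where x: "x = vf_D u r" and ur: "pairing u r = 0" by blast
    have s: "x \<in> sdiff" "y \<in> sdiff" using step by (auto simp: sdiff_def cvs.span_base)
    then have cs: "c *\<^sub>C x + y \<in> sdiff" by (simp add: sdiff_def cvs.span_add cvs.span_scale)
    have "Abs_sdiff_laurent (c *\<^sub>C x + y, 0) = c *\<^sub>C sl_D u r + Abs_sdiff_laurent (y, 0)"
      using ur by (simp add: sl_pair_inject[symmetric] inv[OF cs, unfolded x] inv[OF s(2)]
          plus_sdiff_laurent.rep_eq cscale_sdiff_laurent.rep_eq sl_D.rep_eq x)
    moreover have "sl_D u r \<in> ?G" using ur by blast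
    ultimately show ?case using step(2) cs by (simp only: cvs.span_add cvs.span_scale cvs.span_base)
  qed
  obtain Y f where p: "sl_pair x = (Y, f)" "Y \<in> sdiff" using sl_pair[of x] by auto
  then have "x = Abs_sdiff_laurent (Y, 0) + Abs_sdiff_laurent (0, f)"
    by (simp add: sl_pair_inject[symmetric] inv zero plus_sdiff_laurent.rep_eq)
  then show ?thesis using t D[OF p(2)] by (simp only: cvs.span_add)
qed

lemma tens_zero_left: "0 \<otimes> b = 0"
  using tens_cscale_left[of 0 0 b] by simp

lemma lie_submoduleI:
  fixes \<rho> :: "('n::finite sdiff_laurent, 'b::complex_comm_algebra) tensor \<Rightarrow> 'v::complex_space \<Rightarrow> 'v"
  assumes "lie_module \<rho>" and W: "cvs.subspace W"
    and D: "\<And>u r b w. pairing u r = 0 \<Longrightarrow> w \<in> W \<Longrightarrow> \<rho> (sl_D u r \<otimes> b) w \<in> W"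
    and X: "\<And>s b w. w \<in> W \<Longrightarrow> \<rho> (sl_t s \<otimes> b) w \<in> W"
  shows "lie_submodule \<rho> W"
proof -
  have lin: "clinear (\<lambda>T. \<rho> T w)" for w
    using assms(1) by (simp add: lie_module_def cbilinear_def)
  have "\<rho> T w \<in> W" if w: "w \<in> W" for T w
  proof (induction T rule: tensor_induct)
    case (tens x b)
    show ?case using sl_span[of x]
    proof (induction rule: cvs.span_induct_alt)
      case base
      show ?case using clinear_zero[OF lin] cvs.subspace_0[OF W] by (simp add: tens_zero_left)
    next
      case (step c x y)
      then have "\<rho> (x \<otimes> b) w \<in> W" using D X w by blast
      then show ?case
        using step cvs.subspace_add[OF W] cvs.subspace_scale[OF W]
        by (simp add: tens_add_left tens_cscale_left clinearD[OF lin])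
    qed
  next
    case (add T T')
    then show ?case using cvs.subspace_add[OF W] by (simp add: clinearD[OF lin])
  qed
  then show ?thesis using W by (simp add: lie_submodule_def)
qed

text \<open>The weight as a functional: the linear functional on \<open>cartan\<close> with value \<open>l $ i\<close> at \<open>d\<^sub>i\<close>, extended by zero.\<close>

definition functional :: "complex ^ 'n::finite \<Rightarrow> 'n sdiff_laurent \<Rightarrow> complex"
  where "functional l h = (if h \<in> cartan
    then \<Sum>i\<in>UNIV. Poly_Mapping.lookup (fst (sl_pair h) $ i) 0 * l $ i else 0)"

lemma functional_sl_D: "functional l (sl_D u 0) = (\<Sum>i\<in>UNIV. u $ i * l $ i)"
  by (simp add: functional_def cartan_eq sl_D.rep_eq vf_D_def)

lemma functional_cartan_dual: "functional l \<in> cartan_dual"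
proof -
  have "functional l (x + y) = functional l x + functional l y" "functional l (c *\<^sub>C x) = c * functional l x"
    if xy: "x \<in> cartan" "y \<in> cartan" for x y c
  proof -
    obtain u v where "x = sl_D u 0" "y = sl_D v 0" using xy by (auto simp: cartan_eq)
    then show "functional l (x + y) = functional l x + functional l y"
      "functional l (c *\<^sub>C x) = c * functional l x"
      by (simp_all add: clinearD[OF sl_D_linear_at_0, symmetric] functional_sl_D distrib_right
          sum.distrib sum_distrib_left cscale_complex_def mult.assoc)
  qed
  then show ?thesis by (auto simp: cartan_dual_def functional_def)
qed

lemma functional_surj:
  assumes "l \<in> cartan_dual"
  obtains m where "\<And>u. l (sl_D u 0) = (\<Sum>i\<in>UNIV. u $ i * m $ i)"
proof -
  have lin: "clinear (\<lambda>u. l (sl_D u 0))"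
    using assms by (intro clinearI)
      (auto simp: cartan_dual_def cartan_eq clinearD[OF sl_D_linear_at_0] cscale_complex_def)
  have e: "l (sl_D u 0) = (\<Sum>i\<in>UNIV. u $ i * l (sl_D (axis i 1) 0))" for u
    by (subst axis_decomposition)
      (simp only: clinear_sum[OF lin] clinearD(2)[OF lin] cscale_complex_def)
  show ?thesis
    by (rule that[of "\<chi> i. l (sl_D (axis i 1) 0)"], unfold vec_lambda_beta) (rule e)
qed

lemma uniformly_bounded_irreducible_rep:
  fixes \<rho> :: "('n::finite sdiff_laurent, 'b::complex_comm_algebra) tensor \<Rightarrow> 'v::complex_space \<Rightarrow> 'v"
  assumes N: "CARD('n) \<ge> 2"
    and irr: "irreducible_lie_module \<rho>"
    and ub: "uniformly_bounded_weight_module \<rho>"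
    and nz: "\<exists>s. s \<noteq> 0 \<and> (\<exists>w. \<rho> (sl_t s \<otimes> 1) w \<noteq> 0)"
  obtains M where "bounded_irreducible_rep
    (\<lambda>u r b. Endo (\<rho> (sl_D u r \<otimes> b))) (\<lambda>s b. Endo (\<rho> (sl_t s \<otimes> b))) M"
proof -
  have mod: "lie_module \<rho>" using irr by (simp add: irreducible_lie_module_def)
  then have lin: "clinear (\<rho> T)" "clinear (\<lambda>T. \<rho> T w)" for T w
    by (simp_all add: lie_module_def cbilinear_def)
  have app: "app (Endo (\<rho> T)) = \<rho> T" for T by (rule app_Endo[OF lin(1)])
  have add: "Endo (\<rho> (S + T)) = Endo (\<rho> S) + Endo (\<rho> T)" for S T
    by (rule endo_eqI) (simp add: app clinearD[OF lin(2)])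
  have scale: "Endo (\<rho> (c *\<^sub>C T)) = c *\<^sub>C Endo (\<rho> T)" for c T
    by (rule endo_eqI) (simp add: app clinearD[OF lin(2)])
  have br: "cmt (Endo (\<rho> S)) (Endo (\<rho> T)) = Endo (\<rho> (lie S T))" for S T
    by (rule endo_eqI) (use mod in \<open>simp add: app cmt_def lie_module_def\<close>)
  obtain M where M: "\<And>l. l \<in> cartan_dual \<Longrightarrow> dim_at_most (weight_space \<rho> l) M"
    using ub by (auto simp: uniformly_bounded_weight_module_def)
  let ?D = "\<lambda>u r b. Endo (\<rho> (sl_D u r \<otimes> b))"
  have ws: "weight_vectors ?D m = weight_space \<rho> l" if "\<And>u. l (sl_D u 0) = (\<Sum>i\<in>UNIV. u $ i * m $ i)" for l m
    using that by (auto simp: weight_vectors_def weight_space_def cartan_eq app)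
  have "bounded_irreducible_rep ?D (\<lambda>s b. Endo (\<rho> (sl_t s \<otimes> b))) M"
  proof
    show "2 \<le> CARD('n)" by (rule N)
    show "Endo (\<rho> (sl_D (c *\<^sub>C u) r \<otimes> b)) = c *\<^sub>C Endo (\<rho> (sl_D u r \<otimes> b))"
      if "pairing u r = 0" for u r c b
      by (simp add: sl_D_scale[OF that] tens_cscale_left scale)
    show "Endo (\<rho> (sl_D u r \<otimes> (b + b'))) = Endo (\<rho> (sl_D u r \<otimes> b)) + Endo (\<rho> (sl_D u r \<otimes> b'))"
      "Endo (\<rho> (sl_D u r \<otimes> (c *\<^sub>C b))) = c *\<^sub>C Endo (\<rho> (sl_D u r \<otimes> b))"
      "Endo (\<rho> (sl_t s \<otimes> (b + b'))) = Endo (\<rho> (sl_t s \<otimes> b)) + Endo (\<rho> (sl_t s \<otimes> b'))"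
      "Endo (\<rho> (sl_t s \<otimes> (c *\<^sub>C b))) = c *\<^sub>C Endo (\<rho> (sl_t s \<otimes> b))" for u r s b b' c
      by (simp_all add: tens_add_right tens_cscale_right add scale)
    show "cmt (?D u r b) (?D v s b') =
        ?D (pairing u s *\<^sub>C v - pairing v r *\<^sub>C u) (r + s) (b * b')"
      if "pairing u r = 0" "pairing v s = 0" for u r v s b b'
      by (simp only: br lie_tens lie_sl_D_D[OF that])
    show "cmt (?D u r b) (Endo (\<rho> (sl_t s \<otimes> b'))) =
        pairing u s *\<^sub>C Endo (\<rho> (sl_t (r + s) \<otimes> (b * b')))"
      if "pairing u r = 0" for u r s b b'
      by (simp only: br lie_tens lie_sl_D_t[OF that] tens_cscale_left scale)
    show "Endo (\<rho> (sl_t r \<otimes> b)) * Endo (\<rho> (sl_t s \<otimes> b')) =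
        Endo (\<rho> (sl_t s \<otimes> b')) * Endo (\<rho> (sl_t r \<otimes> b))" for r s b b'
    proof -
      have "Endo (\<rho> (0 :: ('n sdiff_laurent, 'b) tensor)) = 0" using scale[of 0 0] by simp
      then show ?thesis
        by (simp add: cmt_eq_0_iff[symmetric] br lie_tens lie_sl_t_t tens_zero_left)
    qed
    show "W = {0} \<or> W = UNIV"
      if W: "cvs.subspace W"
        "\<And>u r b w. pairing u r = 0 \<Longrightarrow> w \<in> W \<Longrightarrow> app (?D u r b) w \<in> W"
        "\<And>s b w. w \<in> W \<Longrightarrow> app (Endo (\<rho> (sl_t s \<otimes> b))) w \<in> W" for W
      using irr lie_submoduleI[OF mod W(1)] W(2,3) by (simp add: irreducible_lie_module_def app)
    show "\<exists>w::'v. w \<noteq> 0" using irr by (auto simp: irreducible_lie_module_def)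
    show "cvs.span (\<Union>l. weight_vectors ?D l) = UNIV"
    proof -
      have "v \<in> cvs.span (\<Union>l. weight_vectors ?D l)" for v
      proof -
        obtain f where f: "{i. f i \<noteq> 0} \<subseteq> cartan_dual" "\<forall>i\<in>cartan_dual. f i \<in> weight_space \<rho> i"
          "v = (\<Sum>i | f i \<noteq> 0. f i)"
          using ub unfolding uniformly_bounded_weight_module_def internal_direct_sum_def by metis
        have "f i \<in> (\<Union>l. weight_vectors ?D l)" if i: "f i \<noteq> 0" for i
        proof -
          have "i \<in> cartan_dual" using f(1) i by blast
          obtain m where "\<And>u. i (sl_D u 0) = (\<Sum>j\<in>UNIV. u $ j * m $ j)"
            by (rule functional_surj[OF \<open>i \<in> cartan_dual\<close>]) blast
          then have "weight_vectors ?D m = weight_space \<rho> i" by (rule ws)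
          moreover have "f i \<in> weight_space \<rho> i" using f(2) \<open>i \<in> cartan_dual\<close> by blast
          ultimately show ?thesis by (intro UN_I[of m]) simp_all
        qed
        then show ?thesis unfolding f(3) by (intro cvs.span_sum cvs.span_base) simp
      qed
      then show ?thesis by blast
    qed
    show "dim_at_most (weight_vectors ?D l) M" for l
      using M[OF functional_cartan_dual[of l]] ws[OF functional_sl_D, of l] by simp
    show "\<exists>s. s \<noteq> 0 \<and> Endo (\<rho> (sl_t s \<otimes> 1)) \<noteq> 0"
      using nz by (metis app app_simps(1))
  qed
  then show ?thesis by (rule that)
qed

lemma uea_orbit_submodule:
  fixes \<sigma> :: "'g::complex_lie_algebra \<Rightarrow> 'v::complex_space \<Rightarrow> 'v" and v :: 'v
  assumes mod: "lie_module \<sigma>"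
  defines "W \<equiv> range (\<lambda>u. uea_act \<sigma> u v)"
  shows "cvs.subspace W" "w \<in> W \<Longrightarrow> \<sigma> x w \<in> W" "v \<in> W"
proof -
  have W: "W = range (\<lambda>p. free_act \<sigma> p v)"
  proof -
    have "uea_act \<sigma> u v \<in> range (\<lambda>p. free_act \<sigma> p v)" for u by (simp add: uea_act_def)
    moreover have "free_act \<sigma> p v \<in> W" for p
      unfolding W_def uea_act_abs[OF mod, symmetric] by blast
    ultimately show ?thesis unfolding W_def by blast
  qed
  show "cvs.subspace W" unfolding W by (rule clinear_range_subspace[OF free_act_linear])
  show "\<sigma> x w \<in> W" if w: "w \<in> W"
  proof -
    obtain u where "w = uea_act \<sigma> u v" using w by (auto simp: W_def)
    then have "\<sigma> x w = uea_act \<sigma> (uea_of x * u) v"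
      by (simp add: uea_act_mult[OF mod] uea_act_of[OF mod])
    then show ?thesis by (simp add: W_def)
  qed
  have "v = free_act \<sigma> (Poly_Mapping.single 0 1) v"
    by (simp only: free_act_def lin_ext_single letters_zero foldr.simps id_apply cscale_one)
  then show "v \<in> W" unfolding W by blast
qed

theorem lemma3p16:
  fixes \<rho> :: "('n::finite sdiff_laurent, 'b::complex_comm_algebra) tensor
      \<Rightarrow> 'v::complex_space \<Rightarrow> 'v"
    and v :: 'v
  assumes "CARD('n) \<ge> 2"
    and "finitely_generated_algebra TYPE('b)"
    and "irreducible_lie_module \<rho>"
    and "uniformly_bounded_weight_module \<rho>"
    and "\<exists>w. \<rho> (sl_t 0 \<otimes> 1) w \<noteq> 0"
    and "\<exists>s. s \<noteq> 0 \<and> (\<exists>w. \<rho> (sl_t s \<otimes> 1) w \<noteq> 0)"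
    and "v \<noteq> 0"
  shows "range (\<lambda>u. uea_act (\<lambda>x. \<rho> (x \<otimes> 1)) u v) = UNIV"
proof -
  let ?\<sigma> = "\<lambda>x. \<rho> (x \<otimes> 1)"
  let ?W = "range (\<lambda>u. uea_act ?\<sigma> u v)"
  have mod: "lie_module \<rho>" using assms(3) by (simp add: irreducible_lie_module_def)
  then have lin: "clinear (\<rho> T)" "clinear (\<lambda>T. \<rho> T w)" for T w
    by (simp_all add: lie_module_def cbilinear_def)
  have "lie_module ?\<sigma>"
    unfolding lie_module_def cbilinear_def
  proof (intro conjI allI)
    show "clinear (\<rho> (x \<otimes> 1))" for x by (rule lin)
    show "clinear (\<lambda>x. \<rho> (x \<otimes> 1) w)" for w
      by (rule clinearI) (simp_all add: tens_add_left tens_cscale_left clinearD[OF lin(2)])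
    show "\<rho> (lie x y \<otimes> 1) w = \<rho> (x \<otimes> 1) (\<rho> (y \<otimes> 1) w) - \<rho> (y \<otimes> 1) (\<rho> (x \<otimes> 1) w)" for x y w
      using mod lie_tens[of x 1 y "1 :: 'b"] unfolding lie_module_def by (metis mult_1)
  qed
  note W = uea_orbit_submodule[OF this, where v = v]
  obtain M where "bounded_irreducible_rep
      (\<lambda>u r b. Endo (\<rho> (sl_D u r \<otimes> b))) (\<lambda>s b. Endo (\<rho> (sl_t s \<otimes> b))) M"
    using uniformly_bounded_irreducible_rep[OF assms(1,3,4,6)] by blast
  then interpret bounded_irreducible_rep
    "\<lambda>u r b. Endo (\<rho> (sl_D u r \<otimes> b))" "\<lambda>s b. Endo (\<rho> (sl_t s \<otimes> b))" M .
  have "?W = {0} \<or> ?W = UNIV"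
    by (rule irreducible_evaluated[OF W(1)]) (auto simp only: app_Endo[OF lin(1)] intro!: W(2))
  then show ?thesis using W(3) assms(7) by auto
qed

end
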